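(* Let $n \ge 1$ and let $\phi$ be a rational inner function on $\mathbb{D}^n$. Suppose that $\frac{\partial \phi}{\partial z_k} \in H^{\alpha_k}(\mathbb{D}^n)$, where $0 < \alpha_k \leq 2$, for each $k = 1, \ldots, n$. Then for every choice of $(c_1, \ldots, c_n)$ with $c_j > 0$ for all $j$ satisfying $\sum_{i=1}^n c_i^{-1} = 1$, we have $\phi \in \mathcal{D}_{\frac{\alpha_1}{c_1}, \ldots, \frac{\alpha_n}{c_n}}(\mathbb{D}^n)$. In particular, $\phi \in \mathcal{D}_{\frac{\alpha_1}{n}, \ldots, \frac{\alpha_n}{n}}(\mathbb{D}^n)$.
   Context: $\mathbb{D}^n = \{z \in \mathbb{C}^n : |z_j| < 1,\ j = 1,\ldots,n\}$ is the unit polydisc and $\mathbb{T}^n$ is the $n$-torus. A rational inner function (RIF) on $\mathbb{D}^n$ is a bounded holomorphic function $\phi : \mathbb{D}^n \to \mathbb{C}$ that is a quotient of two polynomials in $\mathbb{C}[z_1,\ldots,z_n]$ and satisfies $|\phi(z)| = 1$ for almost every $z \in \mathbb{T}^n$ (boundary values). For $0<p<\infty$, $H^p(\mathbb{D}^n)$ is the Hardy space of holomorphic $f$ on $\mathbb{D}^n$ with $\sup_{0<r<1} \frac{1}{(2\pi)^n}\int_{\mathbb{T}^n} |f(rz)|^p\, |dz_1|\cdots|dz_n| < \infty$. For $(\beta_1,\ldots,\beta_n) \in \mathbb{R}^n$, the Dirichlet-type space $\mathcal{D}_{\beta_1,\ldots,\beta_n}(\mathbb{D}^n)$ is the set of holomorphic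 $f(z) = \sum_{k \in \mathbb{N}^n} \hat f(k) z^k$ on $\mathbb{D}^n$ (with $0\in\mathbb{N}$) such that $\|f\|_{\beta_1,\ldots,\beta_n}^2 := \sum_{k \in \mathbb{N}^n} (1+k_1)^{\beta_1}\cdots(1+k_n)^{\beta_n} |\hat f(k)|^2 < \infty$. *)

theory Defs
  imports "HOL-Analysis.Analysis"
begin

definition polydisc :: "(complex ^ 'n) set" where
  "polydisc = {z. \<forall>j. norm (z $ j) < 1}"

text \<open>Holomorphy in several variables: real Frechet differentiability with a complex-linear
  derivative. Intended for open sets only.\<close>

definition holomorphic_vec_on :: "(complex ^ 'n \<Rightarrow> complex) \<Rightarrow> (complex ^ 'n) set \<Rightarrow> bool" where
  "holomorphic_vec_on f U \<longleftrightarrow>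
     (\<forall>z\<in>U. \<exists>D. (f has_derivative D) (at z) \<and> (\<forall>c v. D (c *s v) = c * D v))"

definition partial_deriv :: "'n \<Rightarrow> (complex ^ 'n \<Rightarrow> complex) \<Rightarrow> complex ^ 'n \<Rightarrow> complex" where
  "partial_deriv k f z = deriv (\<lambda>w. f (\<chi> i. if i = k then w else z $ i)) (z $ k)"

definition vec_monomial :: "nat ^ 'n \<Rightarrow> complex ^ 'n \<Rightarrow> complex" where
  "vec_monomial k z = (\<Prod>i\<in>UNIV. (z $ i) ^ (k $ i))"

definition vec_polynomial :: "(complex ^ 'n \<Rightarrow> complex) \<Rightarrow> bool" where
  "vec_polynomial p \<longleftrightarrow>
     (\<exists>S a. finite S \<and> p = (\<lambda>z. \<Sum>k\<in>S. a k * vec_monomial k z))"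

text \<open>The measure \<open>|dz\<^sub>1| \<cdots> |dz\<^sub>n|\<close> on the torus, of total mass \<open>(2\<pi>)\<^sup>n\<close>, as the image of
  Lebesgue measure on the cube of angles.\<close>

definition torus_measure :: "(complex ^ 'n) measure" where
  "torus_measure =
     distr (restrict_space lborel (cbox 0 (\<chi> i. 2 * pi) :: (real ^ 'n) set)) borel
       (\<lambda>\<theta>. \<chi> i. cis (\<theta> $ i))"

text \<open>Boundary values on the torus are radial limits. The denominator of a rational function is
  only required not to vanish identically; it may have zeros in the polydisc.\<close>

definition rational_inner :: "(complex ^ 'n \<Rightarrow> complex) \<Rightarrow> bool" where
  "rational_inner \<phi> \<longleftrightarrow>
     holomorphic_vec_on \<phi> polydisc \<and>
     bounded (\<phi> ` polydisc) \<and>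
     (\<exists>p q. vec_polynomial p \<and> vec_polynomial q \<and> (\<exists>z. q z \<noteq> 0) \<and>
        (\<forall>z\<in>polydisc. q z \<noteq> 0 \<longrightarrow> \<phi> z = p z / q z)) \<and>
     (AE z in torus_measure.
        \<exists>L. ((\<lambda>r. \<phi> (complex_of_real r *s z)) \<longlongrightarrow> L) (at_left 1) \<and> norm L = 1)"

definition hardy_space :: "real \<Rightarrow> (complex ^ 'n \<Rightarrow> complex) set" where
  "hardy_space p = {f. holomorphic_vec_on f polydisc \<and>
     (SUP r\<in>{0<..<1}. ennreal (1 / (2 * pi) ^ CARD('n)) *
        (\<integral>\<^sup>+ z. ennreal (norm (f (complex_of_real r *s z)) powr p) \<partial>torus_measure)) < \<infinity>}"

text \<open>The coefficient family \<open>a\<close> is uniquely determined by \<open>f\<close>.\<close>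

definition dirichlet_space :: "real ^ 'n \<Rightarrow> (complex ^ 'n \<Rightarrow> complex) set" where
  "dirichlet_space \<beta> = {f. holomorphic_vec_on f polydisc \<and>
     (\<exists>a :: nat ^ 'n \<Rightarrow> complex.
        (\<forall>z\<in>polydisc. ((\<lambda>k. a k * vec_monomial k z) has_sum f z) UNIV) \<and>
        (\<lambda>k. (\<Prod>i\<in>UNIV. (1 + real (k $ i)) powr (\<beta> $ i)) * (norm (a k))\<^sup>2) summable_on UNIV)}"

end

theory Submission
  imports Defs "HOL-Complex_Analysis.Cauchy_Integral_Formula"
begin

text \<open>
  Since a weighted geometric mean is at most the sum, it suffices to treat one variable at a time, that is, to show
  \<open>\<Sum>k (1 + k\<^sub>j)\<^sup>\<alpha> |a k|\<^sup>2 < \<infinity>\<close> for \<open>\<alpha> = \<alpha>\<^sub>j\<close>. For \<open>\<alpha> = 2\<close> this is Bessel's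
  inequality. For \<open>\<alpha> < 2\<close> write \<open>z\<^sub>j exp w\<close> for the \<open>j\<close>-th coordinate, let \<open>h\<close> be the \<open>w\<close>-derivative of
  \<open>\<phi>\<close>, and integrate over the torus on the lines \<open>Re w = - y\<close>. By parts,
  \<open>I = \<integral>\<integral> |h|\<^sup>2 y\<^bsup>1-\<alpha>\<^esup>\<close>, which is comparable to \<open>\<Sum>k k\<^sub>j\<^sup>\<alpha> |a k|\<^sup>2\<close>, is bounded by a multiple of
  \<open>\<integral>\<integral> |h| |h'| y\<^bsup>2-\<alpha>\<^esup>\<close> up to a boundary term. Since \<open>y |h| \<le> B\<close> by Cauchy's estimate, AM-GM absorbs half
  of \<open>I\<close> and leaves a multiple of \<open>\<integral>\<integral> |h|\<^bsup>\<alpha>-2\<^esup> |h'|\<^sup>2 y\<close>. The Hardy--Stein identity (the Laplacian of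
  \<open>|h|\<^sup>\<alpha>\<close> is \<open>\<alpha>\<^sup>2 |h|\<^bsup>\<alpha>-2\<^esup> |h'|\<^sup>2\<close>) bounds that by \<open>\<integral> |h|\<^sup>\<alpha>\<close> on the torus. Zeros of \<open>h\<close> are avoided
  by replacing \<open>|h|\<^sup>2\<close> with \<open>|h|\<^sup>2 + \<epsilon>\<close>.
\<close>

section \<open>Power series on the polydisc\<close>

text \<open>In the variable \<open>w\<close> the operator z_j d/dz_j becomes plain differentiation
  and a rotation of z_j becomes a vertical translation, so a one-variable argument on a half-plane
  can be averaged over the torus. The obstacle is that \<phi> may be singular on the torus. Every
  coordinate is therefore shrunk by \<rho> < 1, which makes the functions of \<open>w\<close>
  bounded and holomorphic on Re w < - ln \<rho>, a neighbourhood of the closed left half-plane.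
  Derivative bounds there depend on \<rho> and \<epsilon>; they only justify differentiation under
  the integral. The resulting inequality involves B, the total mass and the Hardy integral alone, so
  \<rho> can tend to 1 at the end, inside finite sums of coefficients.

  The constant \<kappa> = 2 B^(2-\<alpha>) / (2-\<alpha>) is dictated by the absorption:
  differentiating y^(2-\<alpha>) produces the factor 2-\<alpha>, and AM-GM returns B^(2-\<alpha>) /
  \<kappa>, which has to be half of it. The boundary terms of the Hardy--Stein step are controlled
  by convexity: a convex function bounded on a half-line has no positive slope, and its tangent at
  \<eta> stays below its value at 0.\<close>

definition vec_upd :: "complex ^ 'n \<Rightarrow> 'n \<Rightarrow> complex \<Rightarrow> complex ^ 'n" where
  "vec_upd z i w = (\<chi> l. if l = i then w else z $ l)"

text \<open>A class of functions that is closed under taking one-variable Taylor coefficients, with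
  the same B. This closure lets the multivariable power series be built one variable at a
  time.\<close>

definition sep_holo :: "real \<Rightarrow> (complex ^ 'n \<Rightarrow> complex) \<Rightarrow> bool" where
  "sep_holo B f \<longleftrightarrow> (\<forall>z\<in>polydisc. norm (f z) \<le> B \<and>
     (\<forall>i. (\<lambda>w. f (vec_upd z i w)) holomorphic_on ball 0 1))"

text \<open>The coefficient is kept as a function on the whole polydisc although it ignores z_i;
  thus it has the same type as f and can be expanded again in another variable.\<close>

definition taylor_coeff :: "'n \<Rightarrow> nat \<Rightarrow> (complex ^ 'n \<Rightarrow> complex) \<Rightarrow> complex ^ 'n \<Rightarrow> complex" where
  "taylor_coeff i m f z = (deriv ^^ m) (\<lambda>w. f (vec_upd z i w)) 0 / fact m"

lemma vec_upd_nth [simp]: "vec_upd z i w $ l = (if l = i then w else z $ l)"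
  by (simp add: vec_upd_def)

lemma vec_upd_upd_same [simp]: "vec_upd (vec_upd z i v) i w = vec_upd z i w"
  by (simp add: vec_eq_iff)

lemma vec_upd_self [simp]: "vec_upd z i (z $ i) = z"
  by (simp add: vec_eq_iff)

lemma vec_upd_swap: "l \<noteq> i \<Longrightarrow> vec_upd (vec_upd z l w) i v = vec_upd (vec_upd z i v) l w"
  by (simp add: vec_eq_iff)

lemma vec_upd_polydisc: "z \<in> polydisc \<Longrightarrow> norm w < 1 \<Longrightarrow> vec_upd z i w \<in> polydisc"
  by (simp add: polydisc_def)

lemma taylor_coeff_indep: "taylor_coeff i m f (vec_upd z i w) = taylor_coeff i m f z"
  by (simp add: taylor_coeff_def)

lemma taylor_coeff_cong:
  assumes "\<And>w. norm w < 1 \<Longrightarrow> f (vec_upd z i w) = f (vec_upd z' i w)"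
  shows "taylor_coeff i m f z = taylor_coeff i m f z'"
proof -
  have "eventually (\<lambda>w. w \<in> ball 0 (1::real)) (nhds (0::complex))"
    by (intro eventually_nhds_in_open) auto
  then have "eventually (\<lambda>w. f (vec_upd z i w) = f (vec_upd z' i w)) (nhds 0)"
    by eventually_elim (auto intro: assms)
  then show ?thesis
    unfolding taylor_coeff_def by (intro arg_cong2[where f="(/)"] higher_deriv_cong_ev) auto
qed

text \<open>Cauchy's inequality on a circle of radius r < 1 gives B / r^m, and r tends to 1.\<close>

lemma norm_taylor_coeff_le:
  assumes f: "sep_holo B f" and z: "z \<in> polydisc"
  shows "norm (taylor_coeff i m f z) \<le> B"
proof -
  let ?g = "\<lambda>w. f (vec_upd z i w)"
  have holo: "?g holomorphic_on ball 0 1"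
    using f z by (auto simp: sep_holo_def)
  have est: "norm (taylor_coeff i m f z) * r ^ m \<le> B" if r: "0 < r" "r < 1" for r :: real
  proof -
    have "norm ((deriv ^^ m) ?g 0) \<le> fact m * B / r ^ m"
    proof (rule Cauchy_inequality)
      show "?g holomorphic_on ball 0 r" "continuous_on (cball 0 r) ?g"
        using r holo by (auto intro!: holomorphic_on_imp_continuous_on elim: holomorphic_on_subset)
      show "norm (f (vec_upd z i w)) \<le> B" if "norm (0 - w) = r" for w
        using f vec_upd_polydisc[OF z, of w i] that r by (auto simp: sep_holo_def)
    qed (use r in auto)
    then show ?thesis
      using r by (simp add: taylor_coeff_def norm_divide field_simps)
  qed
  have lim: "((\<lambda>r. norm (taylor_coeff i m f z) * r ^ m) \<longlongrightarrow> norm (taylor_coeff i m f z) * 1 ^ m) (at_left (1::real))"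
    by (intro tendsto_intros)
  have "norm (taylor_coeff i m f z) * 1 ^ m \<le> B"
  proof (rule tendsto_upperbound[OF lim])
    show "\<forall>\<^sub>F r in at_left (1::real). norm (taylor_coeff i m f z) * r ^ m \<le> B"
      by (rule eventually_at_leftI[of 0]) (auto intro: est)
  qed auto
  then show ?thesis by simp
qed

lemma taylor_coeff_sums:
  assumes f: "sep_holo B f" and z: "z \<in> polydisc" and w: "norm w < 1"
  shows "(\<lambda>m. taylor_coeff i m f z * w ^ m) sums f (vec_upd z i w)"
  using holomorphic_power_series[of "\<lambda>w. f (vec_upd z i w)" 0 1 w] f z w
  by (auto simp: sep_holo_def taylor_coeff_def)

lemma taylor_coeff_has_sum:
  assumes f: "sep_holo B f" and z: "z \<in> polydisc"
  shows "((\<lambda>m. taylor_coeff i m f z * (z $ i) ^ m) has_sum f z) UNIV"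
proof (rule norm_summable_imp_has_sum)
  have zi: "norm (z $ i) < 1" using z by (simp add: polydisc_def)
  show "(\<lambda>m. taylor_coeff i m f z * (z $ i) ^ m) sums f z"
    using taylor_coeff_sums[OF f z zi, of i] by simp
  show "summable (\<lambda>m. norm (taylor_coeff i m f z * (z $ i) ^ m))"
  proof (rule summable_comparison_test')
    show "summable (\<lambda>m. B * norm (z $ i) ^ m)"
      using zi by (intro summable_mult summable_geometric) auto
    show "norm (norm (taylor_coeff i m f z * (z $ i) ^ m)) \<le> B * norm (z $ i) ^ m" if "m \<ge> 0" for m
      by (auto simp: norm_mult norm_power intro!: mult_right_mono norm_taylor_coeff_le[OF f z])
  qed
qed

text \<open>The tail is dominated by a geometric series. The bound does not depend on z, so dividing
  by w^m and letting w tend to 0 recovers the m-th coefficient uniformly in the other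
  variables.\<close>

lemma taylor_remainder:
  assumes f: "sep_holo B f" and z: "z \<in> polydisc" and w: "norm w < 1"
  shows "norm (f (vec_upd z i w) - (\<Sum>j\<le>m. taylor_coeff i j f z * w ^ j))
           \<le> B * norm w ^ Suc m / (1 - norm w)"
proof -
  have s1: "(\<lambda>j. taylor_coeff i (j + Suc m) f z * w ^ (j + Suc m)) sums
          (f (vec_upd z i w) - (\<Sum>j<Suc m. taylor_coeff i j f z * w ^ j))"
    by (subst sums_iff_shift) (use taylor_coeff_sums[OF f z w, of i] in auto)
  have "(\<lambda>j. norm w ^ j) sums (1 / (1 - norm w))"
    using w by (intro geometric_sums) auto
  from sums_mult[OF this, of "B * norm w ^ Suc m"]
  have s2: "(\<lambda>j. B * norm w ^ (j + Suc m)) sums (B * norm w ^ Suc m / (1 - norm w))"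
    by (simp add: power_add mult_ac)
  have le: "norm (taylor_coeff i (j + Suc m) f z * w ^ (j + Suc m)) \<le> B * norm w ^ (j + Suc m)" for j
    unfolding norm_mult norm_power by (intro mult_right_mono norm_taylor_coeff_le[OF f z]) auto
  have "norm (\<Sum>j. taylor_coeff i (j + Suc m) f z * w ^ (j + Suc m)) \<le> (\<Sum>j. B * norm w ^ (j + Suc m))"
    by (rule norm_suminf_le) (use le s2 in \<open>auto simp: sums_iff\<close>)
  then show ?thesis
    using s1 s2 by (simp add: sums_iff lessThan_Suc_atMost)
qed

text \<open>By strong induction on m: subtracting the terms of order below m from f and dividing by
  the m-th power of a small value of z_i gives functions holomorphic in z_l, and these converge
  uniformly to the m-th coefficient. For l = i the coefficient is constant.\<close>

lemma sep_holo_taylor_coeff: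
  assumes f: "sep_holo B f"
  shows "sep_holo B (taylor_coeff i m f)"
proof (induction m rule: less_induct)
  case (less m)
  let ?T = "\<lambda>j. taylor_coeff i j f"
  have "(\<lambda>w. ?T m (vec_upd z l w)) holomorphic_on ball 0 1" if z: "z \<in> polydisc" for z l
  proof (cases "l = i")
    case True
    then show ?thesis by (simp add: taylor_coeff_indep)
  next
    case False
    \<comment> \<open>The evaluation points 1/(N+2) tend to 0 and stay at most 1/2, so that the
      factor 1 / (1 - |e N|) of the remainder estimate is at most 2.\<close>
    define e :: "nat \<Rightarrow> complex" where "e N = complex_of_real (1 / real (N + 2))" for N
    define F where "F N w = (f (vec_upd (vec_upd z l w) i (e N)) - (\<Sum>j<m. ?T j (vec_upd z l w) * e N ^ j)) / e N ^ m"
      for N w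
    have e: "norm (e N) < 1" "e N \<noteq> 0" "norm (e N) \<le> 1/2" for N
      by (auto simp: e_def norm_divide divide_simps simp del: of_real_add of_nat_Suc)
    have F_holo: "F N holomorphic_on ball 0 1" for N
      unfolding F_def vec_upd_swap[OF False]
    proof (intro holomorphic_intros)
      show "(\<lambda>w. f (vec_upd (vec_upd z i (e N)) l w)) holomorphic_on ball 0 1"
        using f vec_upd_polydisc[OF z e(1)] unfolding sep_holo_def by blast
      show "(\<lambda>w. ?T j (vec_upd z l w)) holomorphic_on ball 0 1" if "j \<in> {..<m}" for j
        using less[of j] that z unfolding sep_holo_def by blast
    qed (use e in auto)
    have F_lim: "dist (F N w) (?T m (vec_upd z l w)) \<le> 2 * B * norm (e N)" if w: "norm w < 1" for N w
    proof -
      note zw = vec_upd_polydisc[OF z w, of l]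
      have FN: "e N ^ m * F N w = f (vec_upd (vec_upd z l w) i (e N)) - (\<Sum>j<m. ?T j (vec_upd z l w) * e N ^ j)"
        using e(2)[of N] by (simp add: F_def)
      have "norm (f (vec_upd (vec_upd z l w) i (e N)) - (\<Sum>j\<le>m. ?T j (vec_upd z l w) * e N ^ j))
             \<le> B * norm (e N) ^ Suc m / (1 - norm (e N))"
        by (rule taylor_remainder[OF f zw e(1)])
      also have "f (vec_upd (vec_upd z l w) i (e N)) - (\<Sum>j\<le>m. ?T j (vec_upd z l w) * e N ^ j)
          = e N ^ m * (F N w - ?T m (vec_upd z l w))"
        using FN by (simp add: lessThan_Suc_atMost[symmetric] right_diff_distrib)
      finally have "norm (e N) ^ m * norm (F N w - ?T m (vec_upd z l w))
          \<le> norm (e N) ^ m * (B * norm (e N) / (1 - norm (e N)))"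
        by (simp add: norm_mult norm_power mult_ac)
      then have "norm (F N w - ?T m (vec_upd z l w)) \<le> B * norm (e N) / (1 - norm (e N))"
        using e(2)[of N] by (subst (asm) mult_le_cancel_left_pos) auto
      also have "\<dots> \<le> B * norm (e N) / (1/2)"
      proof (rule divide_left_mono)
        have "0 \<le> norm (f z)" by simp
        also have "\<dots> \<le> B" using f z by (auto simp: sep_holo_def)
        finally show "0 \<le> B * norm (e N)" by simp
      qed (use e in \<open>auto simp: less_diff_eq intro!: mult_pos_pos\<close>)
      finally show ?thesis by (simp add: dist_norm)
    qed
    have e0: "(\<lambda>N. 2 * B * norm (e N)) \<longlonglongrightarrow> 0"
      unfolding e_def norm_of_real
      using tendsto_mult_left[OF LIMSEQ_ignore_initial_segment[OF lim_1_over_n[where 'a=real], of 2], of "2 * B"] by simp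
    show ?thesis
    proof (rule holomorphic_uniform_sequence[OF _ F_holo])
      fix x :: complex assume x: "x \<in> ball 0 1"
      then obtain d where d: "d > 0" "cball x d \<subseteq> ball 0 1"
        using open_contains_cball[of "ball (0::complex) 1"] by blast
      have "uniform_limit (cball x d) F (\<lambda>w. ?T m (vec_upd z l w)) sequentially"
      proof (rule uniform_limitI)
        fix \<epsilon> :: real assume "\<epsilon> > 0"
        then have "\<forall>\<^sub>F N in sequentially. 2 * B * norm (e N) < \<epsilon>"
          by (rule order_tendstoD[OF e0])
        then show "\<forall>\<^sub>F N in sequentially. \<forall>w\<in>cball x d. dist (F N w) (?T m (vec_upd z l w)) < \<epsilon>"
        proof eventually_elim
          case (elim N)
          show ?case
          proof
            fix w assume "w \<in> cball x d"
            then have "norm w < 1" using d(2) by (force simp: dist_norm)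
            from F_lim[OF this, of N] elim show "dist (F N w) (?T m (vec_upd z l w)) < \<epsilon>" by simp
          qed
        qed
      qed
      with d show "\<exists>d. 0 < d \<and> cball x d \<subseteq> ball 0 1 \<and>
             uniform_limit (cball x d) F (\<lambda>w. ?T m (vec_upd z l w)) sequentially" by blast
    qed simp
  qed
  then show ?case
    using norm_taylor_coeff_le[OF f] by (auto simp: sep_holo_def)
qed

section \<open>Multi-index expansion by adding one variable at a time\<close>

definition nat_upd :: "nat ^ 'n \<Rightarrow> 'n \<Rightarrow> nat \<Rightarrow> nat ^ 'n" where
  "nat_upd k i m = (\<chi> l. if l = i then m else k $ l)"

lemma nat_upd_nth [simp]: "nat_upd k i m $ l = (if l = i then m else k $ l)"
  by (simp add: nat_upd_def)

lemma bij_betw_nat_upd: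
  assumes "i \<notin> S"
  shows "bij_betw (\<lambda>(k, m). nat_upd k i m) ({k :: nat ^ 'n. \<forall>l. l \<notin> S \<longrightarrow> k $ l = 0} \<times> UNIV)
           {k. \<forall>l. l \<notin> insert i S \<longrightarrow> k $ l = 0}"
  by (rule bij_betw_byWitness[where f' = "\<lambda>k. (nat_upd k i 0, k $ i)"])
     (use assms in \<open>auto simp: vec_eq_iff\<close>)

text \<open>f is expanded in the variables of S only; the coefficients still depend on the remaining
  ones. Passing to \<open>insert i S\<close> expands each coefficient in z_i. The summability of the
  monomials is carried through the induction because, with the uniform bound B on the coefficients,
  it makes the combined family absolutely summable.\<close>

lemma power_series_partial:
  fixes f :: "complex ^ 'n \<Rightarrow> complex"
  assumes f: "sep_holo B f" and B: "0 \<le> B"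
  defines "K \<equiv> \<lambda>S. {k :: nat ^ 'n. \<forall>l. l \<notin> S \<longrightarrow> k $ l = 0}"
  shows "\<exists>c. \<forall>k. sep_holo B (c k) \<and>
           (\<forall>z\<in>polydisc. \<forall>z'\<in>polydisc. (\<forall>l. l \<notin> S \<longrightarrow> z $ l = z' $ l) \<longrightarrow> c k z = c k z') \<and>
           (\<forall>z\<in>polydisc. (\<lambda>k. \<Prod>l\<in>S. norm (z $ l) ^ (k $ l)) summable_on K S \<and>
              ((\<lambda>k. c k z * (\<Prod>l\<in>S. (z $ l) ^ (k $ l))) has_sum f z) (K S))"
proof -
  have "finite S" by simp
  then show ?thesis
  proof (induction S rule: finite_induct)
    case empty
    have K: "K {} = {0}" by (auto simp: K_def vec_eq_iff)
    show ?case
    proof (intro exI[of _ "\<lambda>_. f"] allI conjI ballI impI)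
      show "f z = f z'" if "\<forall>l. l \<notin> {} \<longrightarrow> z $ l = z' $ l" for z z'
        using that by (metis empty_iff vec_eq_iff)
    qed (use f in \<open>auto simp: K intro: has_sum_finiteI\<close>)
  next
    case (insert i S)
    then obtain c where c: "\<And>k. sep_holo B (c k)"
      and indep: "\<And>k z z'. z \<in> polydisc \<Longrightarrow> z' \<in> polydisc \<Longrightarrow> (\<forall>l. l \<notin> S \<longrightarrow> z $ l = z' $ l) \<Longrightarrow> c k z = c k z'"
      and summ: "\<And>z. z \<in> polydisc \<Longrightarrow> (\<lambda>k. \<Prod>l\<in>S. norm (z $ l) ^ (k $ l)) summable_on K S"
      and hs: "\<And>z. z \<in> polydisc \<Longrightarrow> ((\<lambda>k. c k z * (\<Prod>l\<in>S. (z $ l) ^ (k $ l))) has_sum f z) (K S)"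
      by blast
    have bij: "bij_betw (\<lambda>(k, m). nat_upd k i m) (K S \<times> UNIV) (K (insert i S))"
      unfolding K_def by (rule bij_betw_nat_upd[OF insert.hyps(2)])
    \<comment> \<open>The index k splits into its part supported on S, which selects the old
      coefficient, and its i-th entry, which selects the order of the Taylor coefficient in
      z_i.\<close>
    define d where "d k = taylor_coeff i (k $ i) (c (nat_upd k i 0))" for k
    have prod_upd: "(\<Prod>l\<in>insert i S. g l (nat_upd k i m $ l)) = g i m * (\<Prod>l\<in>S. g l (k $ l))"
      for g :: "'n \<Rightarrow> nat \<Rightarrow> 'a::comm_monoid_mult" and k m
    proof -
      have "(\<Prod>l\<in>S. g l (nat_upd k i m $ l)) = (\<Prod>l\<in>S. g l (k $ l))"
        by (rule prod.cong) (use insert.hyps in auto)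
      then show ?thesis using insert.hyps by simp
    qed
    have summ': "(\<lambda>k. \<Prod>l\<in>insert i S. norm (z $ l) ^ (k $ l)) summable_on K (insert i S)"
      if z: "z \<in> polydisc" for z
    proof -
      have zi: "norm (z $ i) < 1" using z by (simp add: polydisc_def)
      have g: "((\<lambda>m. norm (z $ i) ^ m) has_sum (1 / (1 - norm (z $ i)))) UNIV"
        by (rule sums_nonneg_imp_has_sum) (use zi in \<open>auto intro: geometric_sums\<close>)
      have "(\<lambda>(k, m). norm (z $ i) ^ m * (\<Prod>l\<in>S. norm (z $ l) ^ (k $ l))) summable_on (K S \<times> UNIV)"
      proof (rule summable_on_SigmaI)
        show "((\<lambda>m. case (k, m) of (k, m) \<Rightarrow> norm (z $ i) ^ m * (\<Prod>l\<in>S. norm (z $ l) ^ (k $ l)))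
            has_sum 1 / (1 - norm (z $ i)) * (\<Prod>l\<in>S. norm (z $ l) ^ (k $ l))) UNIV" for k
          using has_sum_cmult_left[OF g] by simp
        show "(\<lambda>k. 1 / (1 - norm (z $ i)) * (\<Prod>l\<in>S. norm (z $ l) ^ (k $ l))) summable_on K S"
          by (intro summable_on_cmult_right summ z)
      qed (auto intro!: mult_nonneg_nonneg prod_nonneg)
      then have "(\<lambda>x. \<Prod>l\<in>insert i S. norm (z $ l) ^ ((case x of (k, m) \<Rightarrow> nat_upd k i m) $ l)) summable_on (K S \<times> UNIV)"
        by (rule summable_on_cong[THEN iffD1, rotated])
           (use prod_upd[of "\<lambda>l n. norm (z $ l) ^ n"] in auto)
      then show ?thesis
        by (rule summable_on_reindex_bij_betw[OF bij, of "\<lambda>k. \<Prod>l\<in>insert i S. norm (z $ l) ^ (k $ l)", THEN iffD1])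
    qed
    show ?case
    proof (intro exI[of _ d] allI conjI ballI impI)
      show "sep_holo B (d k)" for k
        unfolding d_def by (intro sep_holo_taylor_coeff c)
      show "d k z = d k z'" if zz: "z \<in> polydisc" "z' \<in> polydisc" "\<forall>l. l \<notin> insert i S \<longrightarrow> z $ l = z' $ l" for k z z'
        unfolding d_def
        by (intro taylor_coeff_cong indep vec_upd_polydisc) (use zz in auto)
      show "(\<lambda>k. \<Prod>l\<in>insert i S. norm (z $ l) ^ (k $ l)) summable_on K (insert i S)"
        if z: "z \<in> polydisc" for z by (rule summ'[OF z])
      show "((\<lambda>k. d k z * (\<Prod>l\<in>insert i S. (z $ l) ^ (k $ l))) has_sum f z) (K (insert i S))"
        if z: "z \<in> polydisc" for z
      proof -
        have "(\<lambda>k. norm (d k z * (\<Prod>l\<in>insert i S. (z $ l) ^ (k $ l)))) summable_on K (insert i S)"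
        proof (rule Infinite_Sum.abs_summable_on_comparison_test'[OF summable_on_cmult_right[OF summ'[OF z], of B]])
          fix k
          show "norm (d k z * (\<Prod>l\<in>insert i S. (z $ l) ^ (k $ l))) \<le> B * (\<Prod>l\<in>insert i S. norm (z $ l) ^ (k $ l))"
            unfolding norm_mult prod_norm[symmetric] norm_power d_def
            by (intro mult_right_mono norm_taylor_coeff_le c z prod_nonneg) auto
        qed
        then have sm: "(\<lambda>k. d k z * (\<Prod>l\<in>insert i S. (z $ l) ^ (k $ l))) summable_on K (insert i S)"
          by (rule abs_summable_summable)
        have eq: "d (nat_upd k i m) z * (\<Prod>l\<in>insert i S. (z $ l) ^ (nat_upd k i m $ l))
           = taylor_coeff i m (c k) z * (z $ i) ^ m * (\<Prod>l\<in>S. (z $ l) ^ (k $ l))" if "k \<in> K S" for k m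
        proof -
          have "nat_upd (nat_upd k i m) i 0 = k"
            using that insert.hyps by (auto simp: vec_eq_iff K_def)
          then show ?thesis
            by (simp only: prod_upd[of "\<lambda>l n. (z $ l) ^ n"] d_def) (simp add: mult_ac)
        qed
        have "((\<lambda>x. d (case x of (k, m) \<Rightarrow> nat_upd k i m) z *
              (\<Prod>l\<in>insert i S. (z $ l) ^ ((case x of (k, m) \<Rightarrow> nat_upd k i m) $ l))) has_sum f z) (K S \<times> UNIV)"
        \<comment> \<open>The inner sum over m is the Taylor series of \<open>c k\<close> in z_i and
          the outer sum is the induction hypothesis. Merging them into one sum requires the joint
          summability \<open>sm\<close>.\<close>
        proof (rule has_sum_SigmaI[OF _ hs[OF z]])
          show "((\<lambda>m. d (case (k, m) of (k, m) \<Rightarrow> nat_upd k i m) z *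
             (\<Prod>l\<in>insert i S. (z $ l) ^ ((case (k, m) of (k, m) \<Rightarrow> nat_upd k i m) $ l)))
              has_sum c k z * (\<Prod>l\<in>S. (z $ l) ^ (k $ l))) UNIV" if "k \<in> K S" for k
            using taylor_coeff_has_sum[OF c z, of i k] that
            by (auto simp only: eq prod.case intro!: has_sum_cmult_left)
          show "(\<lambda>x. d (case x of (k, m) \<Rightarrow> nat_upd k i m) z *
              (\<Prod>l\<in>insert i S. (z $ l) ^ ((case x of (k, m) \<Rightarrow> nat_upd k i m) $ l))) summable_on (K S \<times> UNIV)"
            by (rule summable_on_reindex_bij_betw[OF bij, of "\<lambda>k. d k z * (\<Prod>l\<in>insert i S. (z $ l) ^ (k $ l))", THEN iffD2, OF sm])
        qed
        then show ?thesis
          by (rule has_sum_reindex_bij_betw[OF bij, of "\<lambda>k. d k z * (\<Prod>l\<in>insert i S. (z $ l) ^ (k $ l))", THEN iffD1])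
      qed
    qed
  qed
qed

lemma sep_holo_power_series:
  fixes f :: "complex ^ 'n \<Rightarrow> complex"
  assumes "sep_holo B f" "0 \<le> B"
  obtains a where "\<And>z. z \<in> polydisc \<Longrightarrow> ((\<lambda>k. a k * vec_monomial k z) has_sum f z) UNIV"
proof -
  obtain c where c: "\<forall>k. sep_holo B (c k) \<and>
       (\<forall>z\<in>polydisc. \<forall>z'\<in>polydisc. (\<forall>l. l \<notin> UNIV \<longrightarrow> z $ l = z' $ l) \<longrightarrow> c k z = c k z') \<and>
       (\<forall>z\<in>polydisc. (\<lambda>k. \<Prod>l\<in>UNIV. norm (z $ l) ^ (k $ l)) summable_on {k. \<forall>l. l \<notin> UNIV \<longrightarrow> k $ l = 0} \<and>
          ((\<lambda>k. c k z * (\<Prod>l\<in>UNIV. (z $ l) ^ (k $ l))) has_sum f z) {k. \<forall>l. l \<notin> UNIV \<longrightarrow> k $ l = 0})"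
    using power_series_partial[OF assms, of UNIV] by (rule exE)
  \<comment> \<open>For S = UNIV no coordinate is left on which a coefficient could depend.\<close>
  have const: "c k z = c k 0" if "z \<in> polydisc" for k z
  proof -
    have "(0 :: complex ^ 'n) \<in> polydisc" by (simp add: polydisc_def)
    then show ?thesis using c that by blast
  qed
  have hs: "((\<lambda>k. c k z * vec_monomial k z) has_sum f z) UNIV" if "z \<in> polydisc" for z
    using bspec[OF conjunct2[OF conjunct2[OF spec[OF c]]] that] by (simp add: vec_monomial_def)
  have "((\<lambda>k. c k 0 * vec_monomial k z) has_sum f z) UNIV" if "z \<in> polydisc" for z
    using hs[OF that] by (simp only: const[OF that])
  then show ?thesis by (rule that)
qed

section \<open>Restriction of holomorphic functions to coordinate discs\<close>

lemma has_derivative_vec_upd: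
  "(vec_upd z i has_derivative axis i) (at w)"
proof -
  have "bounded_linear (axis i :: complex \<Rightarrow> complex ^ 'a)"
    unfolding linear_conv_bounded_linear[symmetric] by (auto intro!: linearI simp: vec_eq_iff axis_def)
  then have "((\<lambda>w. vec_upd z i 0 + axis i w) has_derivative axis i) (at w)"
    using has_derivative_add[OF has_derivative_const bounded_linear.has_derivative[OF _ has_derivative_ident]] by fastforce
  moreover have "(\<lambda>w. vec_upd z i 0 + axis i w) = vec_upd z i"
    by (auto simp: fun_eq_iff vec_eq_iff axis_def)
  ultimately show ?thesis by simp
qed

text \<open>Complex linearity of the Frechet derivative turns its restriction to the i-th axis into
  multiplication by the number \<open>D (axis i 1)\<close>.\<close>

lemma holomorphic_vec_upd:
  assumes f: "holomorphic_vec_on f polydisc" and z: "z \<in> polydisc"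
  shows "(\<lambda>w. f (vec_upd z i w)) holomorphic_on ball 0 1"
proof (subst holomorphic_on_open, simp, intro ballI)
  fix w :: complex assume "w \<in> ball 0 1"
  then obtain D where D: "(f has_derivative D) (at (vec_upd z i w))" "\<And>c v. D (c *s v) = c * D v"
    using f vec_upd_polydisc[OF z, of w i] unfolding holomorphic_vec_on_def by (metis mem_ball_0)
  have "((\<lambda>w. f (vec_upd z i w)) has_derivative (\<lambda>h. D (axis i h))) (at w)"
    by (rule has_derivative_compose[OF has_derivative_vec_upd D(1)])
  moreover have "(\<lambda>h. D (axis i h)) = (*) (D (axis i 1))"
  proof
    fix h :: complex
    have "h *s axis i 1 = axis i h"
      by (simp add: vec_eq_iff axis_def)
    then show "D (axis i h) = D (axis i 1) * h"
      using D(2)[of h "axis i 1"] by (simp add: mult.commute)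
  qed
  ultimately show "\<exists>f'. ((\<lambda>w. f (vec_upd z i w)) has_field_derivative f') (at w)"
    by (intro exI[of _ "D (axis i 1)"]) (simp add: has_field_derivative_def)
qed

lemma continuous_on_holomorphic_vec:
  "holomorphic_vec_on f U \<Longrightarrow> continuous_on U f"
  unfolding holomorphic_vec_on_def
  by (meson continuous_at_imp_continuous_on has_derivative_continuous)

section \<open>Fourier analysis on the torus\<close>

definition utorus :: "(complex ^ 'n) set" where
  "utorus = {z. \<forall>i. norm (z $ i) = 1}"

text \<open>\<open>torus_measure\<close> lives on all of the vector space but is carried by
  \<open>utorus\<close>. After restriction, bounds that hold on the torus hold at every point of the
  space, not just almost everywhere.\<close>

definition torus_space :: "(complex ^ 'n) measure" where
  "torus_space = restrict_space torus_measure utorus"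

definition rot :: "'n \<Rightarrow> real \<Rightarrow> complex ^ 'n \<Rightarrow> complex ^ 'n" where
  "rot j s z = vec_upd z j (cis s * z $ j)"

lemma rot_nth: "rot j s z $ i = (if i = j then cis s * z $ j else z $ i)"
  by (simp add: rot_def)

section \<open>Rotation invariance of the torus measure\<close>

lemma emeasure_lborel_shift:
  fixes t :: "'a::euclidean_space"
  assumes "S \<in> sets borel"
  shows "emeasure lborel {x. x + t \<in> S} = emeasure lborel S"
proof -
  have "(lborel :: 'a measure) = distr lborel borel (\<lambda>x. t + x)"
    using lborel_affine[of 1 t] by (simp add: density_1)
  then have "emeasure lborel S = emeasure (distr lborel borel (\<lambda>x. t + x)) S"
    by (rule arg_cong)
  also have "\<dots> = emeasure lborel {x. x + t \<in> S}"
    using assms by (subst emeasure_distr) (auto simp: vimage_def add.commute)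
  finally show ?thesis by simp
qed

lemma borel_angle_map: "(\<lambda>\<theta> :: real ^ 'n. \<chi> i. cis (\<theta> $ i)) \<in> borel_measurable borel"
  by (intro borel_measurable_continuous_onI continuous_on_vec_lambda continuous_intros)

lemma borel_rot: "rot j s \<in> borel_measurable borel"
proof (rule borel_measurable_continuous_onI)
  have "rot j s = (\<lambda>z. \<chi> i. if i = j then cis s * z $ j else z $ i)"
    by (auto simp: fun_eq_iff vec_eq_iff rot_nth)
  moreover have "continuous_on UNIV (\<lambda>z. \<chi> i. if i = j then cis s * z $ j else z $ i :: complex ^ 'a)"
  proof (rule continuous_on_vec_lambda)
    fix i show "continuous_on UNIV (\<lambda>z. if i = j then cis s * z $ j else z $ i :: complex)"
      by (cases "i = j") (auto intro!: continuous_intros)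
  qed
  ultimately show "continuous_on UNIV (rot j s :: complex ^ 'a \<Rightarrow> _)" by simp
qed

lemma emeasure_torus_measure:
  fixes X :: "(complex ^ 'n) set"
  assumes "X \<in> sets borel"
  shows "emeasure torus_measure X
           = emeasure lborel {\<theta> \<in> cbox 0 (\<chi> i. 2 * pi). (\<chi> i. cis (\<theta> $ i)) \<in> X}"
proof -
  let ?M = "restrict_space lborel (cbox 0 (\<chi> i. 2 * pi) :: (real ^ 'n) set)"
  have m: "(\<lambda>\<theta>. \<chi> i. cis (\<theta> $ i)) \<in> measurable ?M borel"
    using measurable_restrict_space1[OF borel_angle_map] by (auto simp: measurable_def sets_restrict_space space_restrict_space)
  have "(\<lambda>\<theta>. \<chi> i. cis (\<theta> $ i)) -` X \<inter> space ?M = {\<theta> \<in> cbox 0 (\<chi> i. 2 * pi). (\<chi> i. cis (\<theta> $ i)) \<in> X}"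
    by (auto simp: space_restrict_space)
  then show ?thesis
    unfolding torus_measure_def using assms m
    by (subst emeasure_distr) (auto intro: emeasure_restrict_space)
qed

lemma sets_torus_measure [simp]: "sets torus_measure = sets borel"
  and space_torus_measure [simp]: "space torus_measure = UNIV"
  by (auto simp: torus_measure_def)

lemma emeasure_torus_measure_UNIV: "emeasure (torus_measure :: (complex ^ 'n) measure) UNIV = ennreal ((2 * pi) ^ CARD('n))"
proof -
  have eq: "(\<Prod>b\<in>Basis. ((\<chi> i. 2 * pi) :: real ^ 'n) \<bullet> b) = (2 * pi) ^ CARD('n)"
  proof -
    have "(\<Prod>b\<in>Basis. ((\<chi> i. 2 * pi) :: real ^ 'n) \<bullet> b) = (\<Prod>b\<in>(Basis :: (real ^ 'n) set). 2 * pi)"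
      by (intro prod.cong refl) (auto simp: Basis_vec_def cart_eq_inner_axis[symmetric])
    then show ?thesis by simp
  qed
  have "emeasure (torus_measure :: (complex ^ 'n) measure) UNIV = emeasure lborel (cbox 0 (\<chi> i. 2 * pi) :: (real ^ 'n) set)"
    by (subst emeasure_torus_measure) auto
  also have "\<dots> = ennreal (\<Prod>b\<in>Basis. ((\<chi> i. 2 * pi) :: real ^ 'n) \<bullet> b)"
    by (subst emeasure_lborel_cbox) (auto simp: Basis_vec_def cart_eq_inner_axis[symmetric])
  finally show ?thesis by (simp only: eq)
qed

lemma cis_shift_angle:
  "(\<chi> i. cis ((\<theta> + axis j s) $ i)) = rot j s (\<chi> i. cis (\<theta> $ i))"
  by (auto simp: vec_eq_iff rot_nth axis_def cis_mult add.commute)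

text \<open>In angle coordinates the rotation is a shift by s in direction j. The shifted box sticks
  out of the original one over angles from 2 pi to 2 pi + s; since the preimage of X is periodic,
  that piece can be moved back by 2 pi, where it fills the gap from 0 to s.\<close>

lemma emeasure_torus_rot_aux:
  fixes X :: "(complex ^ 'n) set"
  assumes X: "X \<in> sets borel" and s: "0 \<le> s" "s \<le> 2 * pi"
  shows "emeasure torus_measure (rot j s -` X) = emeasure torus_measure X"
proof -
  define E where "E = {\<theta> :: real ^ 'n. (\<chi> i. cis (\<theta> $ i)) \<in> X}"
  \<comment> \<open>Half-open in coordinate j, so that consecutive slabs are disjoint and fit
    together exactly; the other coordinates keep the closed ranges of the cube.\<close>
  define W where "W a b = {\<theta> :: real ^ 'n. a \<le> \<theta> $ j \<and> \<theta> $ j < b \<and> (\<forall>i\<in>UNIV - {j}. 0 \<le> \<theta> $ i \<and> \<theta> $ i \<le> 2 * pi)}"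
    for a b
  have E_sets: "E \<in> sets borel"
    using measurable_sets[OF borel_angle_map X] by (simp add: E_def vimage_def)
  have W_sets: "W a b \<in> sets borel" for a b
    unfolding W_def by measurable
  have E_shift: "\<theta> + axis j (2 * pi) \<in> E \<longleftrightarrow> \<theta> \<in> E" for \<theta>
  proof -
    have "rot j (2 * pi) (\<chi> i. cis (\<theta> $ i)) = (\<chi> i. cis (\<theta> $ i))"
      by (simp add: vec_eq_iff rot_nth)
    then show ?thesis by (simp only: E_def mem_Collect_eq cis_shift_angle)
  qed
  have W_shift: "\<theta> + axis j t \<in> W (a + t) (b + t) \<longleftrightarrow> \<theta> \<in> W a b" for \<theta> t a b
    by (auto simp: W_def axis_def)
  \<comment> \<open>The cube and the half-open slab differ only in the face where the j-th angle
    equals 2 pi, a null set.\<close>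
  have null: "emeasure lborel {\<theta> \<in> cbox 0 (\<chi> i. 2 * pi). \<theta> \<in> P} = emeasure lborel (W 0 (2 * pi) \<inter> P)"
    if P: "P \<in> sets borel" for P
  proof (rule emeasure_eq_AE)
    have "{\<theta> :: real ^ 'n. \<theta> $ j = 2 * pi} \<in> null_sets lebesgue"
      using negligible_standard_hyperplane[of "axis j 1 :: real ^ 'n" "2 * pi"]
      by (simp add: negligible_iff_null_sets cart_eq_inner_axis)
    then have "AE \<theta> in lebesgue. \<theta> $ j \<noteq> 2 * pi"
      by (auto dest!: AE_not_in)
    then have "AE \<theta> in (lborel :: (real ^ 'n) measure). \<theta> $ j \<noteq> 2 * pi"
      by (simp add: AE_completion_iff)
    then show "AE \<theta> in lborel. \<theta> \<in> {\<theta> \<in> cbox 0 (\<chi> i. 2 * pi). \<theta> \<in> P} \<longleftrightarrow> \<theta> \<in> W 0 (2 * pi) \<inter> P"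
    proof eventually_elim
      case (elim \<theta>)
      then show ?case
        by (auto simp: W_def mem_box_cart less_le)
    qed
  qed (use P W_sets in \<open>auto simp: Collect_conj_eq\<close>)
  have rotX: "rot j s -` X \<in> sets borel"
    using measurable_sets[OF borel_rot X, of j s] by simp
  have shiftE: "{\<theta>. \<theta> + axis j s \<in> E} = {\<theta>. (\<chi> i. cis (\<theta> $ i)) \<in> rot j s -` X}"
    by (simp only: E_def cis_shift_angle mem_Collect_eq vimage_eq)
  have shiftE_sets: "{\<theta>. \<theta> + axis j s \<in> E} \<in> sets borel"
    unfolding shiftE using measurable_sets[OF borel_angle_map rotX] by (simp add: vimage_def)
  have "emeasure torus_measure (rot j s -` X)
      = emeasure lborel {\<theta> \<in> cbox 0 (\<chi> i. 2 * pi). \<theta> \<in> {\<theta>. \<theta> + axis j s \<in> E}}"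
    by (subst emeasure_torus_measure[OF rotX]) (simp only: shiftE mem_Collect_eq)
  also have "\<dots> = emeasure lborel (W 0 (2 * pi) \<inter> {\<theta>. \<theta> + axis j s \<in> E})"
    by (rule null[OF shiftE_sets])
  also have "W 0 (2 * pi) \<inter> {\<theta>. \<theta> + axis j s \<in> E} = {\<theta>. \<theta> + axis j s \<in> W s (2 * pi + s) \<inter> E}"
    using W_shift[of _ s 0 "2 * pi"] by auto
  also have "emeasure lborel \<dots> = emeasure lborel (W s (2 * pi + s) \<inter> E)"
    by (intro emeasure_lborel_shift sets.Int W_sets E_sets)
  also have "W s (2 * pi + s) \<inter> E = (W s (2 * pi) \<inter> E) \<union> (W (2 * pi) (2 * pi + s) \<inter> E)"
    using s by (auto simp: W_def)
  also have "emeasure lborel \<dots> = emeasure lborel (W s (2 * pi) \<inter> E) + emeasure lborel (W (2 * pi) (2 * pi + s) \<inter> E)"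
    by (intro plus_emeasure[symmetric]) (use W_sets E_sets in \<open>auto simp: W_def\<close>)
  also have "emeasure lborel (W (2 * pi) (2 * pi + s) \<inter> E)
      = emeasure lborel {\<theta>. \<theta> + axis j (2 * pi) \<in> W (2 * pi) (2 * pi + s) \<inter> E}"
    by (intro emeasure_lborel_shift[symmetric] sets.Int W_sets E_sets)
  also have "{\<theta>. \<theta> + axis j (2 * pi) \<in> W (2 * pi) (2 * pi + s) \<inter> E} = W 0 s \<inter> E"
    using W_shift[of _ "2 * pi" 0 s] E_shift by (auto simp: add.commute)
  also have "emeasure lborel (W s (2 * pi) \<inter> E) + emeasure lborel (W 0 s \<inter> E)
      = emeasure lborel ((W s (2 * pi) \<inter> E) \<union> (W 0 s \<inter> E))"
    by (intro plus_emeasure) (use W_sets E_sets in \<open>auto simp: W_def\<close>)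
  also have "(W s (2 * pi) \<inter> E) \<union> (W 0 s \<inter> E) = W 0 (2 * pi) \<inter> E"
    using s by (auto simp: W_def)
  also have "emeasure lborel \<dots> = emeasure lborel {\<theta> \<in> cbox 0 (\<chi> i. 2 * pi). \<theta> \<in> E}"
    by (rule null[OF E_sets, symmetric])
  also have "\<dots> = emeasure torus_measure X"
    by (simp add: emeasure_torus_measure[OF X] E_def)
  finally show ?thesis .
qed

lemma emeasure_torus_rot:
  fixes X :: "(complex ^ 'n) set"
  assumes X: "X \<in> sets borel"
  shows "emeasure torus_measure (rot j s -` X) = emeasure torus_measure X"
proof -
  \<comment> \<open>Only the residue of the angle modulo 2 pi matters, and it lies in the range
    covered by the previous lemma.\<close>
  define s' where "s' = s - 2 * pi * of_int \<lfloor>s / (2 * pi)\<rfloor>"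
  have "cis s' = cis s / cis (2 * pi * of_int \<lfloor>s / (2 * pi)\<rfloor>)"
    unfolding s'_def by (rule cis_divide[symmetric])
  then have cis: "cis s' = cis s"
    by (simp add: cis_multiple_2pi)
  have "0 \<le> s'" "s' \<le> 2 * pi"
    using floor_divide_lower[of "2 * pi" s] floor_divide_upper[of "2 * pi" s]
    by (auto simp: s'_def algebra_simps)
  from emeasure_torus_rot_aux[OF X this, of j] show ?thesis
    by (simp add: rot_def[abs_def] cis)
qed

lemma utorus_sets [measurable]: "utorus \<in> sets borel"
proof (rule borel_closed)
  have "utorus = (\<Inter>i. {z :: complex ^ 'a. norm (z $ i) = 1})"
    by (auto simp: utorus_def)
  also have "closed \<dots>"
    by (intro closed_INT ballI closed_Collect_eq continuous_intros)
  finally show "closed (utorus :: (complex ^ 'a) set)" .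
qed

lemma AE_torus_measure: "AE z in torus_measure. z \<in> utorus"
  unfolding torus_measure_def
proof (subst AE_distr_iff)
  show "(\<lambda>\<theta>. \<chi> i. cis (\<theta> $ i)) \<in> measurable (restrict_space lborel (cbox 0 (\<chi> i. 2 * pi))) borel"
    using measurable_restrict_space1[OF borel_angle_map] by (auto simp: measurable_def sets_restrict_space space_restrict_space)
  show "{z \<in> space borel. z \<in> utorus} \<in> sets borel"
    by simp
qed (simp add: utorus_def)

lemma space_torus_space [simp]: "space torus_space = utorus"
  by (simp add: torus_space_def space_restrict_space)

lemma sets_torus_space: "sets torus_space = sets (restrict_space borel utorus)"
  unfolding torus_space_def by (rule sets_restrict_space_cong) simp

lemma emeasure_torus_space: 
  assumes "A \<subseteq> utorus"
  shows "emeasure torus_space A = emeasure torus_measure A"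
  unfolding torus_space_def using assms by (intro emeasure_restrict_space) auto

lemma measure_torus_space: "measure (torus_space :: (complex ^ 'n) measure) utorus = (2 * pi) ^ CARD('n)"
proof -
  have "emeasure (torus_space :: (complex ^ 'n) measure) utorus = emeasure torus_measure (utorus :: (complex ^ 'n) set)"
    by (rule emeasure_torus_space) simp
  also have "\<dots> = emeasure torus_measure (UNIV :: (complex ^ 'n) set)"
    by (rule emeasure_eq_AE) (use AE_torus_measure in auto)
  finally show ?thesis
    by (simp add: emeasure_torus_measure_UNIV measure_def)
qed

lemma finite_measure_torus_space: "finite_measure (torus_space :: (complex ^ 'n) measure)"
proof
  have "emeasure (torus_space :: (complex ^ 'n) measure) utorus \<le> emeasure torus_measure (UNIV :: (complex ^ 'n) set)"
    by (subst emeasure_torus_space) (auto intro!: emeasure_mono)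
  then show "emeasure (torus_space :: (complex ^ 'n) measure) (space torus_space) \<noteq> \<infinity>"
    by (auto simp: emeasure_torus_measure_UNIV top_unique)
qed

lemma rot_utorus: "z \<in> utorus \<Longrightarrow> rot j s z \<in> utorus"
  by (auto simp: utorus_def rot_nth norm_mult)

lemma measurable_rot: "rot j s \<in> measurable torus_space torus_space"
  unfolding measurable_cong_sets[OF sets_torus_space sets_torus_space]
  by (rule measurable_restrict_space3) (auto simp: borel_rot rot_utorus)

lemma distr_torus_space_rot: "distr torus_space torus_space (rot j s) = torus_space"
proof (rule measure_eqI)
  fix A assume "A \<in> sets (distr torus_space torus_space (rot j s))"
  then have A: "A \<in> sets torus_space" by simp
  then have A': "A \<in> sets borel" "A \<subseteq> utorus"
    unfolding sets_torus_space by (auto simp: sets_restrict_space_iff)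
  have inv: "rot j s -` A \<subseteq> utorus"
  proof
    fix z assume "z \<in> rot j s -` A"
    then have "rot j s z \<in> utorus" using A' by auto
    then show "z \<in> utorus"
      unfolding utorus_def by (auto simp: rot_nth norm_mult split: if_splits)
  qed
  then have *: "rot j s -` A \<inter> utorus = rot j s -` A" by auto
  show "emeasure (distr torus_space torus_space (rot j s)) A = emeasure torus_space A"
    by (subst emeasure_distr[OF measurable_rot A])
       (simp add: * emeasure_torus_space inv A' emeasure_torus_rot)
qed simp

lemma integral_torus_rot:
  fixes f :: "complex ^ 'n \<Rightarrow> 'b::{banach, second_countable_topology}"
  assumes "f \<in> borel_measurable torus_space"
  shows "(\<integral>z. f (rot j s z) \<partial>torus_space) = (\<integral>z. f z \<partial>torus_space)"
  using integral_distr[OF measurable_rot assms, of j s] by (simp add: distr_torus_space_rot)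

lemma borel_measurable_torus_continuous:
  "continuous_on utorus f \<Longrightarrow> f \<in> borel_measurable torus_space"
  unfolding measurable_cong_sets[OF sets_torus_space refl]
  by (rule borel_measurable_continuous_on_restrict)

section \<open>Monomials on the torus: orthogonality, coefficients, Bessel\<close>

lemma continuous_on_vec_monomial: "continuous_on A (vec_monomial k)"
  unfolding vec_monomial_def by (intro continuous_intros)

lemma borel_measurable_vec_monomial: "vec_monomial k \<in> borel_measurable torus_space"
  by (intro borel_measurable_torus_continuous continuous_on_vec_monomial)

lemma norm_vec_monomial_utorus: "z \<in> utorus \<Longrightarrow> norm (vec_monomial k z) = 1"
  by (simp add: vec_monomial_def utorus_def prod_norm[symmetric] norm_power)

lemma vec_monomial_upd_mult: "vec_monomial k (vec_upd z j (c * z $ j)) = c ^ (k $ j) * vec_monomial k z"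
proof -
  have "vec_monomial k (vec_upd z j (c * z $ j)) = (c * z $ j) ^ (k $ j) * (\<Prod>i\<in>UNIV - {j}. (z $ i) ^ (k $ i))"
    unfolding vec_monomial_def by (subst prod.remove[of _ j]) (auto intro!: prod.cong)
  also have "\<dots> = c ^ (k $ j) * vec_monomial k z"
    unfolding vec_monomial_def by (subst (2) prod.remove[of _ j]) (auto simp: power_mult_distrib)
  finally show ?thesis .
qed

lemma vec_monomial_rot: "vec_monomial k (rot j s z) = cis (real (k $ j) * s) * vec_monomial k z"
  by (simp only: rot_def vec_monomial_upd_mult Complex.DeMoivre)

lemma integrable_torus_bounded:
  fixes f :: "complex ^ 'n \<Rightarrow> 'b::{banach, second_countable_topology}"
  assumes "f \<in> borel_measurable torus_space" "\<And>z. z \<in> utorus \<Longrightarrow> norm (f z) \<le> B"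
  shows "integrable torus_space f"
  using assms by (intro finite_measure.integrable_const_bound[OF finite_measure_torus_space, of _ B]) auto

text \<open>If k and l differ in entry j, rotating coordinate j by pi / (k_j - l_j) multiplies the
  integrand by cis pi = -1. Rotation invariance then makes the integral equal to its own negative,
  and no iterated integration is needed.\<close>

lemma integral_vec_monomial_orthogonal:
  fixes k l :: "nat ^ 'n"
  shows "(\<integral>z. vec_monomial k z * cnj (vec_monomial l z) \<partial>torus_space)
           = (if k = l then of_real ((2 * pi) ^ CARD('n)) else 0)"
proof (cases "k = l")
  case True
  have "(\<integral>z. vec_monomial k z * cnj (vec_monomial l z) \<partial>torus_space) = (\<integral>z. 1 \<partial>(torus_space :: (complex ^ 'n) measure))"
    by (rule Bochner_Integration.integral_cong)
       (auto simp: True complex_norm_square[symmetric] norm_vec_monomial_utorus)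
  then show ?thesis
    using True by (simp add: measure_torus_space scaleR_conv_of_real)
next
  case False
  then obtain j where j: "k $ j \<noteq> l $ j" by (auto simp: vec_eq_iff)
  define s where "s = pi / (real (k $ j) - real (l $ j))"
  let ?f = "\<lambda>z. vec_monomial k z * cnj (vec_monomial l z)"
  have f[measurable]: "?f \<in> borel_measurable torus_space"
    by (intro borel_measurable_torus_continuous continuous_intros continuous_on_vec_monomial)
  have "?f (rot j s z) = - ?f z" for z
  proof -
    have "?f (rot j s z) = cis (real (k $ j) * s - real (l $ j) * s) * ?f z"
      by (simp add: vec_monomial_rot cis_cnj cis_divide[symmetric] divide_inverse mult_ac flip: cis_inverse)
    also have "real (k $ j) * s - real (l $ j) * s = pi"
      unfolding left_diff_distrib[symmetric] using j by (simp add: s_def)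
    finally show ?thesis by simp
  qed
  then have "(\<integral>z. ?f z \<partial>torus_space) = (\<integral>z. - ?f z \<partial>torus_space)"
    using integral_torus_rot[OF f, of j s] by simp
  then have "(\<integral>z. ?f z \<partial>torus_space) = - (\<integral>z. ?f z \<partial>torus_space)"
    by (simp add: Bochner_Integration.integral_minus)
  then show ?thesis using False by simp
qed

text \<open>Absolute summability of the coefficients makes finite partial sums converge uniformly on
  the torus. Each partial sum that contains l has the right coefficient by orthogonality, and the
  error integrates to at most \<epsilon>.\<close>

lemma torus_fourier_coeff:
  fixes a :: "nat ^ 'n \<Rightarrow> complex"
  assumes f: "f \<in> borel_measurable torus_space"
    and a: "(\<lambda>k. norm (a k)) summable_on UNIV"
    and hs: "\<And>z. z \<in> utorus \<Longrightarrow> ((\<lambda>k. a k * vec_monomial k z) has_sum f z) UNIV"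
  shows "(\<integral>z. f z * cnj (vec_monomial l z) \<partial>torus_space) = of_real ((2 * pi) ^ CARD('n)) * a l"
proof -
  let ?C = "(2 * pi) ^ CARD('n)"
  have C: "?C > 0" by simp
  let ?I = "\<integral>z. f z * cnj (vec_monomial l z) \<partial>torus_space"
  have "norm (?I - of_real ?C * a l) \<le> \<epsilon>" if "\<epsilon> > 0" for \<epsilon>
  proof -
    define A where "A = infsum (\<lambda>k. norm (a k)) UNIV"
    have A: "((\<lambda>k. norm (a k)) has_sum A) UNIV"
      unfolding A_def using a by (rule has_sum_infsum)
    then have "\<forall>\<^sub>F F in finite_subsets_at_top UNIV. dist (\<Sum>k\<in>F. norm (a k)) A < \<epsilon> / ?C"
      unfolding has_sum_def using that C by (intro tendstoD) auto
    then obtain F0 where F0: "finite F0" "\<And>F. finite F \<Longrightarrow> F0 \<subseteq> F \<Longrightarrow> dist (\<Sum>k\<in>F. norm (a k)) A < \<epsilon> / ?C"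
      unfolding eventually_finite_subsets_at_top by auto
    \<comment> \<open>Adding l keeps the tail estimate, which holds for all finite supersets of F0,
      and lets orthogonality pick out \<open>a l\<close>.\<close>
    define F where "F = insert l F0"
    have F: "finite F" "l \<in> F" "dist (\<Sum>k\<in>F. norm (a k)) A < \<epsilon> / ?C"
      using F0 by (auto simp: F_def)
    define g where "g z = (\<Sum>k\<in>F. a k * vec_monomial k z)" for z
    have g: "g \<in> borel_measurable torus_space"
      unfolding g_def by (intro borel_measurable_sum borel_measurable_times borel_measurable_const borel_measurable_vec_monomial)
    have cm: "(\<lambda>z. cnj (vec_monomial l z)) \<in> borel_measurable torus_space"
      by (intro borel_measurable_torus_continuous continuous_intros continuous_on_vec_monomial)
    have diff: "norm (f z - g z) \<le> \<epsilon> / ?C" if z: "z \<in> utorus" for z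
    proof -
      have "((\<lambda>k. a k * vec_monomial k z) has_sum (f z - g z)) (UNIV - F)"
        unfolding g_def by (rule has_sum_Diff[OF hs[OF z] has_sum_finite[OF F(1)]]) simp
      moreover have "((\<lambda>k. norm (a k)) has_sum (A - (\<Sum>k\<in>F. norm (a k)))) (UNIV - F)"
        by (rule has_sum_Diff[OF A has_sum_finite[OF F(1)]]) simp
      then have "((\<lambda>k. norm (a k * vec_monomial k z)) has_sum (A - (\<Sum>k\<in>F. norm (a k)))) (UNIV - F)"
        by (simp add: norm_mult norm_vec_monomial_utorus[OF z])
      ultimately have "norm (f z - g z) \<le> A - (\<Sum>k\<in>F. norm (a k))"
        by (intro norm_has_sum_bound)
      also have "\<dots> \<le> \<epsilon> / ?C" using F(3) by (simp add: dist_norm)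
      finally show ?thesis .
    qed
    have bd: "norm ((f z - g z) * cnj (vec_monomial l z)) \<le> \<epsilon> / ?C" if "z \<in> utorus" for z
      using diff[OF that] by (simp add: norm_mult norm_vec_monomial_utorus[OF that])
    have mono_int: "integrable torus_space (\<lambda>z. vec_monomial k z * cnj (vec_monomial l z))" for k :: "nat ^ 'n"
      by (rule integrable_torus_bounded[where B = 1])
         (use cm borel_measurable_vec_monomial in \<open>auto simp: norm_mult norm_vec_monomial_utorus intro!: borel_measurable_times\<close>)
    have int1: "integrable torus_space (\<lambda>z. (f z - g z) * cnj (vec_monomial l z))"
      by (rule integrable_torus_bounded[OF _ bd]) (use f g cm in auto)
    have int2: "integrable torus_space (\<lambda>z. g z * cnj (vec_monomial l z))"
      unfolding g_def sum_distrib_right mult.assoc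
      by (intro Bochner_Integration.integrable_sum Bochner_Integration.integrable_mult_right mono_int)
    have "(\<integral>z. g z * cnj (vec_monomial l z) \<partial>torus_space) = (\<Sum>k\<in>F. a k * (\<integral>z. vec_monomial k z * cnj (vec_monomial l z) \<partial>torus_space))"
      unfolding g_def sum_distrib_right mult.assoc
      by (subst Bochner_Integration.integral_sum) (auto intro!: Bochner_Integration.integrable_mult_right mono_int)
    also have "\<dots> = of_real ?C * a l"
      unfolding integral_vec_monomial_orthogonal using F by (simp add: if_distrib sum.delta mult.commute cong: if_cong)
    finally have ig: "(\<integral>z. g z * cnj (vec_monomial l z) \<partial>torus_space) = of_real ?C * a l" .
    have "(\<integral>z. (f z - g z) * cnj (vec_monomial l z) + g z * cnj (vec_monomial l z) \<partial>torus_space)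
        = (\<integral>z. (f z - g z) * cnj (vec_monomial l z) \<partial>torus_space) + of_real ?C * a l"
      unfolding ig[symmetric] by (rule Bochner_Integration.integral_add[OF int1 int2])
    then have "?I - of_real ?C * a l = (\<integral>z. (f z - g z) * cnj (vec_monomial l z) \<partial>torus_space)"
      by (simp add: algebra_simps)
    also have "norm \<dots> \<le> (\<integral>z. norm ((f z - g z) * cnj (vec_monomial l z)) \<partial>torus_space)"
      by (rule integral_norm_bound)
    also have "\<dots> \<le> (\<integral>z. \<epsilon> / ?C \<partial>(torus_space :: (complex ^ 'n) measure))"
      by (rule integral_mono_AE) (use int1 bd in \<open>auto simp: finite_measure.integrable_const[OF finite_measure_torus_space]\<close>)
    also have "\<dots> = \<epsilon>" by (simp add: measure_torus_space)
    finally show ?thesis .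
  qed
  then have "norm (?I - of_real ?C * a l) \<le> 0" by (rule field_le_epsilon[of _ 0, simplified])
  then show ?thesis by simp
qed

text \<open>Expand the nonnegative integral of |f - g|^2 for the partial sum g; both the cross term
  and the integral of |g|^2 equal the mass times the square sum. The coefficients enter through
  their integrals, not through a series for f, because the lemma is also applied to a
  \<open>w\<close>-derivative whose coefficients are found by differentiating an integral.\<close>

lemma torus_bessel:
  fixes f :: "complex ^ 'n \<Rightarrow> complex" and c :: "nat ^ 'n \<Rightarrow> complex"
  assumes f: "f \<in> borel_measurable torus_space" and bd: "\<And>z. z \<in> utorus \<Longrightarrow> norm (f z) \<le> B"
    and F: "finite F"
    and c: "\<And>k. (\<integral>z. f z * cnj (vec_monomial k z) \<partial>torus_space) = of_real ((2 * pi) ^ CARD('n)) * c k"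
  shows "(2 * pi) ^ CARD('n) * (\<Sum>k\<in>F. (norm (c k))\<^sup>2) \<le> (\<integral>z. (norm (f z))\<^sup>2 \<partial>torus_space)"
proof -
  let ?C = "(2 * pi) ^ CARD('n)"
  let ?I = "\<lambda>f. integral\<^sup>L torus_space f"
  define S where "S = (\<Sum>k\<in>F. (norm (c k))\<^sup>2)"
  define g where "g z = (\<Sum>k\<in>F. c k * vec_monomial k z)" for z
  have cm: "(\<lambda>z. cnj (vec_monomial l z)) \<in> borel_measurable torus_space" for l
    by (intro borel_measurable_torus_continuous continuous_intros continuous_on_vec_monomial)
  have gm: "g \<in> borel_measurable torus_space" and gcm: "(\<lambda>z. cnj (g z)) \<in> borel_measurable torus_space"
    unfolding g_def by (intro borel_measurable_torus_continuous continuous_intros continuous_on_vec_monomial)+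
  have gb: "norm (g z) \<le> (\<Sum>k\<in>F. norm (c k))" if "z \<in> utorus" for z
    unfolding g_def by (rule sum_norm_le) (simp add: norm_mult norm_vec_monomial_utorus[OF that])
  have B0: "0 \<le> B" if "z \<in> utorus" for z :: "complex ^ 'n"
    using bd[OF that] norm_ge_zero order_trans by blast
  have int_fm: "integrable torus_space (\<lambda>z. f z * cnj (vec_monomial k z))" for k
    by (rule integrable_torus_bounded[where B = B])
       (use f cm bd in \<open>auto simp: norm_mult norm_vec_monomial_utorus intro!: borel_measurable_times\<close>)
  have int_gm: "integrable torus_space (\<lambda>z. g z * cnj (vec_monomial k z))" for k
    by (rule integrable_torus_bounded[where B = "\<Sum>k\<in>F. norm (c k)"])
       (use gm cm gb in \<open>auto simp: norm_mult norm_vec_monomial_utorus intro!: borel_measurable_times\<close>)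
  have int_mm: "integrable torus_space (\<lambda>z. vec_monomial l z * cnj (vec_monomial k z))" for k l :: "nat ^ 'n"
    by (rule integrable_torus_bounded[where B = 1])
       (use cm borel_measurable_vec_monomial in \<open>auto simp: norm_mult norm_vec_monomial_utorus intro!: borel_measurable_times\<close>)
  have int_fg: "integrable torus_space (\<lambda>z. f z * cnj (g z))"
    by (rule integrable_torus_bounded[where B = "B * (\<Sum>k\<in>F. norm (c k))"])
       (use f gcm bd gb B0 in \<open>auto simp: norm_mult intro!: mult_mono\<close>)
  have int_gg: "integrable torus_space (\<lambda>z. g z * cnj (g z))"
    by (rule integrable_torus_bounded[where B = "(\<Sum>k\<in>F. norm (c k)) * (\<Sum>k\<in>F. norm (c k))"])
       (use gm gcm gb in \<open>auto simp: norm_mult intro!: mult_mono sum_nonneg\<close>)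
  have int_ff: "integrable torus_space (\<lambda>z. (norm (f z))\<^sup>2)"
    by (rule integrable_torus_bounded[where B = "B\<^sup>2"])
       (use f bd in \<open>auto intro!: power_mono\<close>)
  have expand: "?I (\<lambda>z. h z * cnj (g z)) = (\<Sum>k\<in>F. cnj (c k) * ?I (\<lambda>z. h z * cnj (vec_monomial k z)))"
    if "\<And>k. integrable torus_space (\<lambda>z. h z * cnj (vec_monomial k z))" for h
  proof -
    have "?I (\<lambda>z. h z * cnj (g z)) = ?I (\<lambda>z. \<Sum>k\<in>F. cnj (c k) * (h z * cnj (vec_monomial k z)))"
      by (simp add: g_def sum_distrib_left mult_ac)
    also have "\<dots> = (\<Sum>k\<in>F. ?I (\<lambda>z. cnj (c k) * (h z * cnj (vec_monomial k z))))"
      using that by (intro Bochner_Integration.integral_sum) auto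
    finally show ?thesis by simp
  qed
  have ig: "?I (\<lambda>z. g z * cnj (vec_monomial l z)) = of_real ?C * c l" if l: "l \<in> F" for l
  proof -
    have "?I (\<lambda>z. g z * cnj (vec_monomial l z)) = (\<Sum>k\<in>F. c k * ?I (\<lambda>z. vec_monomial k z * cnj (vec_monomial l z)))"
      unfolding g_def sum_distrib_right mult.assoc
      by (subst Bochner_Integration.integral_sum) (auto intro!: Bochner_Integration.integrable_mult_right int_mm)
    then show ?thesis
      unfolding integral_vec_monomial_orthogonal using F l by (simp add: if_distrib sum.delta mult.commute cong: if_cong)
  qed
  have cc: "cnj x * (of_real ?C * x) = of_real (?C * (norm x)\<^sup>2)" for x
    using complex_norm_square[of x] by (simp add: mult_ac)
  have fg: "?I (\<lambda>z. f z * cnj (g z)) = of_real (?C * S)"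
    unfolding expand[OF int_fm] c cc S_def by (simp add: sum_distrib_left)
  have gg: "?I (\<lambda>z. g z * cnj (g z)) = of_real (?C * S)"
    unfolding expand[OF int_gm] S_def by (simp only: ig cc cong: sum.cong) (simp add: sum_distrib_left)
  have "0 \<le> ?I (\<lambda>z. (norm (f z - g z))\<^sup>2)"
    by simp
  also have "?I (\<lambda>z. (norm (f z - g z))\<^sup>2)
      = ?I (\<lambda>z. (norm (f z))\<^sup>2 - 2 * Re (f z * cnj (g z)) + Re (g z * cnj (g z)))"
  proof (rule Bochner_Integration.integral_cong[OF refl])
    fix z
    show "(norm (f z - g z))\<^sup>2 = (norm (f z))\<^sup>2 - 2 * Re (f z * cnj (g z)) + Re (g z * cnj (g z))"
      by (simp add: cmod_power2) (simp add: power2_eq_square algebra_simps)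
  qed
  also have "\<dots> = ?I (\<lambda>z. (norm (f z))\<^sup>2) - 2 * Re (?I (\<lambda>z. f z * cnj (g z))) + Re (?I (\<lambda>z. g z * cnj (g z)))"
    using int_ff int_fg int_gg by (simp del: times_complex.sel)
  also have "\<dots> = ?I (\<lambda>z. (norm (f z))\<^sup>2) - ?C * S"
    by (simp add: fg gg)
  finally show ?thesis by (simp add: S_def)
qed

section \<open>Interpolation between a bounded function and its derivative\<close>

text \<open>Dominated convergence for difference quotients: on a convex set the mean value
  inequality bounds them by the bound C of the derivative. The scalar field is left general because
  complex derivatives are needed for Fourier integrals and real ones for means along lines.\<close>

lemma has_field_derivative_integral:
  fixes f f' :: "'k::{real_normed_field, banach, second_countable_topology} \<Rightarrow> 'a \<Rightarrow> 'k"
  assumes M: "finite_measure M" and S: "open S" "convex S" "x \<in> S"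
    and deriv: "\<And>y z. y \<in> S \<Longrightarrow> z \<in> space M \<Longrightarrow> ((\<lambda>y. f y z) has_field_derivative f' y z) (at y)"
    and bound: "\<And>y z. y \<in> S \<Longrightarrow> z \<in> space M \<Longrightarrow> norm (f' y z) \<le> C"
    and int: "\<And>y. y \<in> S \<Longrightarrow> integrable M (f y)"
  shows "((\<lambda>y. \<integral>z. f y z \<partial>M) has_field_derivative (\<integral>z. f' x z \<partial>M)) (at x)"
    and "f' x \<in> borel_measurable M"
proof -
  have "\<exists>e>0. ball x e \<subseteq> S"
    using S by (meson open_contains_ball)
  then obtain e where e: "e > 0" "ball x e \<subseteq> S" by blast
  define q where "q y z = (f y z - f x z) / (y - x)" for y z
  have q_meas: "q y \<in> borel_measurable M" if "y \<in> S" for y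
    unfolding q_def using int[OF that] int[OF S(3)] by measurable
  have q_lim: "(\<lambda>n. q (X n) z) \<longlonglongrightarrow> f' x z"
    if X: "\<And>i. X i \<in> S - {x}" "X \<longlonglongrightarrow> x" and z: "z \<in> space M" for X z
  proof -
    have "((\<lambda>y. q y z) \<longlongrightarrow> f' x z) (at x within S)"
      unfolding q_def using has_field_derivative_at_within[OF deriv[OF S(3) z]]
      by (simp only: has_field_derivative_iff)
    then show ?thesis
      using X unfolding tendsto_at_iff_sequentially by (auto simp: o_def)
  qed
  have q_bound: "norm (q y z) \<le> C" if "y \<in> S - {x}" "z \<in> space M" for y z
  proof -
    have "norm (f y z - f x z) \<le> C * norm (y - x)"
      by (rule field_differentiable_bound[OF S(2), where f' = "\<lambda>y. f' y z"])
         (use that S bound deriv has_field_derivative_at_within in blast)+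
    then show ?thesis
      using that by (simp add: q_def norm_divide field_simps)
  qed
  \<comment> \<open>Some explicit sequence in S tending to x is needed to exhibit
    \<open>f' x\<close> as a pointwise limit of measurable quotients.\<close>
  define X0 where "X0 n = x + of_real (e / (2 + real n))" for n
  have X0: "X0 n \<in> S - {x}" for n
  proof -
    have "e / (2 + real n) \<le> e / 2"
      using e by (intro divide_left_mono) auto
    also have "\<dots> < e" using e by simp
    finally have "X0 n \<in> ball x e"
      using e by (simp add: X0_def dist_norm norm_of_real del: of_real_divide)
    then show ?thesis using e by (auto simp: X0_def simp del: of_real_divide)
  qed
  have "(\<lambda>n. e * (1 / real (n + 2))) \<longlonglongrightarrow> e * 0"
    by (intro tendsto_intros LIMSEQ_ignore_initial_segment[OF lim_1_over_n[where 'a=real]])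
  then have "(\<lambda>n. x + of_real (e * (1 / real (n + 2)))) \<longlonglongrightarrow> x + of_real 0"
    by (intro tendsto_intros) auto
  then have X0_lim: "X0 \<longlonglongrightarrow> x"
    by (simp add: X0_def[abs_def] add.commute)
  show meas: "f' x \<in> borel_measurable M"
    by (rule borel_measurable_LIMSEQ_metric[of "\<lambda>n. q (X0 n)"])
       (use q_meas X0 q_lim[OF X0 X0_lim] in auto)
  have "((\<lambda>y. \<integral>z. q y z \<partial>M) \<longlongrightarrow> (\<integral>z. f' x z \<partial>M)) (at x within S)"
    unfolding tendsto_at_iff_sequentially o_def
  proof (intro allI impI)
    fix X assume X: "\<forall>i. X i \<in> S - {x}" "X \<longlonglongrightarrow> x"
    show "(\<lambda>n. \<integral>z. q (X n) z \<partial>M) \<longlonglongrightarrow> (\<integral>z. f' x z \<partial>M)"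
    proof (rule integral_dominated_convergence[where w = "\<lambda>_. C"])
      show "integrable M (\<lambda>_. C)"
        using M by (rule finite_measure.integrable_const)
    qed (use X q_meas meas q_lim q_bound in auto)
  qed
  moreover have "(\<integral>z. q y z \<partial>M) = ((\<integral>z. f y z \<partial>M) - (\<integral>z. f x z \<partial>M)) / (y - x)" if "y \<in> S" for y
    using int[OF that] int[OF S(3)] by (simp add: q_def)
  then have "eventually (\<lambda>y. (\<integral>z. q y z \<partial>M) = ((\<integral>z. f y z \<partial>M) - (\<integral>z. f x z \<partial>M)) / (y - x)) (at x within S)"
    by (auto simp: eventually_at_filter)
  ultimately have "((\<lambda>y. \<integral>z. f y z \<partial>M) has_field_derivative (\<integral>z. f' x z \<partial>M)) (at x within S)"
    unfolding has_field_derivative_iff by (rule Lim_transform_eventually)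
  then show "((\<lambda>y. \<integral>z. f y z \<partial>M) has_field_derivative (\<integral>z. f' x z \<partial>M)) (at x)"
    by (simp only: at_within_open[OF S(3) S(1)])
qed

section \<open>Regularised powers and pointwise inequalities\<close>

lemma powr_add_le_add_powr:
  fixes a b p :: real
  assumes "0 \<le> a" "0 \<le> b" "0 \<le> p" "p \<le> 1"
  shows "(a + b) powr p \<le> a powr p + b powr p"
proof (cases "a + b = 0")
  case True
  then show ?thesis using assms by simp
next
  case False
  define s where "s = a + b"
  have s: "s > 0" using False assms by (simp add: s_def)
  \<comment> \<open>After scaling the sum to 1, the claim follows from t \<le> t^p on the unit
    interval.\<close>
  have le: "x / s \<le> (x / s) powr p" if "0 \<le> x" "x \<le> s" for x
    using powr_mono'[of p 1 "x / s"] that s assms by (cases "x = 0") auto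
  have "1 = a / s + b / s" using s by (simp add: s_def add_divide_distrib[symmetric])
  also have "\<dots> \<le> (a / s) powr p + (b / s) powr p"
    by (intro add_mono le) (use assms in \<open>auto simp: s_def\<close>)
  also have "\<dots> = (a powr p + b powr p) / s powr p"
    using assms s by (simp add: powr_divide add_divide_distrib)
  finally show ?thesis
    using s by (simp add: s_def[symmetric] field_simps)
qed

text \<open>First and second derivatives of \<open>(|h|\<^sup>2 + \<epsilon>)\<^sup>q\<close> along a curve \<open>h\<close> with derivatives \<open>a\<close> and \<open>b\<close>.\<close>

definition reg_pow :: "real \<Rightarrow> real \<Rightarrow> complex \<Rightarrow> real" where
  "reg_pow q \<epsilon> h = ((norm h)\<^sup>2 + \<epsilon>) powr q"

definition reg_pow_d1 :: "real \<Rightarrow> real \<Rightarrow> complex \<Rightarrow> complex \<Rightarrow> real" where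
  "reg_pow_d1 q \<epsilon> h a = q * ((norm h)\<^sup>2 + \<epsilon>) powr (q - 1) * (2 * Re (cnj h * a))"

definition reg_pow_d2 :: "real \<Rightarrow> real \<Rightarrow> complex \<Rightarrow> complex \<Rightarrow> complex \<Rightarrow> real" where
  "reg_pow_d2 q \<epsilon> h a b = q * (q - 1) * ((norm h)\<^sup>2 + \<epsilon>) powr (q - 2) * (2 * Re (cnj h * a))\<^sup>2
     + q * ((norm h)\<^sup>2 + \<epsilon>) powr (q - 1) * (2 * (norm a)\<^sup>2 + 2 * Re (cnj h * b))"

lemma has_real_derivative_norm_square:
  assumes "(h has_vector_derivative a) (at x)"
  shows "((\<lambda>x. (norm (h x :: complex))\<^sup>2) has_real_derivative (2 * Re (cnj (h x) * a))) (at x)"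
proof -
  have R: "((\<lambda>x. Re (h x)) has_real_derivative Re a) (at x)" 
    and I: "((\<lambda>x. Im (h x)) has_real_derivative Im a) (at x)"
    using assms has_vector_derivative_complex_iff by (auto simp: has_real_derivative_iff_has_vector_derivative)
  show ?thesis
    unfolding cmod_power2 by (rule derivative_eq_intros R I refl | simp add: algebra_simps)+
qed

lemma has_real_derivative_reg_pow:
  assumes "(h has_vector_derivative a) (at x)" "\<epsilon> > 0"
  shows "((\<lambda>x. reg_pow q \<epsilon> (h x)) has_real_derivative reg_pow_d1 q \<epsilon> (h x) a) (at x)"
proof -
  have pos: "(norm (h x))\<^sup>2 + \<epsilon> > 0" using assms(2) by (simp add: add_nonneg_pos)
  have "((\<lambda>x. (norm (h x))\<^sup>2 + \<epsilon>) has_real_derivative (2 * Re (cnj (h x) * a) + 0)) (at x)"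
    by (intro DERIV_add has_real_derivative_norm_square assms DERIV_const)
  from has_real_derivative_powr'[OF this DERIV_const[of q] pos] show ?thesis
    unfolding reg_pow_def reg_pow_d1_def using pos
    by (simp add: powr_diff field_simps)
qed

lemma has_real_derivative_reg_pow_d1:
  assumes h: "(h has_vector_derivative a x) (at x)" and a: "(a has_vector_derivative b) (at x)" and "\<epsilon> > 0"
  shows "((\<lambda>x. reg_pow_d1 q \<epsilon> (h x) (a x)) has_real_derivative reg_pow_d2 q \<epsilon> (h x) (a x) b) (at x)"
proof -
  have dA: "((\<lambda>x. reg_pow (q - 1) \<epsilon> (h x)) has_real_derivative reg_pow_d1 (q - 1) \<epsilon> (h x) (a x)) (at x)"
    by (rule has_real_derivative_reg_pow[OF h assms(3)])
  have dB: "((\<lambda>x. Re (cnj (h x) * a x)) has_real_derivative (norm (a x))\<^sup>2 + Re (cnj (h x) * b)) (at x)"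
  proof -
    have "((\<lambda>x. cnj (h x) * a x) has_vector_derivative (cnj (h x) * b + cnj (a x) * a x)) (at x)"
      by (intro has_vector_derivative_mult bounded_linear.has_vector_derivative[OF bounded_linear_cnj] h a)
    then have "((\<lambda>x. Re (cnj (h x) * a x)) has_vector_derivative Re (cnj (h x) * b + cnj (a x) * a x)) (at x)"
      by (rule bounded_linear.has_vector_derivative[OF bounded_linear_Re])
    moreover have "Re (cnj (h x) * b + cnj (a x) * a x) = (norm (a x))\<^sup>2 + Re (cnj (h x) * b)"
      by (simp add: cmod_power2) (simp add: power2_eq_square)
    ultimately show ?thesis
      by (simp only: has_real_derivative_iff_has_vector_derivative)
  qed
  define R where "R x = Re (cnj (h x) * a x)" for x
  have eq1: "(\<lambda>x. reg_pow_d1 q \<epsilon> (h x) (a x)) = (\<lambda>x. q * reg_pow (q - 1) \<epsilon> (h x) * (2 * R x))"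
    by (simp only: R_def reg_pow_d1_def reg_pow_def)
  have eq2: "reg_pow_d2 q \<epsilon> (h x) (a x) b
      = q * reg_pow_d1 (q - 1) \<epsilon> (h x) (a x) * (2 * R x)
       + 2 * ((norm (a x))\<^sup>2 + Re (cnj (h x) * b)) * (q * reg_pow (q - 1) \<epsilon> (h x))"
  proof -
    have q: "q - 1 - 1 = q - 2" by simp
    show ?thesis
      unfolding reg_pow_d2_def reg_pow_d1_def reg_pow_def R_def[symmetric] q
      by (simp add: power2_eq_square algebra_simps del: times_complex.sel)
  qed
  show ?thesis
    unfolding eq1 eq2 using DERIV_mult[OF DERIV_cmult[OF dA, of q] DERIV_cmult[OF dB, of 2]]
    by (simp only: R_def)
qed

text \<open>Replacing a by its multiple by the imaginary unit turns the real part of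
  \<open>cnj h * a\<close> into minus its imaginary part, so the two squares add up to the squared
  modulus.\<close>

lemma Re_cnj_mult_squares: "(Re (cnj h * a))\<^sup>2 + (Re (cnj h * (\<i> * a)))\<^sup>2 = (norm h)\<^sup>2 * (norm a)\<^sup>2"
proof -
  have "Re (cnj h * (\<i> * a)) = - Im (cnj h * a)" by simp
  then show ?thesis
    using cmod_power2[of "cnj h * a"] by (simp only: norm_mult complex_mod_cnj power_mult_distrib power2_minus)
qed

text \<open>The right-hand side is a Laplacian: the directions -1 and \<open>\<i>\<close> give the
  velocities - a and \<open>\<i> * a\<close>, while their squares 1 and -1 give the accelerations b
  and - b. The b-terms therefore cancel.\<close>

lemma reg_pow_laplacian:
  assumes q: "0 < q" "q \<le> 1" and "\<epsilon> > 0"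
  shows "4 * q\<^sup>2 * (((norm h)\<^sup>2 + \<epsilon>) powr (q - 1) * (norm a)\<^sup>2)
      \<le> reg_pow_d2 q \<epsilon> h (- a) b + reg_pow_d2 q \<epsilon> h (\<i> * a) (- b)"
proof -
  define N where "N = (norm h)\<^sup>2 + \<epsilon>"
  have N: "N > 0" "(norm h)\<^sup>2 \<le> N" using assms(3) by (auto simp: N_def add_nonneg_pos)
  have "reg_pow_d2 q \<epsilon> h (- a) b + reg_pow_d2 q \<epsilon> h (\<i> * a) (- b)
      = q * (q - 1) * N powr (q - 2) * (4 * ((Re (cnj h * a))\<^sup>2 + (Re (cnj h * (\<i> * a)))\<^sup>2))
       + q * N powr (q - 1) * (4 * (norm a)\<^sup>2)"
    unfolding reg_pow_d2_def N_def[symmetric] by (simp add: norm_mult power2_eq_square algebra_simps)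
  also have "\<dots> = 4 * q * (N powr (q - 1) * (norm a)\<^sup>2) - 4 * q * (1 - q) * (N powr (q - 2) * (norm h)\<^sup>2 * (norm a)\<^sup>2)"
    unfolding Re_cnj_mult_squares by (simp add: algebra_simps)
  \<comment> \<open>Only |h|^2 \<le> |h|^2 + \<epsilon> is lost here; at \<epsilon> = 0 this would
    be the exact Hardy--Stein identity, with 4 q^2 = \<alpha>^2 for q = \<alpha>/2.\<close>
  also have "\<dots> \<ge> 4 * q * (N powr (q - 1) * (norm a)\<^sup>2) - 4 * q * (1 - q) * (N powr (q - 1) * (norm a)\<^sup>2)"
  proof -
    have "N powr (q - 2) * (norm h)\<^sup>2 \<le> N powr (q - 2) * N"
      using N by (intro mult_left_mono) auto
    also have "\<dots> = N powr (q - 1)"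
      using N powr_add[of N "q - 2" 1] by simp
    finally show ?thesis
      using q by (intro diff_left_mono mult_left_mono mult_right_mono) auto
  qed
  also have "4 * q * (N powr (q - 1) * (norm a)\<^sup>2) - 4 * q * (1 - q) * (N powr (q - 1) * (norm a)\<^sup>2)
      = 4 * q\<^sup>2 * (N powr (q - 1) * (norm a)\<^sup>2)"
    by (simp add: power2_eq_square algebra_simps)
  finally show ?thesis by (simp add: N_def)
qed

text \<open>A crude bound, obtained from (|h|^2 + \<epsilon>)^(q-1) \<le> \<epsilon>^(q-1) since q -
  1 \<le> 0. It serves as a dominating constant at fixed \<epsilon> and never reaches the final
  estimate.\<close>

lemma reg_pow_d1_bound:
  assumes q: "0 < q" "q \<le> 1" and "\<epsilon> > 0" and "norm h \<le> K" "norm a \<le> K"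
  shows "\<bar>reg_pow_d1 q \<epsilon> h a\<bar> \<le> q * \<epsilon> powr (q - 1) * (2 * K\<^sup>2)"
proof -
  have ha: "\<bar>Re (cnj h * a)\<bar> \<le> K * K"
    using abs_Re_le_cmod[of "cnj h * a"] mult_mono[OF assms(4,5)] assms(4) norm_ge_zero[of h]
    by (simp add: norm_mult del: times_complex.sel)
  have p: "((norm h)\<^sup>2 + \<epsilon>) powr (q - 1) \<le> \<epsilon> powr (q - 1)"
    using assms by (intro powr_mono2') auto
  have "\<bar>reg_pow_d1 q \<epsilon> h a\<bar> = q * ((norm h)\<^sup>2 + \<epsilon>) powr (q - 1) * (2 * \<bar>Re (cnj h * a)\<bar>)"
    using q by (simp add: reg_pow_d1_def abs_mult del: times_complex.sel)
  also have "\<dots> \<le> q * \<epsilon> powr (q - 1) * (2 * (K * K))"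
    using q by (intro mult_mono mult_left_mono p ha) auto
  finally show ?thesis by (simp add: power2_eq_square)
qed

lemma reg_pow_d2_bound:
  assumes q: "0 < q" "q \<le> 1" and "\<epsilon> > 0" and "norm h \<le> K" "norm a \<le> K" "norm b \<le> K"
  shows "\<bar>reg_pow_d2 q \<epsilon> h a b\<bar> \<le> q * (1 - q) * \<epsilon> powr (q - 2) * (2 * K\<^sup>2)\<^sup>2 + q * \<epsilon> powr (q - 1) * (4 * K\<^sup>2)"
proof -
  have K0: "0 \<le> K" using assms(4) norm_ge_zero[of h] by linarith
  have ha: "\<bar>Re (cnj h * a)\<bar> \<le> K\<^sup>2" "\<bar>Re (cnj h * b)\<bar> \<le> K\<^sup>2"
    using abs_Re_le_cmod[of "cnj h * a"] abs_Re_le_cmod[of "cnj h * b"]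
      mult_mono[OF assms(4,5)] mult_mono[OF assms(4,6)] K0
    by (simp_all add: norm_mult power2_eq_square del: times_complex.sel)
  have p1: "((norm h)\<^sup>2 + \<epsilon>) powr (q - 1) \<le> \<epsilon> powr (q - 1)"
    using assms by (intro powr_mono2') auto
  have p2: "((norm h)\<^sup>2 + \<epsilon>) powr (q - 2) \<le> \<epsilon> powr (q - 2)"
    using assms by (intro powr_mono2') auto
  have aa: "(norm a)\<^sup>2 \<le> K\<^sup>2" using assms(5) by (intro power_mono) auto
  have "\<bar>q * (q - 1) * ((norm h)\<^sup>2 + \<epsilon>) powr (q - 2) * (2 * Re (cnj h * a))\<^sup>2\<bar>
      = q * (1 - q) * ((norm h)\<^sup>2 + \<epsilon>) powr (q - 2) * (2 * \<bar>Re (cnj h * a)\<bar>)\<^sup>2"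
    using q by (simp add: abs_mult power_mult_distrib del: times_complex.sel)
  also have "\<dots> \<le> q * (1 - q) * \<epsilon> powr (q - 2) * (2 * K\<^sup>2)\<^sup>2"
    using q ha by (intro mult_mono mult_left_mono p2 power_mono) auto
  finally have 1: "\<bar>q * (q - 1) * ((norm h)\<^sup>2 + \<epsilon>) powr (q - 2) * (2 * Re (cnj h * a))\<^sup>2\<bar>
      \<le> q * (1 - q) * \<epsilon> powr (q - 2) * (2 * K\<^sup>2)\<^sup>2" .
  have "\<bar>q * ((norm h)\<^sup>2 + \<epsilon>) powr (q - 1) * (2 * (norm a)\<^sup>2 + 2 * Re (cnj h * b))\<bar>
      = q * ((norm h)\<^sup>2 + \<epsilon>) powr (q - 1) * \<bar>2 * (norm a)\<^sup>2 + 2 * Re (cnj h * b)\<bar>"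
    using q by (simp add: abs_mult del: times_complex.sel)
  also have "\<dots> \<le> q * \<epsilon> powr (q - 1) * (4 * K\<^sup>2)"
  proof (intro mult_mono mult_left_mono p1)
    show "\<bar>2 * (norm a)\<^sup>2 + 2 * Re (cnj h * b)\<bar> \<le> 4 * K\<^sup>2"
      using ha(2) aa zero_le_power2[of "norm a"] by linarith
  qed (use q in auto)
  finally show ?thesis
    unfolding reg_pow_d2_def using 1 by (intro order_trans[OF abs_triangle_ineq] add_mono)
qed

text \<open>Weighted AM-GM, followed by \<open>|h|\<^sup>2\<^sup>-\<^sup>\<alpha> \<le> (B/y)\<^sup>2\<^sup>-\<^sup>\<alpha>\<close>.\<close>

lemma weighted_am_gm:
  fixes h a :: complex
  assumes \<alpha>: "0 < \<alpha>" "\<alpha> < 2" and "\<epsilon> > 0" "y > 0" "B > 0" "\<kappa> > 0" and h: "norm h \<le> B / y"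
  shows "2 * norm h * norm a * y powr (2 - \<alpha>)
    \<le> \<kappa> * y * (((norm h)\<^sup>2 + \<epsilon>) powr (\<alpha> / 2 - 1) * (norm a)\<^sup>2)
      + (B powr (2 - \<alpha>) / \<kappa> * y powr (1 - \<alpha>) + \<epsilon> powr (1 - \<alpha> / 2) / \<kappa> * y powr (3 - 2 * \<alpha>)) * (norm h)\<^sup>2"
proof -
  define N where "N = (norm h)\<^sup>2 + \<epsilon>"
  have N: "N > 0" using assms by (simp add: N_def add_nonneg_pos)
  define c where "c = N powr (\<alpha> / 2 - 1)"
  have c: "c > 0" using N by (simp add: c_def)
  have c_inv: "1 / c = N powr (1 - \<alpha> / 2)"
    using powr_minus_divide[of N "\<alpha> / 2 - 1"] by (simp add: c_def)
  \<comment> \<open>The exponent 1 - \<alpha>/2 lies between 0 and 1, so subadditivity splits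
    \<epsilon> off before |h| \<le> B/y is used.\<close>
  have N_le: "N powr (1 - \<alpha> / 2) \<le> (B / y) powr (2 - \<alpha>) + \<epsilon> powr (1 - \<alpha> / 2)"
  proof -
    have "N powr (1 - \<alpha> / 2) \<le> ((norm h)\<^sup>2) powr (1 - \<alpha> / 2) + \<epsilon> powr (1 - \<alpha> / 2)"
      unfolding N_def using assms by (intro powr_add_le_add_powr) auto
    also have "((norm h)\<^sup>2) powr (1 - \<alpha> / 2) \<le> ((B / y)\<^sup>2) powr (1 - \<alpha> / 2)"
      using assms by (intro powr_mono2 power_mono) auto
    also have "((B / y)\<^sup>2) powr (1 - \<alpha> / 2) = (B / y) powr (2 - \<alpha>)"
    proof -
      have "(B / y)\<^sup>2 = (B / y) powr 2"
        using assms by (simp add: powr_numeral)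
      then show ?thesis by (simp add: powr_powr algebra_simps)
    qed
    finally show ?thesis by simp
  qed
  have "2 * norm h * norm a \<le> \<kappa> * y powr (\<alpha> - 1) * (c * (norm a)\<^sup>2) + (1 / (\<kappa> * y powr (\<alpha> - 1))) * ((1 / c) * (norm h)\<^sup>2)"
  proof -
    \<comment> \<open>The power y^(\<alpha>-1) in the weight is chosen so that, after multiplication
      by y^(2-\<alpha>), the term with |a|^2 carries exactly the factor y of the Hardy--Stein
      integral.\<close>
    define \<mu> where "\<mu> = \<kappa> * y powr (\<alpha> - 1) * c"
    have \<mu>: "\<mu> > 0" using assms c by (simp add: \<mu>_def)
    have "0 \<le> (\<mu> * norm a - norm h)\<^sup>2 / \<mu>" using \<mu> by simp
    also have "\<dots> = \<mu> * (norm a)\<^sup>2 + (norm h)\<^sup>2 / \<mu> - 2 * norm h * norm a"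
      using \<mu> by (simp add: power2_eq_square field_simps)
    finally show ?thesis by (simp add: \<mu>_def mult_ac)
  qed
  then have "2 * norm h * norm a * y powr (2 - \<alpha>) \<le>
      (\<kappa> * y powr (\<alpha> - 1) * (c * (norm a)\<^sup>2) + (1 / (\<kappa> * y powr (\<alpha> - 1))) * ((1 / c) * (norm h)\<^sup>2)) * y powr (2 - \<alpha>)"
    by (rule mult_right_mono) simp
  also have "\<dots> = \<kappa> * (y powr (\<alpha> - 1) * y powr (2 - \<alpha>)) * (c * (norm a)\<^sup>2)
      + (y powr (2 - \<alpha>) / y powr (\<alpha> - 1)) / \<kappa> * ((1 / c) * (norm h)\<^sup>2)"
    by (simp add: algebra_simps)
  also have "y powr (\<alpha> - 1) * y powr (2 - \<alpha>) = y"
    using assms by (simp add: powr_add[symmetric])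
  also have "y powr (2 - \<alpha>) / y powr (\<alpha> - 1) = y powr (3 - 2 * \<alpha>)"
    using assms by (simp add: powr_diff[symmetric])
  also have "y powr (3 - 2 * \<alpha>) / \<kappa> * ((1 / c) * (norm h)\<^sup>2) \<le>
      y powr (3 - 2 * \<alpha>) / \<kappa> * (((B / y) powr (2 - \<alpha>) + \<epsilon> powr (1 - \<alpha> / 2)) * (norm h)\<^sup>2)"
    unfolding c_inv using assms by (intro mult_left_mono mult_right_mono N_le) auto
  also have "\<dots> = (B powr (2 - \<alpha>) / \<kappa> * (y powr (3 - 2 * \<alpha>) / y powr (2 - \<alpha>))
       + \<epsilon> powr (1 - \<alpha> / 2) / \<kappa> * y powr (3 - 2 * \<alpha>)) * (norm h)\<^sup>2"
    using assms by (simp add: powr_divide algebra_simps add_divide_distrib)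
  also have "y powr (3 - 2 * \<alpha>) / y powr (2 - \<alpha>) = y powr (1 - \<alpha>)"
    using assms by (simp add: powr_diff[symmetric])
  finally show ?thesis by (simp add: c_def N_def)
qed

lemma powr_half_of_square:
  fixes x :: real
  assumes "0 \<le> x"
  shows "(x\<^sup>2) powr (a / 2) = x powr a"
proof (cases "x = 0")
  case False
  then have "x\<^sup>2 = x powr 2" using assms by (simp add: powr_numeral)
  then show ?thesis by (simp add: powr_powr)
qed simp

lemma borel_measurable_cnj [measurable]: "cnj \<in> borel_measurable borel"
  by (intro borel_measurable_continuous_onI continuous_intros)

text \<open>The one-variable core, detached from the polydisc. In the application the points z range
  over the torus, \<open>G z w\<close> is \<phi> at a dilated point whose j-th coordinate is
  multiplied by exp w, and \<open>rotate\<close> is rotation of that coordinate. L > 0 puts the line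
  Re w = 0, on which the Hardy integral lives, strictly inside the domain.\<close>

locale rotating_family = finite_measure M
  for M :: "'a measure" +
  fixes G :: "'a \<Rightarrow> complex \<Rightarrow> complex" and L B :: real and rotate :: "real \<Rightarrow> 'a \<Rightarrow> 'a"
  assumes L_pos: "0 < L" and B_pos: "0 < B"
    and holo: "\<And>z. z \<in> space M \<Longrightarrow> G z holomorphic_on {w. Re w < L}"
    and bounded: "\<And>z w. z \<in> space M \<Longrightarrow> Re w < L \<Longrightarrow> norm (G z w) \<le> B"
    and meas: "\<And>w. Re w < L \<Longrightarrow> (\<lambda>z. G z w) \<in> borel_measurable M"
    and rotate_meas: "\<And>s. rotate s \<in> measurable M M"
    and rotate_distr: "\<And>s. distr M M (rotate s) = M"
    and rotate_eq: "\<And>z w s. z \<in> space M \<Longrightarrow> Re w < L \<Longrightarrow> G z (w + \<i> * of_real s) = G (rotate s z) w"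
begin

section \<open>Derivatives in w: bounds, measurability, equivariance\<close>

definition D :: "nat \<Rightarrow> 'a \<Rightarrow> complex \<Rightarrow> complex" where
  "D n z = (deriv ^^ n) (G z)"

lemma D_0 [simp]: "D 0 = G"
  by (simp add: D_def fun_eq_iff)

lemma open_half: "open {w. Re w < L}"
  by (rule open_halfspace_Re_lt)

lemma D_deriv:
  assumes "z \<in> space M" "Re w < L"
  shows "(D n z has_field_derivative D (Suc n) z w) (at w)"
proof -
  have "(D n z has_field_derivative deriv (D n z) w) (at w)"
    unfolding D_def
    by (rule holomorphic_derivI[OF holomorphic_higher_deriv[OF holo[OF assms(1)] open_half] open_half])
       (use assms in simp)
  then show ?thesis by (simp add: D_def)
qed

text \<open>Cauchy's inequality on a disc inside the half-plane. At w = - y the radius y is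
  admissible for every L > 0, so |G'| \<le> B/y there, uniformly in L.\<close>

lemma D_bound:
  assumes z: "z \<in> space M" and r: "0 < r" "Re w + r < L"
  shows "norm (D n z w) \<le> fact n * B / r ^ n"
proof -
  have sub: "cball w r \<subseteq> {w. Re w < L}"
  proof
    fix v assume "v \<in> cball w r"
    then have "Re (v - w) \<le> r"
      using complex_Re_le_cmod[of "v - w"] by (simp add: dist_norm norm_minus_commute)
    then show "v \<in> {w. Re w < L}" using r by simp
  qed
  show ?thesis
    unfolding D_def
  proof (rule Cauchy_inequality)
    show "G z holomorphic_on ball w r"
      by (rule holomorphic_on_subset[OF holo[OF z]]) (use sub ball_subset_cball in blast)
    show "continuous_on (cball w r) (G z)"
      by (rule holomorphic_on_imp_continuous_on[OF holomorphic_on_subset[OF holo[OF z] sub]])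
    show "norm (G z x) \<le> B" if "norm (w - x) = r" for x
      using that sub by (intro bounded z) (auto simp: dist_norm)
  qed (use r in auto)
qed

text \<open>K depends on L and is used only for integrability, domination and qualitative
  boundedness. Order 3 suffices because two differentiations of a power of |G'| reach the third
  derivative.\<close>

lemma D_bound_half:
  obtains K where "\<And>n z w. n \<le> 3 \<Longrightarrow> z \<in> space M \<Longrightarrow> Re w < L / 2 \<Longrightarrow> norm (D n z w) \<le> K" "K > 0"
proof
  define K where "K = (\<Sum>n\<le>3. fact n * B / (L / 2) ^ n)"
  show "norm (D n z w) \<le> K" if "n \<le> 3" "z \<in> space M" "Re w < L / 2" for n z w
  proof -
    have "norm (D n z w) \<le> fact n * B / (L / 2) ^ n"
      using that L_pos by (intro D_bound) auto
    also have "\<dots> \<le> K"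
      unfolding K_def using that L_pos B_pos by (intro member_le_sum) auto
    finally show ?thesis .
  qed
  show "K > 0"
    unfolding K_def using L_pos B_pos by (intro sum_pos) auto
qed

lemma D_meas: "Re w < L \<Longrightarrow> (\<lambda>z. D n z w) \<in> borel_measurable M"
proof (induction n arbitrary: w)
  case 0
  then show ?case by (simp add: meas)
next
  case (Suc n)
  \<comment> \<open>Negative real increments keep w + h in the half-plane for every w in it.\<close>
  define h where "h k = - (1 / real (Suc k))" for k
  have h: "h k < 0" for k by (simp add: h_def)
  have h_lim: "h \<longlonglongrightarrow> 0"
    using tendsto_minus[OF LIMSEQ_inverse_real_of_nat] by (simp add: h_def[abs_def] inverse_eq_divide)
  show ?case
  proof (rule borel_measurable_LIMSEQ_metric)
    show "(\<lambda>z. (D n z (w + of_real (h k)) - D n z w) / of_real (h k)) \<in> borel_measurable M" for k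
    proof -
      have "Re (w + of_real (h k)) < L" using Suc.prems h[of k] by simp
      with Suc show ?thesis by (intro borel_measurable_divide borel_measurable_diff) auto
    qed
    show "(\<lambda>k. (D n z (w + of_real (h k)) - D n z w) / of_real (h k)) \<longlonglongrightarrow> D (Suc n) z w"
      if z: "z \<in> space M" for z
    proof -
      have "((\<lambda>h. (D n z (w + h) - D n z w) / h) \<longlongrightarrow> D (Suc n) z w) (at 0)"
        using D_deriv[OF z Suc.prems, of n] by (simp only: DERIV_def)
      moreover have "filterlim (\<lambda>k. complex_of_real (h k)) (at 0) sequentially"
        unfolding filterlim_at using h tendsto_of_real[OF h_lim, where 'a = complex]
        by (auto simp: less_le)
      ultimately show ?thesis by (rule filterlim_compose)
    qed
  qed
qed

lemma D_rotate:
  assumes z: "z \<in> space M" and w: "Re w < L"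
  shows "D n z (w + \<i> * of_real s) = D n (rotate s z) w"
proof -
  have "(deriv ^^ n) (\<lambda>v. G z (1 * v + \<i> * of_real s)) w = 1 ^ n * D n z (1 * w + \<i> * of_real s)"
    unfolding D_def by (rule higher_deriv_compose_linear'[OF holo[OF z] open_half open_half]) (use w in auto)
  moreover have "(deriv ^^ n) (\<lambda>v. G z (1 * v + \<i> * of_real s)) w = D n (rotate s z) w"
    unfolding D_def
  proof (rule higher_deriv_cong_ev[OF _ refl])
    have "eventually (\<lambda>v. v \<in> {w. Re w < L}) (nhds w)"
      using w by (intro eventually_nhds_in_open open_half) auto
    then show "\<forall>\<^sub>F v in nhds w. G z (1 * v + \<i> * of_real s) = G (rotate s z) v"
      by eventually_elim (simp add: rotate_eq[OF z])
  qed
  ultimately show ?thesis by simp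
qed

text \<open>The factor c^k allows the lemma to be applied again to its own result. The direction c =
  -1 is motion in y, and c = \<open>\<i>\<close> is motion along a vertical line.\<close>

lemma D_line_deriv:
  assumes z: "z \<in> space M" and w: "Re (w + c * of_real x) < L"
  shows "((\<lambda>x. c ^ k * D n z (w + c * of_real x)) has_vector_derivative c ^ Suc k * D (Suc n) z (w + c * of_real x)) (at x)"
proof -
  have "((\<lambda>x. w + c * of_real x) has_vector_derivative c) (at x)"
    by (auto intro!: derivative_eq_intros simp: has_vector_derivative_def scaleR_conv_of_real)
  from field_vector_diff_chain_at[OF this D_deriv[OF z w, of n]]
  have "((\<lambda>x. D n z (w + c * of_real x)) has_vector_derivative c * D (Suc n) z (w + c * of_real x)) (at x)"
    by (simp add: o_def)
  from has_vector_derivative_mult_right[OF this, of "c ^ k"] show ?thesis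
    by (simp add: mult_ac)
qed

lemma integrable_bounded:
  fixes f :: "'a \<Rightarrow> 'b::{banach, second_countable_topology}"
  assumes "f \<in> borel_measurable M" "\<And>z. z \<in> space M \<Longrightarrow> norm (f z) \<le> C"
  shows "integrable M f"
  using assms by (intro integrable_const_bound[of _ C]) auto

lemma integral_rotate:
  fixes f :: "'a \<Rightarrow> real"
  assumes "f \<in> borel_measurable M"
  shows "(\<integral>z. f (rotate s z) \<partial>M) = (\<integral>z. f z \<partial>M)"
  using integral_distr[OF rotate_meas assms, of s] by (simp add: rotate_distr)

lemma fourier_deriv:
  assumes w: "Re w < L / 2" and c: "c \<in> borel_measurable M" "\<And>z. z \<in> space M \<Longrightarrow> norm (c z) \<le> C"
  shows "((\<lambda>w. \<integral>z. G z w * c z \<partial>M) has_field_derivative (\<integral>z. D 1 z w * c z \<partial>M)) (at w)"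
proof -
  obtain K where K: "\<And>n z w. n \<le> 3 \<Longrightarrow> z \<in> space M \<Longrightarrow> Re w < L / 2 \<Longrightarrow> norm (D n z w) \<le> K" "K > 0"
    by (rule D_bound_half) blast
  have b: "norm (D n z w * c z) \<le> K * \<bar>C\<bar>" if "n \<le> 3" "z \<in> space M" "Re w < L / 2" for n z w
    unfolding norm_mult using K(1)[OF that] c(2)[OF that(2)] K(2) by (intro mult_mono) auto
  show ?thesis
  proof (rule has_field_derivative_integral(1)[OF finite_measure_axioms open_halfspace_Re_lt[of "L / 2"] convex_halfspace_Re_lt])
    show "((\<lambda>w. G z w * c z) has_field_derivative D 1 z w * c z) (at w)"
      if "w \<in> {w. Re w < L / 2}" "z \<in> space M" for w z
      using that L_pos D_deriv[of z w 0] by (intro DERIV_cmult_right) auto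
    show "norm (D 1 z w * c z) \<le> K * \<bar>C\<bar>" if "w \<in> {w. Re w < L / 2}" "z \<in> space M" for w z
      using b[of 1] that by simp
    show "integrable M (\<lambda>z. G z w * c z)" if "w \<in> {w. Re w < L / 2}" for w
      by (rule integrable_bounded[where C = "K * \<bar>C\<bar>"])
         (use b[of 0] that c L_pos meas in \<open>auto intro!: borel_measurable_times\<close>)
  qed (use w in auto)
qed

section \<open>The Hardy--Stein convexity and the interpolation inequality\<close>

definition energy :: "real \<Rightarrow> real" where
  "energy y = (\<integral>z. (norm (D 1 z (- of_real y)))\<^sup>2 \<partial>M)"

text \<open>The Hardy--Stein step: the mean of the regularised power \<open>(|G'|\<^sup>2 + \<epsilon>)\<^sup>q\<close> over the lines
  \<open>Re w = - y\<close> is convex, and its second derivative controls \<open>|G''|\<^sup>2\<close>. Rotation invariance of the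
  measure makes the second derivative in the imaginary direction integrate to \<open>0\<close>.\<close>

lemma hardy_stein:
  assumes q: "0 < q" "q \<le> 1" and \<epsilon>: "\<epsilon> > 0"
  obtains m' m'' where
    "\<And>y. y > - L / 2 \<Longrightarrow> ((\<lambda>y. \<integral>z. reg_pow q \<epsilon> (D 1 z (- of_real y)) \<partial>M) has_real_derivative m' y) (at y)"
    "\<And>y. y > - L / 2 \<Longrightarrow> (m' has_real_derivative m'' y) (at y)"
    "\<And>y. y > - L / 2 \<Longrightarrow> integrable M (\<lambda>z. ((norm (D 1 z (- of_real y)))\<^sup>2 + \<epsilon>) powr (q - 1) * (norm (D 2 z (- of_real y)))\<^sup>2)"
    "\<And>y. y > - L / 2 \<Longrightarrow> 4 * q\<^sup>2 * (\<integral>z. ((norm (D 1 z (- of_real y)))\<^sup>2 + \<epsilon>) powr (q - 1) * (norm (D 2 z (- of_real y)))\<^sup>2 \<partial>M) \<le> m'' y"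
proof -
  obtain K where K: "\<And>n z w. n \<le> 3 \<Longrightarrow> z \<in> space M \<Longrightarrow> Re w < L / 2 \<Longrightarrow> norm (D n z w) \<le> K" "K > 0"
    by (rule D_bound_half) blast
  define u where "u w z = reg_pow q \<epsilon> (D 1 z w)" for w z
  define u1 where "u1 c w z = reg_pow_d1 q \<epsilon> (D 1 z w) (c * D 2 z w)" for c w z
  define u2 where "u2 c w z = reg_pow_d2 q \<epsilon> (D 1 z w) (c * D 2 z w) (c\<^sup>2 * D 3 z w)" for c w z
  have D_meas': "(\<lambda>z. D n z w) \<in> borel_measurable M" if "Re w < L / 2" for n w
    using that L_pos by (intro D_meas) auto
  have u_meas: "u w \<in> borel_measurable M" if "Re w < L / 2" for w
    using D_meas'[OF that, measurable] unfolding u_def reg_pow_def by measurable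
  have u1_meas: "u1 c w \<in> borel_measurable M" if "Re w < L / 2" for c w
    using D_meas'[OF that, measurable] unfolding u1_def reg_pow_d1_def by measurable
  have u2_meas: "u2 c w \<in> borel_measurable M" if "Re w < L / 2" for c w
    using D_meas'[OF that, measurable] unfolding u2_def reg_pow_d2_def by measurable
  define C1 where "C1 = q * \<epsilon> powr (q - 1) * (2 * K\<^sup>2)"
  define C2 where "C2 = q * (1 - q) * \<epsilon> powr (q - 2) * (2 * K\<^sup>2)\<^sup>2 + q * \<epsilon> powr (q - 1) * (4 * K\<^sup>2)"
  have u_bd: "norm (u w z) \<le> (K\<^sup>2 + \<epsilon>) powr q" if "Re w < L / 2" "z \<in> space M" for w z
    unfolding u_def reg_pow_def using K(1)[of 1 z w] that q \<epsilon>
    by (auto intro!: powr_mono2 power_mono)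
  have u1_bd: "norm (u1 c w z) \<le> C1" if "norm c = 1" "Re w < L / 2" "z \<in> space M" for c w z
    unfolding u1_def C1_def real_norm_def
    by (rule reg_pow_d1_bound) (use that q \<epsilon> K(1) in \<open>auto simp: norm_mult\<close>)
  have u2_bd: "norm (u2 c w z) \<le> C2" if "norm c = 1" "Re w < L / 2" "z \<in> space M" for c w z
    unfolding u2_def C2_def real_norm_def
    by (rule reg_pow_d2_bound) (use that q \<epsilon> K(1) in \<open>auto simp: norm_mult norm_power\<close>)
  have u_int: "integrable M (u w)" if "Re w < L / 2" for w
    by (rule integrable_bounded[OF u_meas u_bd]) (use that in auto)
  have u1_int: "integrable M (u1 c w)" if "norm c = 1" "Re w < L / 2" for w c
    by (rule integrable_bounded[OF u1_meas u1_bd]) (use that in auto)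
  have u2_int: "integrable M (u2 c w)" if "norm c = 1" "Re w < L / 2" for w c
    by (rule integrable_bounded[OF u2_meas u2_bd]) (use that in auto)
  \<comment> \<open>Base point, direction and interval are left free: the direction -1 is used on a
    half-line, and the direction \<open>\<i>\<close> on the whole real line.\<close>
  have D1: "((\<lambda>x. \<integral>z. u (w + c * of_real x) z \<partial>M) has_real_derivative (\<integral>z. u1 c (w + c * of_real x) z \<partial>M)) (at x)"
    if c: "norm c = 1" and x: "x \<in> S" and S: "open S" "convex S" "\<And>x. x \<in> S \<Longrightarrow> Re (w + c * of_real x) < L / 2"
    for w c S x
  proof (rule has_field_derivative_integral(1)[where C = C1, OF finite_measure_axioms S(1,2) x])
    fix y z assume y: "y \<in> S" and z: "z \<in> space M"
    have "((\<lambda>x. D 1 z (w + c * of_real x)) has_vector_derivative c * D 2 z (w + c * of_real y)) (at y)"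
      using D_line_deriv[OF z, of w c y 0 1] S(3)[OF y] L_pos by (simp add: numeral_2_eq_2)
    from has_real_derivative_reg_pow[OF this \<epsilon>]
    show "((\<lambda>x. u (w + c * of_real x) z) has_real_derivative u1 c (w + c * of_real y) z) (at y)"
      by (simp add: u_def u1_def)
  qed (use u1_bd u_int S c in auto)
  have D2: "((\<lambda>x. \<integral>z. u1 c (w + c * of_real x) z \<partial>M) has_real_derivative (\<integral>z. u2 c (w + c * of_real x) z \<partial>M)) (at x)"
    if c: "norm c = 1" and x: "x \<in> S" and S: "open S" "convex S" "\<And>x. x \<in> S \<Longrightarrow> Re (w + c * of_real x) < L / 2"
    for w c S x
  proof (rule has_field_derivative_integral(1)[where C = C2, OF finite_measure_axioms S(1,2) x])
    fix y z assume y: "y \<in> S" and z: "z \<in> space M"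
    have Re: "Re (w + c * of_real y) < L" using S(3)[OF y] L_pos by simp
    have 1: "((\<lambda>x. D 1 z (w + c * of_real x)) has_vector_derivative c * D 2 z (w + c * of_real y)) (at y)"
      using D_line_deriv[OF z Re, of 0 1] by (simp add: numeral_2_eq_2)
    have 2: "((\<lambda>x. c * D 2 z (w + c * of_real x)) has_vector_derivative c\<^sup>2 * D 3 z (w + c * of_real y)) (at y)"
      using D_line_deriv[OF z Re, of 1 2] by (simp add: numeral_3_eq_3 numeral_2_eq_2)
    from has_real_derivative_reg_pow_d1[OF 1 2 \<epsilon>]
    show "((\<lambda>x. u1 c (w + c * of_real x) z) has_real_derivative u2 c (w + c * of_real y) z) (at y)"
      by (simp add: u1_def u2_def)
  qed (use u2_bd u1_int S c in auto)
  define m' where "m' y = (\<integral>z. u1 (-1) (- of_real y) z \<partial>M)" for y :: real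
  define m'' where "m'' y = (\<integral>z. u2 (-1) (- of_real y) z \<partial>M)" for y :: real
  show ?thesis
  proof (rule that[of m' m''])
    fix y :: real assume y: "y > - L / 2"
    have Re_y: "Re (- of_real y) < L / 2" using y by simp
    show "((\<lambda>y. \<integral>z. reg_pow q \<epsilon> (D 1 z (- of_real y)) \<partial>M) has_real_derivative m' y) (at y)"
      using D1[of "-1" y "{- L / 2<..}" 0] y by (simp add: m'_def u_def)
    show "(m' has_real_derivative m'' y) (at y)"
      using D2[of "-1" y "{- L / 2<..}" 0] y by (simp add: m'_def[abs_def] m''_def)
    define v where "v z = ((norm (D 1 z (- of_real y)))\<^sup>2 + \<epsilon>) powr (q - 1) * (norm (D 2 z (- of_real y)))\<^sup>2" for z
    show v_int: "integrable M v"
    proof (rule integrable_bounded)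
      show "v \<in> borel_measurable M"
        using D_meas'[OF Re_y, measurable] unfolding v_def by measurable
      show "norm (v z) \<le> \<epsilon> powr (q - 1) * K\<^sup>2" if z: "z \<in> space M" for z
        unfolding v_def using K(1)[of 2 z "- of_real y"] z Re_y q \<epsilon>
        by (auto intro!: mult_mono powr_mono2' power_mono)
    qed
    have const: "(\<lambda>x. \<integral>z. u (- of_real y + \<i> * of_real x) z \<partial>M) = (\<lambda>x. \<integral>z. u (- of_real y) z \<partial>M)"
    proof
      fix x :: real
      have "(\<integral>z. u (- of_real y + \<i> * of_real x) z \<partial>M) = (\<integral>z. u (- of_real y) (rotate x z) \<partial>M)"
        by (rule Bochner_Integration.integral_cong[OF refl])
           (use Re_y L_pos D_rotate[of _ "- of_real y"] in \<open>auto simp: u_def\<close>)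
      also have "\<dots> = (\<integral>z. u (- of_real y) z \<partial>M)"
        by (rule integral_rotate[OF u_meas[OF Re_y]])
      finally show "(\<integral>z. u (- of_real y + \<i> * of_real x) z \<partial>M) = (\<integral>z. u (- of_real y) z \<partial>M)" .
    qed
    \<comment> \<open>Needed at every x and not only at 0, so that this vanishing function can be
      differentiated once more.\<close>
    have zero1: "(\<integral>z. u1 \<i> (- of_real y + \<i> * of_real x) z \<partial>M) = 0" for x
    proof (rule DERIV_unique)
      show "((\<lambda>x. \<integral>z. u (- of_real y + \<i> * of_real x) z \<partial>M) has_real_derivative 0) (at x)"
        unfolding const by (rule DERIV_const)
      show "((\<lambda>x. \<integral>z. u (- of_real y + \<i> * of_real x) z \<partial>M) has_real_derivative (\<integral>z. u1 \<i> (- of_real y + \<i> * of_real x) z \<partial>M)) (at x)"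
        by (rule D1[of _ _ UNIV]) (use Re_y in auto)
    qed
    have zero2: "(\<integral>z. u2 \<i> (- of_real y) z \<partial>M) = 0"
    proof (rule DERIV_unique)
      show "((\<lambda>x. \<integral>z. u1 \<i> (- of_real y + \<i> * of_real x) z \<partial>M) has_real_derivative 0) (at 0)"
        unfolding zero1 by (rule DERIV_const)
      show "((\<lambda>x. \<integral>z. u1 \<i> (- of_real y + \<i> * of_real x) z \<partial>M) has_real_derivative (\<integral>z. u2 \<i> (- of_real y) z \<partial>M)) (at 0)"
        using D2[of \<i> 0 UNIV "- of_real y"] Re_y by simp
    qed
    have "4 * q\<^sup>2 * (\<integral>z. v z \<partial>M) = (\<integral>z. 4 * q\<^sup>2 * v z \<partial>M)"
      by simp
    also have "\<dots> \<le> (\<integral>z. u2 (-1) (- of_real y) z + u2 \<i> (- of_real y) z \<partial>M)"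
    proof (rule integral_mono)
      show "integrable M (\<lambda>z. 4 * q\<^sup>2 * v z)" using v_int by simp
      show "integrable M (\<lambda>z. u2 (-1) (- of_real y) z + u2 \<i> (- of_real y) z)"
        using u2_int Re_y by simp
      show "4 * q\<^sup>2 * v z \<le> u2 (-1) (- of_real y) z + u2 \<i> (- of_real y) z" for z
        unfolding v_def u2_def using reg_pow_laplacian[OF q \<epsilon>] by simp
    qed
    also have "\<dots> = m'' y"
      using u2_int[of _ "- of_real y"] Re_y by (simp add: zero2 m''_def)
    finally show "4 * q\<^sup>2 * (\<integral>z. v z \<partial>M) \<le> m'' y" .
  qed
qed

lemma energy_deriv:
  assumes y: "y > - L / 2"
  shows "(energy has_real_derivative (\<integral>z. - 2 * Re (cnj (D 1 z (- of_real y)) * D 2 z (- of_real y)) \<partial>M)) (at y)"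
    and "integrable M (\<lambda>z. (norm (D 1 z (- of_real y)))\<^sup>2)"
    and "integrable M (\<lambda>z. Re (cnj (D 1 z (- of_real y)) * D 2 z (- of_real y)))"
proof -
  obtain K where K: "\<And>n z w. n \<le> 3 \<Longrightarrow> z \<in> space M \<Longrightarrow> Re w < L / 2 \<Longrightarrow> norm (D n z w) \<le> K" "K > 0"
    by (rule D_bound_half) blast
  have D_meas': "(\<lambda>z. D n z (- of_real y)) \<in> borel_measurable M" if "y > - L / 2" for n y
    using that L_pos by (intro D_meas) auto
  have bd: "\<bar>- 2 * Re (cnj (D 1 z (- of_real y)) * D 2 z (- of_real y))\<bar> \<le> 2 * K\<^sup>2" if "z \<in> space M" "y > - L / 2" for y z
  proof -
    have "\<bar>Re (cnj (D 1 z (- of_real y)) * D 2 z (- of_real y))\<bar> \<le> norm (cnj (D 1 z (- of_real y)) * D 2 z (- of_real y))"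
      by (rule abs_Re_le_cmod)
    also have "\<dots> \<le> K * K"
      unfolding norm_mult using K(1)[of 1 z "- of_real y"] K(1)[of 2 z "- of_real y"] K(2) that
      by (intro mult_mono) auto
    finally show ?thesis by (simp add: power2_eq_square abs_mult del: times_complex.sel)
  qed
  have int: "integrable M (\<lambda>z. (norm (D 1 z (- of_real y)))\<^sup>2)" if "y > - L / 2" for y
    by (rule integrable_bounded[where C = "K\<^sup>2"])
       (use that D_meas'[OF that, of 1] K(1)[of 1 _ "- of_real y"] in \<open>auto intro!: power_mono\<close>)
  then show "integrable M (\<lambda>z. (norm (D 1 z (- of_real y)))\<^sup>2)" using y by simp
  show "integrable M (\<lambda>z. Re (cnj (D 1 z (- of_real y)) * D 2 z (- of_real y)))"
  proof (rule integrable_bounded[where C = "K\<^sup>2"])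
    show "(\<lambda>z. Re (cnj (D 1 z (- of_real y)) * D 2 z (- of_real y))) \<in> borel_measurable M"
      using D_meas'[OF y, measurable] by measurable
  qed (use bd[OF _ y] in \<open>auto simp: abs_mult simp del: times_complex.sel\<close>)
  show "(energy has_real_derivative (\<integral>z. - 2 * Re (cnj (D 1 z (- of_real y)) * D 2 z (- of_real y)) \<partial>M)) (at y)"
    unfolding energy_def[abs_def]
  proof (rule has_field_derivative_integral(1)[OF finite_measure_axioms, of "{- L / 2<..}"])
    fix x z assume x: "x \<in> {- L / 2<..}" and z: "z \<in> space M"
    then have "Re (0 + (-1) * of_real x) < L" using L_pos by auto
    from D_line_deriv[OF z this, of 0 1]
    have "((\<lambda>x. D 1 z (- of_real x)) has_vector_derivative (- D 2 z (- of_real x))) (at x)"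
      by (simp add: numeral_2_eq_2)
    from has_real_derivative_norm_square[OF this]
    show "((\<lambda>y. (norm (D 1 z (- of_real y)))\<^sup>2) has_real_derivative - 2 * Re (cnj (D 1 z (- of_real x)) * D 2 z (- of_real x))) (at x)"
      by (simp del: times_complex.sel)
    show "norm (- 2 * Re (cnj (D 1 z (- of_real x)) * D 2 z (- of_real x))) \<le> 2 * K\<^sup>2"
      using bd[OF z, of x] x by simp
  qed (use y int in auto)
qed

lemma energy_bound: "y > 0 \<Longrightarrow> energy y \<le> (B / y)\<^sup>2 * measure M (space M)"
proof -
  assume y: "y > 0"
  have bd: "(norm (D 1 z (- of_real y)))\<^sup>2 \<le> (B / y)\<^sup>2" if "z \<in> space M" for z
    using D_bound[OF that y, of "- of_real y" 1] L_pos by (intro power_mono) auto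
  have "energy y \<le> (\<integral>z. (B / y)\<^sup>2 \<partial>M)"
    unfolding energy_def
    by (intro integral_mono energy_deriv(2) integrable_const bd) (use y L_pos in auto)
  then show ?thesis by (simp add: mult.commute)
qed

lemma energy_nonneg: "energy y \<ge> 0"
  by (simp add: energy_def)

lemma continuous_on_energy: "0 < a \<Longrightarrow> continuous_on {a..b} energy"
  by (rule continuous_at_imp_continuous_on)
     (use energy_deriv(1) L_pos in \<open>force intro: DERIV_isCont\<close>)

text \<open>The integrations by parts are packed into one function \<Psi> whose derivative dominates
  the integrand of the left-hand side; its increment from \<eta> to 1 is then bounded by the
  boundary terms. Starting at \<eta> > 0 keeps all powers of y continuous.\<close>

lemma interpolation_regularised:
  assumes \<alpha>: "0 < \<alpha>" "\<alpha> < 2" and \<epsilon>: "\<epsilon> > 0" and \<eta>: "0 < \<eta>" "\<eta> < 1"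
  defines "\<kappa> \<equiv> 2 * B powr (2 - \<alpha>) / (2 - \<alpha>)"
  shows "(2 - \<alpha>) / 2 * integral {\<eta>..1} (\<lambda>y. energy y * y powr (1 - \<alpha>))
           - \<epsilon> powr (1 - \<alpha> / 2) / \<kappa> * integral {\<eta>..1} (\<lambda>y. energy y * y powr (3 - 2 * \<alpha>))
         \<le> B\<^sup>2 * measure M (space M) + \<kappa> / \<alpha>\<^sup>2 * ((\<integral>z. norm (D 1 z 0) powr \<alpha> \<partial>M)
              + \<epsilon> powr (\<alpha> / 2) * measure M (space M))"
proof -
  define q where "q = \<alpha> / 2"
  have q: "0 < q" "q \<le> 1" "4 * q\<^sup>2 = \<alpha>\<^sup>2" using \<alpha> by (auto simp: q_def power2_eq_square)
  have \<kappa>: "\<kappa> > 0" using B_pos \<alpha> by (simp add: \<kappa>_def)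
  obtain K where K: "\<And>n z w. n \<le> 3 \<Longrightarrow> z \<in> space M \<Longrightarrow> Re w < L / 2 \<Longrightarrow> norm (D n z w) \<le> K" "K > 0"
    by (rule D_bound_half) blast
  define m where "m y = (\<integral>z. reg_pow q \<epsilon> (D 1 z (- of_real y)) \<partial>M)" for y :: real
  define X where "X z y = ((norm (D 1 z (- of_real y)))\<^sup>2 + \<epsilon>) powr (q - 1) * (norm (D 2 z (- of_real y)))\<^sup>2"
    for z and y :: real
  obtain m' m'' where m': "\<And>y. y > - L / 2 \<Longrightarrow> (m has_real_derivative m' y) (at y)"
    and m'': "\<And>y. y > - L / 2 \<Longrightarrow> (m' has_real_derivative m'' y) (at y)"
    and X_int: "\<And>y. y > - L / 2 \<Longrightarrow> integrable M (\<lambda>z. X z y)"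
    and X_le: "\<And>y. y > - L / 2 \<Longrightarrow> \<alpha>\<^sup>2 * (\<integral>z. X z y \<partial>M) \<le> m'' y"
    using hardy_stein[OF q(1,2) \<epsilon>] unfolding m_def[symmetric] X_def[symmetric] q(3) by metis
  have m_nonneg: "m y \<ge> 0" for y
    unfolding m_def reg_pow_def by (intro integral_nonneg_AE) auto
  have m''_nonneg: "m'' y \<ge> 0" if "y > - L / 2" for y
  proof -
    have "0 \<le> \<alpha>\<^sup>2 * (\<integral>z. X z y \<partial>M)"
      unfolding X_def by (intro mult_nonneg_nonneg integral_nonneg_AE) auto
    then show ?thesis using X_le[OF that] by linarith
  qed
  \<comment> \<open>The mean m is convex because its second derivative dominates a nonnegative
    integral, so it lies above its tangents.\<close>
  have tangent: "m' x * (y - x) \<le> m y - m x" if "x > - L / 2" "y > - L / 2" for x y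
    by (rule f''_imp_f'[of "{- L / 2<..}" m m' m'']) (use m' m'' m''_nonneg that in auto)
  have meas_u: "(\<lambda>z. reg_pow q \<epsilon> (D 1 z (- of_real y))) \<in> borel_measurable M" if "y > - L / 2" for y
  proof -
    have "(\<lambda>z. D 1 z (- of_real y)) \<in> borel_measurable M"
      using that L_pos by (intro D_meas) auto
    note [measurable] = this
    show ?thesis unfolding reg_pow_def by measurable
  qed
  have u_bd: "reg_pow q \<epsilon> (D 1 z (- of_real y)) \<le> (K\<^sup>2 + \<epsilon>) powr q" if "y > - L / 2" "z \<in> space M" for y z
    unfolding reg_pow_def using K(1)[of 1 z "- of_real y"] that q \<epsilon>
    by (auto intro!: powr_mono2 power_mono)
  have u_int: "integrable M (\<lambda>z. reg_pow q \<epsilon> (D 1 z (- of_real y)))" if "y > - L / 2" for y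
    by (rule integrable_bounded[OF meas_u[OF that], of "(K\<^sup>2 + \<epsilon>) powr q"])
       (use u_bd[OF that] in \<open>auto simp: reg_pow_def\<close>)
  have m_le: "m y \<le> (K\<^sup>2 + \<epsilon>) powr q * measure M (space M)" if "y > - L / 2" for y
  proof -
    have "m y \<le> (\<integral>z. (K\<^sup>2 + \<epsilon>) powr q \<partial>M)"
      unfolding m_def by (intro integral_mono u_int that integrable_const u_bd)
    then show ?thesis by (simp add: mult.commute)
  qed
  \<comment> \<open>m is bounded on the half-line, so a positive slope at 1 is impossible: Y is the
    point at which the tangent has risen by C + 1, more than m can.\<close>
  have m'1: "m' 1 \<le> 0"
  proof (rule ccontr)
    assume "\<not> m' 1 \<le> 0"
    then have pos: "m' 1 > 0" by simp
    define C where "C = (K\<^sup>2 + \<epsilon>) powr q * measure M (space M)"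
    have C: "C \<ge> 0" by (simp add: C_def)
    define Y where "Y = 1 + (C + 1) / m' 1"
    have "(C + 1) / m' 1 \<ge> 0" using pos C by simp
    then have Y: "Y > - L / 2" using L_pos unfolding Y_def by linarith
    have "m' 1 * (Y - 1) \<le> m Y - m 1" using Y L_pos by (intro tangent) auto
    also have "\<dots> \<le> C" using m_le[OF Y] m_nonneg[of 1] by (simp add: C_def)
    finally show False using pos by (simp add: Y_def)
  qed
  \<comment> \<open>The tangent at \<eta>, read off at 0, moves the boundary term to the torus
    itself, where the Hardy integral controls it.\<close>
  have m_tangent: "m \<eta> - \<eta> * m' \<eta> \<le> m 0"
    using tangent[of \<eta> 0] \<eta> L_pos by (simp add: algebra_simps)
  have m0: "m 0 \<le> (\<integral>z. norm (D 1 z 0) powr \<alpha> \<partial>M) + \<epsilon> powr q * measure M (space M)"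
  proof -
    have meas0: "(\<lambda>z. D 1 z 0) \<in> borel_measurable M" using L_pos by (intro D_meas) auto
    note [measurable] = this
    have int0: "integrable M (\<lambda>z. norm (D 1 z 0) powr \<alpha>)"
    proof (rule integrable_bounded[where C = "K powr \<alpha>"])
      show "(\<lambda>z. norm (D 1 z 0) powr \<alpha>) \<in> borel_measurable M" by measurable
    qed (use K(1)[of 1 _ 0] L_pos \<alpha> in \<open>auto intro!: powr_mono2\<close>)
    have "m 0 \<le> (\<integral>z. norm (D 1 z 0) powr \<alpha> + \<epsilon> powr q \<partial>M)"
      unfolding m_def
    proof (rule integral_mono)
      fix z
      have "reg_pow q \<epsilon> (D 1 z 0) \<le> ((norm (D 1 z 0))\<^sup>2) powr q + \<epsilon> powr q"
        unfolding reg_pow_def using q \<epsilon> by (intro powr_add_le_add_powr) auto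
      also have "((norm (D 1 z 0))\<^sup>2) powr q = norm (D 1 z 0) powr \<alpha>"
        unfolding q_def by (rule powr_half_of_square) simp
      finally show "reg_pow q \<epsilon> (D 1 z (- of_real 0)) \<le> norm (D 1 z 0) powr \<alpha> + \<epsilon> powr q"
        by simp
    qed (use u_int[of 0] int0 L_pos in auto)
    also have "\<dots> = (\<integral>z. norm (D 1 z 0) powr \<alpha> \<partial>M) + \<epsilon> powr q * measure M (space M)"
      using int0 by (simp add: mult.commute)
    finally show ?thesis .
  qed
  define e' where "e' y = (\<integral>z. - 2 * Re (cnj (D 1 z (- of_real y)) * D 2 z (- of_real y)) \<partial>M)" for y :: real
  \<comment> \<open>The derivative of y m' - m is y m'', which is the Hardy--Stein bound with its
    weight y. The first summand supplies the integral to be bounded together with the cross term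
    that AM-GM handles.\<close>
  define \<Psi> where "\<Psi> y = energy y * y powr (2 - \<alpha>) + \<kappa> / \<alpha>\<^sup>2 * (y * m' y - m y)" for y
  define \<Psi>' where "\<Psi>' y = e' y * y powr (2 - \<alpha>) + energy y * ((2 - \<alpha>) * y powr (1 - \<alpha>)) + \<kappa> / \<alpha>\<^sup>2 * (y * m'' y)" for y
  define g where "g y = (2 - \<alpha>) / 2 * (energy y * y powr (1 - \<alpha>)) - \<epsilon> powr (1 - \<alpha> / 2) / \<kappa> * (energy y * y powr (3 - 2 * \<alpha>))" for y
  have \<Psi>_deriv: "(\<Psi> has_real_derivative \<Psi>' y) (at y)" if y: "y > 0" for y
  proof -
    have y': "y > - L / 2" using y L_pos by simp
    have de: "(energy has_real_derivative e' y) (at y)"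
      unfolding e'_def by (rule energy_deriv(1)[OF y'])
    have dp: "((\<lambda>y. y powr (2 - \<alpha>)) has_real_derivative (2 - \<alpha>) * y powr (1 - \<alpha>)) (at y)"
      using has_real_derivative_powr[OF y, of "2 - \<alpha>"] by simp
    have "((\<lambda>y. energy y * y powr (2 - \<alpha>) + \<kappa> / \<alpha>\<^sup>2 * (y * m' y - m y)) has_real_derivative
       (e' y * y powr (2 - \<alpha>) + ((2 - \<alpha>) * y powr (1 - \<alpha>)) * energy y)
        + \<kappa> / \<alpha>\<^sup>2 * ((1 * m' y + m'' y * y) - m' y)) (at y)"
      by (intro DERIV_add DERIV_mult DERIV_cmult DERIV_diff de dp m' m'' y' DERIV_ident)
    then show ?thesis
      unfolding \<Psi>_def[abs_def] \<Psi>'_def by (simp add: mult_ac)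
  qed
  have g_le: "g y \<le> \<Psi>' y" if y: "y > 0" for y
  proof -
    have y': "y > - L / 2" using y L_pos by simp
    let ?h = "\<lambda>z. D 1 z (- of_real y)" and ?a = "\<lambda>z. D 2 z (- of_real y)"
    define c where "c = B powr (2 - \<alpha>) / \<kappa> * y powr (1 - \<alpha>) + \<epsilon> powr (1 - \<alpha> / 2) / \<kappa> * y powr (3 - 2 * \<alpha>)"
    have "- e' y * y powr (2 - \<alpha>) = (\<integral>z. 2 * Re (cnj (?h z) * ?a z) * y powr (2 - \<alpha>) \<partial>M)"
      using energy_deriv(3)[OF y'] by (simp add: e'_def del: times_complex.sel)
    also have "\<dots> \<le> (\<integral>z. \<kappa> * y * X z y + c * (norm (?h z))\<^sup>2 \<partial>M)"
    proof (rule integral_mono)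
      show "integrable M (\<lambda>z. 2 * Re (cnj (?h z) * ?a z) * y powr (2 - \<alpha>))"
        using energy_deriv(3)[OF y'] by (simp del: times_complex.sel)
      show "integrable M (\<lambda>z. \<kappa> * y * X z y + c * (norm (?h z))\<^sup>2)"
        using X_int[OF y'] energy_deriv(2)[OF y'] by simp
      fix z assume z: "z \<in> space M"
      have "norm (?h z) \<le> B / y"
        using D_bound[OF z y, of "- of_real y" 1] L_pos by simp
      from weighted_am_gm[OF \<alpha> \<epsilon> y B_pos \<kappa> this, of "?a z"]
      have "2 * norm (?h z) * norm (?a z) * y powr (2 - \<alpha>) \<le> \<kappa> * y * X z y + c * (norm (?h z))\<^sup>2"
        by (simp add: X_def c_def q_def)
      moreover have "2 * Re (cnj (?h z) * ?a z) * y powr (2 - \<alpha>) \<le> 2 * norm (?h z) * norm (?a z) * y powr (2 - \<alpha>)"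
        using complex_Re_le_cmod[of "cnj (?h z) * ?a z"]
        by (intro mult_right_mono) (auto simp: norm_mult simp del: times_complex.sel)
      ultimately show "2 * Re (cnj (?h z) * ?a z) * y powr (2 - \<alpha>) \<le> \<kappa> * y * X z y + c * (norm (?h z))\<^sup>2"
        by linarith
    qed
    also have "\<dots> = \<kappa> * y * (\<integral>z. X z y \<partial>M) + c * energy y"
      using X_int[OF y'] energy_deriv(2)[OF y'] by (simp add: energy_def)
    also have "\<kappa> * y * (\<integral>z. X z y \<partial>M) \<le> \<kappa> / \<alpha>\<^sup>2 * (y * m'' y)"
    proof -
      have "\<kappa> * y * (\<integral>z. X z y \<partial>M) = \<kappa> / \<alpha>\<^sup>2 * (y * (\<alpha>\<^sup>2 * (\<integral>z. X z y \<partial>M)))"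
        using \<alpha> by simp
      also have "\<dots> \<le> \<kappa> / \<alpha>\<^sup>2 * (y * m'' y)"
        using \<kappa> y by (intro mult_left_mono X_le y') auto
      finally show ?thesis .
    qed
    finally have main: "- e' y * y powr (2 - \<alpha>) \<le> \<kappa> / \<alpha>\<^sup>2 * (y * m'' y) + c * energy y" by simp
    \<comment> \<open>This is where \<kappa> is fixed: the AM-GM term equals half of the
      (2-\<alpha>) term in \<Psi>' and leaves the other half.\<close>
    have B\<kappa>: "B powr (2 - \<alpha>) / \<kappa> = (2 - \<alpha>) / 2"
      using B_pos \<alpha> by (simp add: \<kappa>_def)
    have "c * energy y = (2 - \<alpha>) / 2 * (energy y * y powr (1 - \<alpha>))
        + \<epsilon> powr (1 - \<alpha> / 2) / \<kappa> * (energy y * y powr (3 - 2 * \<alpha>))"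
      unfolding c_def B\<kappa> by (simp add: algebra_simps)
    moreover have "energy y * ((2 - \<alpha>) * y powr (1 - \<alpha>)) = 2 * ((2 - \<alpha>) / 2 * (energy y * y powr (1 - \<alpha>)))"
      by (simp add: field_simps)
    ultimately show ?thesis
      using main unfolding g_def \<Psi>'_def by linarith
  qed
  have cont: "continuous_on {\<eta>..1} (\<lambda>y. energy y * y powr p)" for p
    using \<eta> by (intro continuous_on_mult continuous_on_energy continuous_on_powr continuous_intros) auto
  have int: "((\<lambda>y. energy y * y powr p) has_integral integral {\<eta>..1} (\<lambda>y. energy y * y powr p)) {\<eta>..1}" for p
    by (intro integrable_integral integrable_continuous_real cont)
  have g_int: "(g has_integral ((2 - \<alpha>) / 2 * integral {\<eta>..1} (\<lambda>y. energy y * y powr (1 - \<alpha>))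
           - \<epsilon> powr (1 - \<alpha> / 2) / \<kappa> * integral {\<eta>..1} (\<lambda>y. energy y * y powr (3 - 2 * \<alpha>)))) {\<eta>..1}"
    unfolding g_def by (intro has_integral_diff has_integral_mult_right int)
  have "(\<Psi>' has_integral (\<Psi> 1 - \<Psi> \<eta>)) {\<eta>..1}"
  proof (rule fundamental_theorem_of_calculus)
    show "(\<Psi> has_vector_derivative \<Psi>' y) (at y within {\<eta>..1})" if "y \<in> {\<eta>..1}" for y
      using has_field_derivative_at_within[OF \<Psi>_deriv[of y]] that \<eta>
      by (simp add: has_real_derivative_iff_has_vector_derivative)
  qed (use \<eta> in auto)
  from has_integral_le[OF g_int this] g_le \<eta>
  have "(2 - \<alpha>) / 2 * integral {\<eta>..1} (\<lambda>y. energy y * y powr (1 - \<alpha>))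
           - \<epsilon> powr (1 - \<alpha> / 2) / \<kappa> * integral {\<eta>..1} (\<lambda>y. energy y * y powr (3 - 2 * \<alpha>)) \<le> \<Psi> 1 - \<Psi> \<eta>"
    by auto
  also have "\<Psi> 1 - \<Psi> \<eta> \<le> energy 1 + \<kappa> / \<alpha>\<^sup>2 * m 0"
  proof -
    have "\<Psi> 1 - \<Psi> \<eta> = energy 1 - energy \<eta> * \<eta> powr (2 - \<alpha>) + \<kappa> / \<alpha>\<^sup>2 * (m' 1 - m 1 + (m \<eta> - \<eta> * m' \<eta>))"
    proof -
      define k where "k = \<kappa> / \<alpha>\<^sup>2"
      show ?thesis unfolding \<Psi>_def k_def[symmetric] by (simp add: algebra_simps)
    qed
    also have "\<dots> \<le> energy 1 - 0 + \<kappa> / \<alpha>\<^sup>2 * m 0"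
      using m'1 m_nonneg[of 1] m_tangent \<kappa> energy_nonneg[of \<eta>]
      by (intro add_mono diff_mono mult_left_mono) auto
    finally show ?thesis by simp
  qed
  also have "energy 1 + \<kappa> / \<alpha>\<^sup>2 * m 0 \<le> B\<^sup>2 * measure M (space M) + \<kappa> / \<alpha>\<^sup>2 * ((\<integral>z. norm (D 1 z 0) powr \<alpha> \<partial>M)
              + \<epsilon> powr q * measure M (space M))"
    using energy_bound[of 1] m0 \<kappa> by (intro add_mono mult_left_mono) auto
  finally show ?thesis by (simp add: q_def)
qed

text \<open>With \<eta> fixed the correction terms are constants times \<epsilon>^(1-\<alpha>/2) and
  \<epsilon>^(\<alpha>/2), both vanishing as \<epsilon> tends to 0. The right-hand side contains
  neither \<eta> nor L.\<close>

lemma interpolation: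
  assumes \<alpha>: "0 < \<alpha>" "\<alpha> < 2" and \<eta>: "0 < \<eta>" "\<eta> < 1"
  defines "\<kappa> \<equiv> 2 * B powr (2 - \<alpha>) / (2 - \<alpha>)"
  shows "(2 - \<alpha>) / 2 * integral {\<eta>..1} (\<lambda>y. energy y * y powr (1 - \<alpha>))
         \<le> B\<^sup>2 * measure M (space M) + \<kappa> / \<alpha>\<^sup>2 * (\<integral>z. norm (D 1 z 0) powr \<alpha> \<partial>M)"
proof -
  let ?I = "(2 - \<alpha>) / 2 * integral {\<eta>..1} (\<lambda>y. energy y * y powr (1 - \<alpha>))"
  let ?J = "integral {\<eta>..1} (\<lambda>y. energy y * y powr (3 - 2 * \<alpha>))"
  let ?P = "\<integral>z. norm (D 1 z 0) powr \<alpha> \<partial>M"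
  have lim: "((\<lambda>\<epsilon>. \<epsilon> powr p) \<longlongrightarrow> 0) (at_right (0::real))" if "p > 0" for p
    by (rule tendsto_zero_powrI[where b = p])
       (use that in \<open>auto simp: eventually_at_filter intro: tendsto_ident_at\<close>)
  have "?I - 0 / \<kappa> * ?J \<le> B\<^sup>2 * measure M (space M) + \<kappa> / \<alpha>\<^sup>2 * (?P + 0 * measure M (space M))"
  proof (rule tendsto_le)
    show "((\<lambda>\<epsilon>. ?I - \<epsilon> powr (1 - \<alpha> / 2) / \<kappa> * ?J) \<longlongrightarrow> ?I - 0 / \<kappa> * ?J) (at_right 0)"
      by (intro tendsto_intros lim) (use \<alpha> B_pos in \<open>auto simp: \<kappa>_def\<close>)
    show "((\<lambda>\<epsilon>. B\<^sup>2 * measure M (space M) + \<kappa> / \<alpha>\<^sup>2 * (?P + \<epsilon> powr (\<alpha> / 2) * measure M (space M)))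
        \<longlongrightarrow> B\<^sup>2 * measure M (space M) + \<kappa> / \<alpha>\<^sup>2 * (?P + 0 * measure M (space M))) (at_right 0)"
      by (intro tendsto_intros lim) (use \<alpha> in auto)
    show "\<forall>\<^sub>F \<epsilon> in at_right 0. ?I - \<epsilon> powr (1 - \<alpha> / 2) / \<kappa> * ?J
        \<le> B\<^sup>2 * measure M (space M) + \<kappa> / \<alpha>\<^sup>2 * (?P + \<epsilon> powr (\<alpha> / 2) * measure M (space M))"
      using eventually_at_right_less[of 0]
      by eventually_elim (use interpolation_regularised[OF \<alpha> _ \<eta>] in \<open>simp add: \<kappa>_def\<close>)
  qed simp
  then show ?thesis by simp
qed

end

section \<open>Coefficient bounds\<close>

lemma vec_monomial_const: "vec_monomial k (\<chi> i. c) = c ^ (\<Sum>i\<in>UNIV. k $ i)"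
  by (simp add: vec_monomial_def power_sum)

lemma vec_monomial_times: "vec_monomial k (\<chi> i. x $ i * y $ i) = vec_monomial k x * vec_monomial k y"
  by (simp add: vec_monomial_def power_mult_distrib prod.distrib)

text \<open>All coordinates are shrunk by \<rho>, and the j-th is multiplied by exp w besides. For z
  on the torus the argument stays in the polydisc when Re w < - ln \<rho>; at w = 0 it is \<rho> z
  for every j.\<close>

definition dilate :: "(complex ^ 'n \<Rightarrow> complex) \<Rightarrow> 'n \<Rightarrow> real \<Rightarrow> complex ^ 'n \<Rightarrow> complex \<Rightarrow> complex" where
  "dilate \<phi> j \<rho> z w = \<phi> (vec_upd (of_real \<rho> *s z) j (of_real \<rho> * z $ j * exp w))"

lemma scaled_utorus_polydisc: "z \<in> utorus \<Longrightarrow> 0 < \<rho> \<Longrightarrow> \<rho> < 1 \<Longrightarrow> of_real \<rho> *s z \<in> polydisc"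
  by (simp add: utorus_def polydisc_def norm_mult)

lemma norm_dilate_arg:
  assumes "z \<in> utorus" "0 < \<rho>" "Re w < - ln \<rho>"
  shows "norm (of_real \<rho> * z $ j * exp w) < 1"
proof -
  have "exp (Re w) < exp (- ln \<rho>)" using assms by simp
  also have "\<dots> = 1 / \<rho>" using assms by (simp add: exp_minus inverse_eq_divide)
  finally show ?thesis using assms by (simp add: utorus_def norm_mult field_simps)
qed

lemma dilate_arg_polydisc:
  assumes "z \<in> utorus" "0 < \<rho>" "\<rho> < 1" "Re w < - ln \<rho>"
  shows "vec_upd (of_real \<rho> *s z) j (of_real \<rho> * z $ j * exp w) \<in> polydisc"
  using assms by (intro vec_upd_polydisc scaled_utorus_polydisc norm_dilate_arg)

lemma continuous_on_vec_upd:
  assumes "continuous_on A f" "continuous_on A g"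
  shows "continuous_on A (\<lambda>x. vec_upd (f x) j (g x))"
  unfolding vec_upd_def
proof (rule continuous_on_vec_lambda)
  fix i show "continuous_on A (\<lambda>x. if i = j then g x else f x $ i)"
    by (cases "i = j") (use assms in \<open>auto intro!: continuous_intros\<close>)
qed

lemma rotating_family_dilate:
  fixes \<phi> :: "complex ^ 'n \<Rightarrow> complex"
  assumes \<phi>: "holomorphic_vec_on \<phi> polydisc" and bd: "\<And>z. z \<in> polydisc \<Longrightarrow> norm (\<phi> z) \<le> B"
    and B: "B > 0" and \<rho>: "0 < \<rho>" "\<rho> < 1"
  shows "rotating_family torus_space (dilate \<phi> j \<rho>) (- ln \<rho>) B (rot j)"
proof (intro rotating_family.intro rotating_family_axioms.intro)
  fix z :: "complex ^ 'n" assume "z \<in> space torus_space"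
  then have z: "z \<in> utorus" by simp
  have "(\<lambda>w. \<phi> (vec_upd (of_real \<rho> *s z) j w)) \<circ> (\<lambda>w. of_real \<rho> * z $ j * exp w) holomorphic_on {w. Re w < - ln \<rho>}"
  proof (rule holomorphic_on_compose_gen)
    show "(\<lambda>w. \<phi> (vec_upd (of_real \<rho> *s z) j w)) holomorphic_on ball 0 1"
      by (rule holomorphic_vec_upd[OF \<phi> scaled_utorus_polydisc[OF z \<rho>]])
    show "(\<lambda>w. of_real \<rho> * z $ j * exp w) ` {w. Re w < - ln \<rho>} \<subseteq> ball 0 1"
      using norm_dilate_arg[OF z \<rho>(1)] by auto
  qed (intro holomorphic_intros)
  then show "dilate \<phi> j \<rho> z holomorphic_on {w. Re w < - ln \<rho>}"
    by (simp add: dilate_def[abs_def] o_def)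
  show "norm (dilate \<phi> j \<rho> z w) \<le> B" if "Re w < - ln \<rho>" for w
    unfolding dilate_def by (rule bd[OF dilate_arg_polydisc[OF z \<rho> that]])
  show "dilate \<phi> j \<rho> z (w + \<i> * of_real s) = dilate \<phi> j \<rho> (rot j s z) w" for w s
  proof -
    have "vec_upd (of_real \<rho> *s z) j (of_real \<rho> * z $ j * exp (w + \<i> * of_real s))
        = vec_upd (of_real \<rho> *s rot j s z) j (of_real \<rho> * rot j s z $ j * exp w)"
      by (simp add: vec_eq_iff rot_nth exp_add cis_conv_exp mult_ac)
    then show ?thesis by (simp only: dilate_def)
  qed
next
  fix w :: complex assume w: "Re w < - ln \<rho>"
  show "(\<lambda>z. dilate \<phi> j \<rho> z w) \<in> borel_measurable torus_space"
    unfolding dilate_def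
  proof (intro borel_measurable_torus_continuous continuous_on_compose2[OF continuous_on_holomorphic_vec[OF \<phi>]])
    show "continuous_on utorus (\<lambda>z. vec_upd (of_real \<rho> *s z) j (of_real \<rho> * z $ j * exp w))"
      unfolding vector_scalar_mult_def
      by (intro continuous_on_vec_upd continuous_on_vec_lambda continuous_intros)
    show "(\<lambda>z. vec_upd (of_real \<rho> *s z) j (of_real \<rho> * z $ j * exp w)) ` utorus \<subseteq> polydisc"
      using dilate_arg_polydisc[OF _ \<rho> w] by blast
  qed
qed (use \<rho> B measurable_rot distr_torus_space_rot finite_measure_torus_space in auto)

text \<open>By the chain rule the derivative at 0 is the partial derivative times \<rho> z_j, and
  |z_j| = 1 on the torus.\<close>

lemma deriv_dilate:
  fixes \<phi> :: "complex ^ 'n \<Rightarrow> complex"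
  assumes \<phi>: "holomorphic_vec_on \<phi> polydisc" and z: "z \<in> utorus" and \<rho>: "0 < \<rho>" "\<rho> < 1"
  shows "norm (deriv (dilate \<phi> j \<rho> z) 0) = \<rho> * norm (partial_deriv j \<phi> (of_real \<rho> *s z))"
proof -
  define F where "F w = \<phi> (vec_upd (of_real \<rho> *s z) j w)" for w
  have "F holomorphic_on ball 0 1"
    unfolding F_def by (rule holomorphic_vec_upd[OF \<phi> scaled_utorus_polydisc[OF z \<rho>]])
  moreover have zj: "norm (of_real \<rho> * z $ j) < 1"
    using z \<rho> by (simp add: utorus_def norm_mult)
  ultimately have F: "(F has_field_derivative deriv F (of_real \<rho> * z $ j)) (at (of_real \<rho> * z $ j * exp 0))"
    by (auto intro: holomorphic_derivI)
  have "((\<lambda>w. F (of_real \<rho> * z $ j * exp w)) has_field_derivative deriv F (of_real \<rho> * z $ j) * (of_real \<rho> * z $ j * exp 0)) (at 0)"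
    by (rule DERIV_chain2[where f = F and g = "\<lambda>w. of_real \<rho> * z $ j * exp w", OF F])
       (intro DERIV_cmult DERIV_exp)
  then have "deriv (dilate \<phi> j \<rho> z) 0 = deriv F (of_real \<rho> * z $ j) * (of_real \<rho> * z $ j)"
    by (simp add: dilate_def[abs_def] F_def DERIV_imp_deriv)
  moreover have "partial_deriv j \<phi> (of_real \<rho> *s z) = deriv F (of_real \<rho> * z $ j)"
    by (simp add: partial_deriv_def F_def[abs_def] vec_upd_def)
  ultimately show ?thesis
    using z \<rho> by (simp add: norm_mult utorus_def)
qed

text \<open>The chain-rule factor \<rho> is below 1, so the supremum in the Hardy condition,
  multiplied by the mass that it was normalised by, bounds the integral for all \<rho> at
  once.\<close>

lemma hardy_space_dilate_bound:
  fixes \<phi> :: "complex ^ 'n \<Rightarrow> complex"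
  assumes \<phi>: "holomorphic_vec_on \<phi> polydisc" and bd: "\<And>z. z \<in> polydisc \<Longrightarrow> norm (\<phi> z) \<le> B"
    and B: "B > 0" and \<alpha>: "0 < \<alpha>" and H: "partial_deriv j \<phi> \<in> hardy_space \<alpha>"
  shows "\<exists>P. \<forall>\<rho>. 0 < \<rho> \<longrightarrow> \<rho> < 1 \<longrightarrow> (\<integral>z. norm (deriv (dilate \<phi> j \<rho> z) 0) powr \<alpha> \<partial>torus_space) \<le> P"
proof -
  let ?C = "(2 * pi) ^ CARD('n)"
  define N where "N \<rho> = (\<integral>\<^sup>+ z. ennreal (norm (partial_deriv j \<phi> (of_real \<rho> *s z)) powr \<alpha>) \<partial>torus_measure)" for \<rho>
  define S where "S = (SUP r\<in>{0<..<1}. ennreal (1 / ?C) * N r)"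
  have S: "S < \<infinity>" using H by (simp add: hardy_space_def S_def N_def)
  show ?thesis
  proof (intro exI[of _ "?C * enn2real S"] allI impI)
    fix \<rho> :: real assume \<rho>: "0 < \<rho>" "\<rho> < 1"
    interpret rotating_family torus_space "dilate \<phi> j \<rho>" "- ln \<rho>" B "rot j"
      by (rule rotating_family_dilate[OF \<phi> bd B \<rho>])
    have meas0: "(\<lambda>z. deriv (dilate \<phi> j \<rho> z) 0) \<in> borel_measurable torus_space"
      using D_meas[of 0 1] L_pos by (simp add: D_def)
    note [measurable] = this
    obtain K where K: "\<And>n z w. n \<le> 3 \<Longrightarrow> z \<in> space torus_space \<Longrightarrow> Re w < - ln \<rho> / 2 \<Longrightarrow> norm (D n z w) \<le> K"
      using D_bound_half by metis
    have int: "integrable torus_space (\<lambda>z. norm (deriv (dilate \<phi> j \<rho> z) 0) powr \<alpha>)"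
    proof (rule integrable_bounded[where C = "K powr \<alpha>"])
      show "(\<lambda>z. norm (deriv (dilate \<phi> j \<rho> z) 0) powr \<alpha>) \<in> borel_measurable torus_space"
        by measurable
    qed (use K[of 1 _ 0] L_pos \<alpha> in \<open>auto intro!: powr_mono2 simp: D_def\<close>)
    have "ennreal (\<integral>z. norm (deriv (dilate \<phi> j \<rho> z) 0) powr \<alpha> \<partial>torus_space)
        = (\<integral>\<^sup>+z. ennreal (norm (deriv (dilate \<phi> j \<rho> z) 0) powr \<alpha>) \<partial>torus_space)"
      by (rule nn_integral_eq_integral[symmetric, OF int]) auto
    also have "\<dots> = (\<integral>\<^sup>+z. ennreal (norm (deriv (dilate \<phi> j \<rho> z) 0) powr \<alpha>) * indicator utorus z \<partial>torus_measure)"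
      unfolding torus_space_def by (rule nn_integral_restrict_space) simp
    also have "\<dots> \<le> N \<rho>"
      unfolding N_def
    proof (intro nn_integral_mono)
      fix z :: "complex ^ 'n"
      show "ennreal (norm (deriv (dilate \<phi> j \<rho> z) 0) powr \<alpha>) * indicator utorus z
          \<le> ennreal (norm (partial_deriv j \<phi> (of_real \<rho> *s z)) powr \<alpha>)"
      proof (cases "z \<in> utorus")
        case True
        then have "norm (deriv (dilate \<phi> j \<rho> z) 0) \<le> norm (partial_deriv j \<phi> (of_real \<rho> *s z))"
          unfolding deriv_dilate[OF \<phi> True \<rho>] using \<rho> by (intro mult_left_le_one_le) auto
        then show ?thesis
          using True \<alpha> by (auto intro!: ennreal_leI powr_mono2)
      qed simp
    qed
    also have "N \<rho> = ennreal ?C * (ennreal (1 / ?C) * N \<rho>)"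
      by (simp add: mult.assoc[symmetric] ennreal_mult'[symmetric])
    also have "\<dots> \<le> ennreal ?C * S"
      unfolding S_def using \<rho> by (intro mult_left_mono SUP_upper) auto
    also have "\<dots> = ennreal (?C * enn2real S)"
      using S by (simp add: ennreal_mult'')
    finally show "(\<integral>z. norm (deriv (dilate \<phi> j \<rho> z) 0) powr \<alpha> \<partial>torus_space) \<le> ?C * enn2real S"
      by (subst (asm) ennreal_le_iff) auto
  qed
qed

text \<open>The argument of \<phi> is the coordinatewise product of z with a fixed point r of the
  polydisc. Monomials are multiplicative, so the power series becomes a Fourier series with
  coefficients a_k r^k, absolutely summable because r lies in the polydisc.\<close>

lemma dilate_fourier:
  fixes \<phi> :: "complex ^ 'n \<Rightarrow> complex"
  assumes \<phi>: "holomorphic_vec_on \<phi> polydisc" and bd: "\<And>z. z \<in> polydisc \<Longrightarrow> norm (\<phi> z) \<le> B"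
    and B: "B > 0" and \<rho>: "0 < \<rho>" "\<rho> < 1"
    and a: "\<And>z. z \<in> polydisc \<Longrightarrow> ((\<lambda>k. a k * vec_monomial k z) has_sum \<phi> z) UNIV"
    and w: "Re w < - ln \<rho>"
  shows "(\<integral>z. dilate \<phi> j \<rho> z w * cnj (vec_monomial k z) \<partial>torus_space)
    = of_real ((2 * pi) ^ CARD('n)) * (a k * of_real \<rho> ^ (\<Sum>i\<in>UNIV. k $ i) * exp w ^ (k $ j))"
proof -
  interpret rotating_family torus_space "dilate \<phi> j \<rho>" "- ln \<rho>" B "rot j"
    by (rule rotating_family_dilate[OF \<phi> bd B \<rho>])
  define r :: "complex ^ 'n" where "r = vec_upd (of_real \<rho> *s 1) j (of_real \<rho> * 1 $ j * exp w)"
  have r: "r \<in> polydisc"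
    unfolding r_def by (rule dilate_arg_polydisc[OF _ \<rho> w]) (simp add: utorus_def)
  have r_mon: "vec_monomial k r = of_real \<rho> ^ (\<Sum>i\<in>UNIV. k $ i) * exp w ^ (k $ j)" for k
  proof -
    have "r = vec_upd (\<chi> i. of_real \<rho>) j (exp w * (\<chi> i. of_real \<rho>) $ j)"
      by (simp add: r_def vec_eq_iff)
    then show ?thesis
      by (simp only: vec_monomial_upd_mult vec_monomial_const mult.commute)
  qed
  have arg: "vec_upd (of_real \<rho> *s z) j (of_real \<rho> * z $ j * exp w) = (\<chi> i. r $ i * z $ i)" for z
    by (simp add: r_def vec_eq_iff)
  have "(\<integral>z. dilate \<phi> j \<rho> z w * cnj (vec_monomial k z) \<partial>torus_space)
      = of_real ((2 * pi) ^ CARD('n)) * (a k * vec_monomial k r)"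
  proof (rule torus_fourier_coeff)
    show "(\<lambda>z. dilate \<phi> j \<rho> z w) \<in> borel_measurable torus_space" by (rule meas[OF w])
    show "(\<lambda>k. norm (a k * vec_monomial k r)) summable_on UNIV"
      using has_sum_imp_summable[OF a[OF r]] by (simp only: summable_on_iff_abs_summable_on_complex)
    show "((\<lambda>k. a k * vec_monomial k r * vec_monomial k z) has_sum dilate \<phi> j \<rho> z w) UNIV" if z: "z \<in> utorus" for z
      using a[OF dilate_arg_polydisc[OF z \<rho> w, of j]]
      unfolding dilate_def arg vec_monomial_times by (simp add: mult.assoc)
  qed
  then show ?thesis by (simp add: r_mon mult.assoc)
qed

text \<open>Bessel's inequality for the \<open>w\<close>-derivative at w = - y. Differentiating
  exp(k_j w) in the Fourier coefficients of the dilate brings down the factor k_j, and uniqueness of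
  derivatives identifies the result with the coefficients of \<open>D 1\<close>.\<close>

lemma energy_dilate_ge:
  fixes \<phi> :: "complex ^ 'n \<Rightarrow> complex"
  assumes \<phi>: "holomorphic_vec_on \<phi> polydisc" and bd: "\<And>z. z \<in> polydisc \<Longrightarrow> norm (\<phi> z) \<le> B"
    and B: "B > 0" and \<rho>: "0 < \<rho>" "\<rho> < 1"
    and a: "\<And>z. z \<in> polydisc \<Longrightarrow> ((\<lambda>k. a k * vec_monomial k z) has_sum \<phi> z) UNIV"
    and y: "y \<ge> 0" and F: "finite F"
  shows "(2 * pi) ^ CARD('n) * (\<Sum>k\<in>F. (real (k $ j))\<^sup>2 * (norm (a k))\<^sup>2 * (\<rho> ^ (\<Sum>i\<in>UNIV. k $ i))\<^sup>2 * exp (- 2 * real (k $ j) * y))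
     \<le> rotating_family.energy torus_space (dilate \<phi> j \<rho>) y"
proof -
  interpret rotating_family torus_space "dilate \<phi> j \<rho>" "- ln \<rho>" B "rot j"
    by (rule rotating_family_dilate[OF \<phi> bd B \<rho>])
  let ?C = "(2 * pi) ^ CARD('n)"
  obtain K where K: "\<And>n z w. n \<le> 3 \<Longrightarrow> z \<in> space torus_space \<Longrightarrow> Re w < - ln \<rho> / 2 \<Longrightarrow> norm (D n z w) \<le> K"
    using D_bound_half by metis
  define w :: complex where "w = - of_real y"
  have w: "Re w < - ln \<rho> / 2" "Re w < - ln \<rho>" using y L_pos by (simp_all add: w_def)
  define p where "p k = a k * of_real \<rho> ^ (\<Sum>i\<in>UNIV. k $ i)" for k
  define c where "c k = p k * (of_nat (k $ j) * exp (of_nat (k $ j) * w))" for k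
  have cnj_meas: "(\<lambda>z. cnj (vec_monomial k z)) \<in> borel_measurable torus_space" for k
    using borel_measurable_vec_monomial by measurable
  have coeff: "(\<integral>z. D 1 z w * cnj (vec_monomial k z) \<partial>torus_space) = of_real ?C * c k" for k
  proof (rule DERIV_unique)
    show "((\<lambda>w. \<integral>z. dilate \<phi> j \<rho> z w * cnj (vec_monomial k z) \<partial>torus_space) has_field_derivative
        (\<integral>z. D 1 z w * cnj (vec_monomial k z) \<partial>torus_space)) (at w)"
      by (rule fourier_deriv[OF w(1) cnj_meas, of _ 1]) (auto simp: norm_vec_monomial_utorus)
    have "((\<lambda>w. of_real ?C * (p k * exp (of_nat (k $ j) * w))) has_field_derivative of_real ?C * c k) (at w)"
      unfolding c_def by (auto intro!: derivative_eq_intros)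
    then show "((\<lambda>w. \<integral>z. dilate \<phi> j \<rho> z w * cnj (vec_monomial k z) \<partial>torus_space) has_field_derivative of_real ?C * c k) (at w)"
    proof (rule has_field_derivative_transform_within_open[OF _ open_half])
      show "of_real ?C * (p k * exp (of_nat (k $ j) * v)) = (\<integral>z. dilate \<phi> j \<rho> z v * cnj (vec_monomial k z) \<partial>torus_space)"
        if "v \<in> {w. Re w < - ln \<rho>}" for v
        using that dilate_fourier[OF \<phi> bd B \<rho> a, of v j k] by (simp add: p_def exp_of_nat_mult exp_of_nat2_mult mult_ac)
    qed (use w in simp)
  qed
  have "?C * (\<Sum>k\<in>F. (norm (c k))\<^sup>2) \<le> (\<integral>z. (norm (D 1 z w))\<^sup>2 \<partial>torus_space)"
    by (rule torus_bessel[OF D_meas[OF w(2)] _ F coeff, of K]) (use K[of 1] w in auto)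
  also have "\<dots> = energy y" by (simp add: energy_def w_def)
  also have "(\<Sum>k\<in>F. (norm (c k))\<^sup>2) = (\<Sum>k\<in>F. (real (k $ j))\<^sup>2 * (norm (a k))\<^sup>2 * (\<rho> ^ (\<Sum>i\<in>UNIV. k $ i))\<^sup>2 * exp (- 2 * real (k $ j) * y))"
  proof (rule sum.cong[OF refl])
    fix k
    have "(exp (- (real (k $ j) * y)))\<^sup>2 = exp (- 2 * real (k $ j) * y)"
      by (simp add: exp_double[symmetric] mult_ac)
    then show "(norm (c k))\<^sup>2 = (real (k $ j))\<^sup>2 * (norm (a k))\<^sup>2 * (\<rho> ^ (\<Sum>i\<in>UNIV. k $ i))\<^sup>2 * exp (- 2 * real (k $ j) * y)"
      using \<rho> by (simp add: c_def p_def w_def norm_mult norm_power power_mult_distrib)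
  qed
  finally show ?thesis .
qed

lemma square_sum_dilate_le:
  fixes \<phi> :: "complex ^ 'n \<Rightarrow> complex"
  assumes \<phi>: "holomorphic_vec_on \<phi> polydisc" and bd: "\<And>z. z \<in> polydisc \<Longrightarrow> norm (\<phi> z) \<le> B"
    and B: "B > 0" and \<rho>: "0 < \<rho>" "\<rho> < 1"
    and a: "\<And>z. z \<in> polydisc \<Longrightarrow> ((\<lambda>k. a k * vec_monomial k z) has_sum \<phi> z) UNIV"
    and F: "finite F"
  shows "(\<Sum>k\<in>F. (norm (a k))\<^sup>2 * (\<rho> ^ (\<Sum>i\<in>UNIV. k $ i))\<^sup>2) \<le> B\<^sup>2"
proof -
  \<comment> \<open>Any coordinate will do: at w = 0 the dilate does not depend on j.\<close>
  fix j :: 'n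
  interpret rotating_family torus_space "dilate \<phi> j \<rho>" "- ln \<rho>" B "rot j"
    by (rule rotating_family_dilate[OF \<phi> bd B \<rho>])
  let ?C = "(2 * pi) ^ CARD('n)"
  have w: "Re 0 < - ln \<rho>" using L_pos by simp
  have "?C * (\<Sum>k\<in>F. (norm (a k * of_real \<rho> ^ (\<Sum>i\<in>UNIV. k $ i) * exp 0 ^ (k $ j)))\<^sup>2)
      \<le> (\<integral>z. (norm (dilate \<phi> j \<rho> z 0))\<^sup>2 \<partial>torus_space)"
    by (rule torus_bessel[OF meas[OF w] _ F dilate_fourier[OF \<phi> bd B \<rho> a w], of B]) (use bounded[OF _ w] in auto)
  also have "\<dots> \<le> (\<integral>z. B\<^sup>2 \<partial>(torus_space :: (complex ^ 'n) measure))"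
  proof (rule integral_mono)
    have m: "(\<lambda>z. dilate \<phi> j \<rho> z 0) \<in> borel_measurable torus_space" by (rule meas[OF w])
    show "integrable torus_space (\<lambda>z. (norm (dilate \<phi> j \<rho> z 0))\<^sup>2)"
      by (rule integrable_bounded[where C = "B\<^sup>2"])
         (use m bounded[OF _ w] in \<open>auto intro!: power_mono\<close>)
    show "(norm (dilate \<phi> j \<rho> z 0))\<^sup>2 \<le> B\<^sup>2" if "z \<in> space torus_space" for z
      by (intro power_mono bounded that w) auto
  qed (rule integrable_const)
  also have "\<dots> = ?C * B\<^sup>2" by (simp add: measure_torus_space)
  finally show ?thesis
    using \<rho> by (simp add: norm_mult norm_power power_mult_distrib)
qed

section \<open>From energy integrals to weighted coefficient sums\<close>

lemma integral_exp_powr_ge: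
  assumes k: "k \<ge> (1 :: real)" and \<alpha>: "0 < \<alpha>" "\<alpha> < 2" and \<eta>: "0 < \<eta>" "\<eta> \<le> 1 / (2 * k)"
  shows "exp (- 2) / 4 * k powr (\<alpha> - 2) \<le> integral {\<eta>..1} (\<lambda>y. exp (- 2 * k * y) * y powr (1 - \<alpha>))"
proof -
  let ?g = "\<lambda>y. exp (- 2 * k * y) * y powr (1 - \<alpha>)"
  have cont: "continuous_on {\<eta>..1} ?g"
    using \<eta> by (intro continuous_intros) auto
  \<comment> \<open>Only the window from 1/(2k) to 1/k is kept. Its length 1/(2k), the bound exp(-2)
    for the exponential and k^(\<alpha>-1) / 2 for the power multiply to the stated
    constant.\<close>
  have sub: "{1 / (2 * k)..1 / k} \<subseteq> {\<eta>..1}" using k \<eta> by (auto simp: field_simps)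
  have ge: "exp (- 2) * (k powr (\<alpha> - 1) / 2) \<le> ?g y" if y: "y \<in> {1 / (2 * k)..1 / k}" for y
  proof (rule mult_mono)
    have "k * y \<le> 1" using y k by (simp add: field_simps)
    then show "exp (- 2) \<le> exp (- 2 * k * y)" by simp
    have y0: "y > 0" using y k by (auto intro: less_le_trans[of _ "1 / (2 * k)"])
    show "k powr (\<alpha> - 1) / 2 \<le> y powr (1 - \<alpha>)"
    \<comment> \<open>The sign of 1 - \<alpha> decides which end of the window minimises the power:
      the left one for \<alpha> \<le> 1, which costs the factor 1/2, the right one
      otherwise.\<close>
    proof (cases "\<alpha> \<le> 1")
      case True
      have "k powr (\<alpha> - 1) / 2 = (1 / k) powr (1 - \<alpha>) * (1 / 2) powr 1"
        using k by (simp add: powr_divide powr_minus_divide[of k "1 - \<alpha>", simplified])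
      also have "\<dots> \<le> (1 / k) powr (1 - \<alpha>) * (1 / 2) powr (1 - \<alpha>)"
        using \<alpha> by (intro mult_left_mono powr_mono') auto
      also have "\<dots> = (1 / (2 * k)) powr (1 - \<alpha>)"
        using k by (simp add: powr_mult[symmetric] mult.commute)
      also have "\<dots> \<le> y powr (1 - \<alpha>)"
        using y k True by (intro powr_mono2) auto
      finally show ?thesis .
    next
      case False
      have "k powr (\<alpha> - 1) / 2 \<le> k powr (\<alpha> - 1)" by simp
      also have "\<dots> = (1 / k) powr (1 - \<alpha>)"
        using k by (simp add: powr_divide powr_minus_divide[of k "1 - \<alpha>", simplified])
      also have "\<dots> \<le> y powr (1 - \<alpha>)"
        using y y0 False by (intro powr_mono2') auto
      finally show ?thesis .
    qed
  qed auto
  have "exp (- 2) / 4 * k powr (\<alpha> - 2) = (1 / k - 1 / (2 * k)) * (exp (- 2) * (k powr (\<alpha> - 1) / 2))"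
  proof -
    have "k powr (\<alpha> - 2) = k powr (\<alpha> - 1) / k"
      using k powr_diff[of k "\<alpha> - 1" 1] by simp
    then show ?thesis using k by (simp add: field_simps)
  qed
  also have "\<dots> = integral {1 / (2 * k)..1 / k} (\<lambda>y. exp (- 2) * (k powr (\<alpha> - 1) / 2))"
    using k by (simp add: field_simps)
  also have "\<dots> \<le> integral {1 / (2 * k)..1 / k} ?g"
    by (rule integral_le)
       (use ge continuous_on_subset[OF cont sub] in \<open>auto intro: integrable_continuous_real\<close>)
  also have "\<dots> \<le> integral {\<eta>..1} ?g"
    by (rule integral_subset_le[OF sub])
       (use cont continuous_on_subset[OF cont sub] in \<open>auto intro: integrable_continuous_real\<close>)
  finally show ?thesis .
qed

text \<open>For \<alpha> = 2 the energy at y = 0 already is the Hardy integral. For \<alpha> < 2 the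
  energy bound is integrated against y^(1-\<alpha>), which turns k_j^2 into a multiple of
  k_j^\<alpha>. The point is that Q depends on neither F nor \<rho>.\<close>

lemma weighted_coeff_bound:
  fixes \<phi> :: "complex ^ 'n \<Rightarrow> complex"
  assumes \<phi>: "holomorphic_vec_on \<phi> polydisc" and bd: "\<And>z. z \<in> polydisc \<Longrightarrow> norm (\<phi> z) \<le> B"
    and B: "B > 0" and \<alpha>: "0 < \<alpha>" "\<alpha> \<le> 2" and H: "partial_deriv j \<phi> \<in> hardy_space \<alpha>"
    and a: "\<And>z. z \<in> polydisc \<Longrightarrow> ((\<lambda>k. a k * vec_monomial k z) has_sum \<phi> z) UNIV"
  shows "\<exists>Q. \<forall>F \<rho>. finite F \<longrightarrow> 0 < \<rho> \<longrightarrow> \<rho> < 1 \<longrightarrow>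
     (\<Sum>k\<in>F. real (k $ j) powr \<alpha> * (norm (a k))\<^sup>2 * (\<rho> ^ (\<Sum>i\<in>UNIV. k $ i))\<^sup>2) \<le> Q"
proof -
  let ?C = "(2 * pi) ^ CARD('n)"
  obtain P where P: "\<And>\<rho>. 0 < \<rho> \<Longrightarrow> \<rho> < 1 \<Longrightarrow> (\<integral>z. norm (deriv (dilate \<phi> j \<rho> z) 0) powr \<alpha> \<partial>torus_space) \<le> P"
    using hardy_space_dilate_bound[OF \<phi> bd B \<alpha>(1) H] by auto
  show ?thesis
  proof (cases "\<alpha> = 2")
    case True
    show ?thesis
    proof (intro exI[of _ "P / ?C"] allI impI)
      fix F :: "(nat ^ 'n) set" and \<rho> :: real assume F: "finite F" and \<rho>: "0 < \<rho>" "\<rho> < 1"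
      interpret rotating_family torus_space "dilate \<phi> j \<rho>" "- ln \<rho>" B "rot j"
        by (rule rotating_family_dilate[OF \<phi> bd B \<rho>])
      have "energy 0 = (\<integral>z. norm (deriv (dilate \<phi> j \<rho> z) 0) powr \<alpha> \<partial>torus_space)"
        by (simp add: energy_def D_def True)
      then have "?C * (\<Sum>k\<in>F. (real (k $ j))\<^sup>2 * (norm (a k))\<^sup>2 * (\<rho> ^ (\<Sum>i\<in>UNIV. k $ i))\<^sup>2) \<le> P"
        using energy_dilate_ge[OF \<phi> bd B \<rho> a order_refl F, of j] P[OF \<rho>] by simp
      then show "(\<Sum>k\<in>F. real (k $ j) powr \<alpha> * (norm (a k))\<^sup>2 * (\<rho> ^ (\<Sum>i\<in>UNIV. k $ i))\<^sup>2) \<le> P / ?C"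
        by (simp add: True field_simps)
    qed
  next
    case False
    then have \<alpha>2: "\<alpha> < 2" using \<alpha> by simp
    define R where "R = B\<^sup>2 * ?C + 2 * B powr (2 - \<alpha>) / (2 - \<alpha>) / \<alpha>\<^sup>2 * P"
    \<comment> \<open>The factors come from the interpolation inequality, from the mass in Bessel's
      inequality, and from the lower bound for the exponential integral.\<close>
    define E where "E = (2 - \<alpha>) / 2 * ?C * (exp (- 2 :: real) / 4)"
    have E: "E > 0" using \<alpha>2 by (simp add: E_def)
    show ?thesis
    proof (intro exI[of _ "R / E"] allI impI)
      fix F :: "(nat ^ 'n) set" and \<rho> :: real assume F: "finite F" and \<rho>: "0 < \<rho>" "\<rho> < 1"
      interpret rotating_family torus_space "dilate \<phi> j \<rho>" "- ln \<rho>" B "rot j"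
        by (rule rotating_family_dilate[OF \<phi> bd B \<rho>])
      define N where "N = (\<Sum>k\<in>F. k $ j)"
      \<comment> \<open>Small enough that the window from 1/(2 k_j) to 1/k_j lies in the range of
        integration for every k in F; N is merely a convenient majorant of all k_j.\<close>
      define \<eta> where "\<eta> = 1 / (2 * (real N + 1))"
      have \<eta>: "0 < \<eta>" "\<eta> < 1" by (auto simp: \<eta>_def field_simps)
      define d where "d k = (norm (a k))\<^sup>2 * (\<rho> ^ (\<Sum>i\<in>UNIV. k $ i))\<^sup>2" for k
      have d: "d k \<ge> 0" for k by (simp add: d_def)
      let ?g = "\<lambda>k y. exp (- 2 * real (k $ j) * y) * y powr (1 - \<alpha>)"
      have g_int: "?g k integrable_on {\<eta>..1}" for k :: "nat ^ 'n"
        using \<eta> by (intro integrable_continuous_real continuous_intros) auto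
      have summand: "real (k $ j) powr \<alpha> * d k * (exp (- 2) / 4) \<le> (real (k $ j))\<^sup>2 * d k * integral {\<eta>..1} (?g k)"
        if k: "k \<in> F" for k
      \<comment> \<open>Indices with k_j = 0 are invisible to the derivative: both sides vanish, as
        \<open>0 powr \<alpha>\<close> is 0. They are recovered later from the square sum of all
        coefficients.\<close>
      proof (cases "k $ j = 0")
        case False
        then have kj: "real (k $ j) \<ge> 1" by simp
        have "k $ j \<le> N"
          unfolding N_def using F k by (intro member_le_sum) auto
        then have "\<eta> \<le> 1 / (2 * real (k $ j))"
          using kj by (simp add: \<eta>_def field_simps)
        from integral_exp_powr_ge[OF kj \<alpha>(1) \<alpha>2 \<eta>(1) this]
        have "(real (k $ j))\<^sup>2 * d k * (exp (- 2) / 4 * real (k $ j) powr (\<alpha> - 2)) \<le> (real (k $ j))\<^sup>2 * d k * integral {\<eta>..1} (?g k)"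
          using d by (intro mult_left_mono) auto
        moreover have "(real (k $ j))\<^sup>2 * d k * (exp (- 2) / 4 * real (k $ j) powr (\<alpha> - 2)) = real (k $ j) powr \<alpha> * d k * (exp (- 2) / 4)"
        proof -
          have "(real (k $ j))\<^sup>2 * real (k $ j) powr (\<alpha> - 2) = real (k $ j) powr \<alpha>"
            using kj powr_add[of "real (k $ j)" 2 "\<alpha> - 2"] by (simp add: powr_numeral)
          then have "(real (k $ j))\<^sup>2 * real (k $ j) powr (\<alpha> - 2) * (d k * (exp (- 2) / 4)) = real (k $ j) powr \<alpha> * (d k * (exp (- 2) / 4))"
            by (rule arg_cong)
          then show ?thesis by (simp only: mult_ac)
        qed
        ultimately show ?thesis by (simp only:)
      qed simp
      have "?C * (\<Sum>k\<in>F. real (k $ j) powr \<alpha> * d k) * (exp (- 2) / 4)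
          = ?C * (\<Sum>k\<in>F. real (k $ j) powr \<alpha> * d k * (exp (- 2) / 4))"
        by (simp add: sum_distrib_right mult.assoc)
      also have "\<dots> \<le> ?C * (\<Sum>k\<in>F. (real (k $ j))\<^sup>2 * d k * integral {\<eta>..1} (?g k))"
        by (intro mult_left_mono sum_mono summand) auto
      also have "\<dots> = integral {\<eta>..1} (\<lambda>y. ?C * (\<Sum>k\<in>F. (real (k $ j))\<^sup>2 * d k * ?g k y))"
        by (subst integral_mult_right, subst integral_sum[OF F]) (use g_int in \<open>auto intro!: integrable_on_mult_right\<close>)
      also have "\<dots> \<le> integral {\<eta>..1} (\<lambda>y. energy y * y powr (1 - \<alpha>))"
      proof (rule integral_le)
        show "(\<lambda>y. ?C * (\<Sum>k\<in>F. (real (k $ j))\<^sup>2 * d k * ?g k y)) integrable_on {\<eta>..1}"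
          by (intro integrable_on_mult_right integrable_sum F g_int)
        show "(\<lambda>y. energy y * y powr (1 - \<alpha>)) integrable_on {\<eta>..1}"
          using \<eta> by (intro integrable_continuous_real continuous_on_mult continuous_on_energy continuous_on_powr continuous_intros) auto
        show "?C * (\<Sum>k\<in>F. (real (k $ j))\<^sup>2 * d k * ?g k y) \<le> energy y * y powr (1 - \<alpha>)" if y: "y \<in> {\<eta>..1}" for y
        proof -
          have "?C * (\<Sum>k\<in>F. (real (k $ j))\<^sup>2 * (norm (a k))\<^sup>2 * (\<rho> ^ (\<Sum>i\<in>UNIV. k $ i))\<^sup>2 * exp (- 2 * real (k $ j) * y)) \<le> energy y"
            by (rule energy_dilate_ge[OF \<phi> bd B \<rho> a _ F]) (use y \<eta> in auto)
          from mult_right_mono[OF this, of "y powr (1 - \<alpha>)"] show ?thesis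
            by (simp add: sum_distrib_right d_def mult.assoc)
        qed
      qed
      finally have 1: "?C * (\<Sum>k\<in>F. real (k $ j) powr \<alpha> * d k) * (exp (- 2) / 4) \<le> integral {\<eta>..1} (\<lambda>y. energy y * y powr (1 - \<alpha>))" .
      have "E * (\<Sum>k\<in>F. real (k $ j) powr \<alpha> * d k)
          = (2 - \<alpha>) / 2 * (?C * (\<Sum>k\<in>F. real (k $ j) powr \<alpha> * d k) * (exp (- 2) / 4))"
        by (simp add: E_def)
      also have "\<dots> \<le> (2 - \<alpha>) / 2 * integral {\<eta>..1} (\<lambda>y. energy y * y powr (1 - \<alpha>))"
        using 1 \<alpha>2 by (intro mult_left_mono) auto
      also have "\<dots> \<le> B\<^sup>2 * measure (torus_space :: (complex ^ 'n) measure) (space torus_space)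
          + 2 * B powr (2 - \<alpha>) / (2 - \<alpha>) / \<alpha>\<^sup>2 * (\<integral>z. norm (D 1 z 0) powr \<alpha> \<partial>torus_space)"
        by (rule interpolation[OF \<alpha>(1) \<alpha>2 \<eta>])
      also have "\<dots> \<le> R"
        unfolding R_def using P[OF \<rho>] B \<alpha> \<alpha>2
        by (intro add_mono mult_left_mono) (auto simp: measure_torus_space D_def)
      finally show "(\<Sum>k\<in>F. real (k $ j) powr \<alpha> * (norm (a k))\<^sup>2 * (\<rho> ^ (\<Sum>i\<in>UNIV. k $ i))\<^sup>2) \<le> R / E"
        using E by (simp add: d_def field_simps)
    qed
  qed
qed

text \<open>For k \<ge> 1 one has 1 + k \<le> 2k and 2^\<alpha> \<le> 4; the summand 1 covers k =
  0.\<close>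

lemma one_plus_powr_le:
  assumes "0 < \<alpha>" "\<alpha> \<le> 2"
  shows "(1 + real k) powr \<alpha> \<le> 4 * real k powr \<alpha> + 1"
proof (cases "k = 0")
  case False
  then have "(1 + real k) powr \<alpha> \<le> (2 * real k) powr \<alpha>"
    using assms by (intro powr_mono2) auto
  also have "\<dots> = 2 powr \<alpha> * real k powr \<alpha>" by (simp add: powr_mult)
  also have "\<dots> \<le> 2 powr 2 * real k powr \<alpha>"
    using assms by (intro mult_right_mono powr_mono) auto
  finally show ?thesis by simp
qed simp

text \<open>The weighted bound is combined with the plain square sum bound B^2. For finite F the sum
  is a polynomial in \<rho>, so \<rho> may tend to 1 with the bound unchanged.\<close>

lemma one_plus_coeff_bound:
  fixes \<phi> :: "complex ^ 'n \<Rightarrow> complex"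
  assumes \<phi>: "holomorphic_vec_on \<phi> polydisc" and bd: "\<And>z. z \<in> polydisc \<Longrightarrow> norm (\<phi> z) \<le> B"
    and B: "B > 0" and \<alpha>: "0 < \<alpha>" "\<alpha> \<le> 2" and H: "partial_deriv j \<phi> \<in> hardy_space \<alpha>"
    and a: "\<And>z. z \<in> polydisc \<Longrightarrow> ((\<lambda>k. a k * vec_monomial k z) has_sum \<phi> z) UNIV"
  shows "\<exists>Q. \<forall>F. finite F \<longrightarrow> (\<Sum>k\<in>F. (1 + real (k $ j)) powr \<alpha> * (norm (a k))\<^sup>2) \<le> Q"
proof -
  obtain Q where Q: "\<And>F \<rho>. finite F \<Longrightarrow> 0 < \<rho> \<Longrightarrow> \<rho> < 1 \<Longrightarrow>
     (\<Sum>k\<in>F. real (k $ j) powr \<alpha> * (norm (a k))\<^sup>2 * (\<rho> ^ (\<Sum>i\<in>UNIV. k $ i))\<^sup>2) \<le> Q"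
    using weighted_coeff_bound[OF \<phi> bd B \<alpha> H a] by auto
  show ?thesis
  proof (intro exI[of _ "4 * Q + B\<^sup>2"] allI impI)
    fix F :: "(nat ^ 'n) set" assume F: "finite F"
    define S where "S \<rho> = (\<Sum>k\<in>F. (1 + real (k $ j)) powr \<alpha> * (norm (a k))\<^sup>2 * (\<rho> ^ (\<Sum>i\<in>UNIV. k $ i))\<^sup>2)" for \<rho> :: real
    have S_le: "S \<rho> \<le> 4 * Q + B\<^sup>2" if \<rho>: "0 < \<rho>" "\<rho> < 1" for \<rho>
    proof -
      have "S \<rho> \<le> (\<Sum>k\<in>F. (4 * real (k $ j) powr \<alpha> + 1) * (norm (a k))\<^sup>2 * (\<rho> ^ (\<Sum>i\<in>UNIV. k $ i))\<^sup>2)"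
        unfolding S_def by (intro sum_mono mult_right_mono one_plus_powr_le \<alpha>) auto
      also have "\<dots> = 4 * (\<Sum>k\<in>F. real (k $ j) powr \<alpha> * (norm (a k))\<^sup>2 * (\<rho> ^ (\<Sum>i\<in>UNIV. k $ i))\<^sup>2)
          + (\<Sum>k\<in>F. (norm (a k))\<^sup>2 * (\<rho> ^ (\<Sum>i\<in>UNIV. k $ i))\<^sup>2)"
        by (simp add: sum_distrib_left sum.distrib[symmetric] distrib_right mult.assoc)
      also have "\<dots> \<le> 4 * Q + B\<^sup>2"
        by (intro add_mono mult_left_mono Q F \<rho> square_sum_dilate_le[OF \<phi> bd B \<rho> a F]) auto
      finally show ?thesis .
    qed
    have lim: "(S \<longlongrightarrow> S 1) (at_left 1)"
      unfolding S_def by (intro tendsto_intros)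
    have "S 1 \<le> 4 * Q + B\<^sup>2"
    proof (rule tendsto_upperbound[OF lim])
      show "\<forall>\<^sub>F \<rho> in at_left 1. S \<rho> \<le> 4 * Q + B\<^sup>2"
        by (rule eventually_at_leftI[of 0]) (auto intro: S_le)
    qed auto
    then show "(\<Sum>k\<in>F. (1 + real (k $ j)) powr \<alpha> * (norm (a k))\<^sup>2) \<le> 4 * Q + B\<^sup>2"
      by (simp add: S_def)
  qed
qed

section \<open>Combining the variables\<close>

lemma prod_powr_le_sum:
  fixes x w :: "'i \<Rightarrow> real"
  assumes "finite I" and x: "\<And>i. i \<in> I \<Longrightarrow> 0 < x i" and w: "\<And>i. i \<in> I \<Longrightarrow> 0 \<le> w i" and "sum w I = 1"
  shows "(\<Prod>i\<in>I. x i powr w i) \<le> (\<Sum>i\<in>I. x i)"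
proof -
  have "I \<noteq> {}" using assms by auto
  then have pos: "sum x I > 0" using assms by (intro sum_pos) auto
  \<comment> \<open>Each factor is compared with the total, and the exponents add up to 1; the
    sharper weighted AM-GM is not called for.\<close>
  have "(\<Prod>i\<in>I. x i powr w i) \<le> (\<Prod>i\<in>I. sum x I powr w i)"
  proof (intro prod_mono conjI powr_mono2 w)
    show "x i \<le> sum x I" if "i \<in> I" for i
      using assms(1) x that by (intro member_le_sum) (auto intro: less_imp_le)
  qed (use x in \<open>auto intro: less_imp_le\<close>)
  also have "\<dots> = sum x I powr (sum w I)"
    using pos assms(1) by (simp add: powr_sum)
  finally show ?thesis using pos assms(4) by simp
qed

lemma dirichlet_space_of_hardy_derivatives:
  fixes \<phi> :: "complex ^ 'n \<Rightarrow> complex" and \<alpha> c :: "real ^ 'n"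
  assumes \<phi>: "holomorphic_vec_on \<phi> polydisc" and bd: "bounded (\<phi> ` polydisc)"
    and \<alpha>: "\<And>k. 0 < \<alpha> $ k" "\<And>k. \<alpha> $ k \<le> 2"
    and H: "\<And>k. partial_deriv k \<phi> \<in> hardy_space (\<alpha> $ k)"
    and c: "\<And>j. c $ j > 0" "(\<Sum>i\<in>UNIV. inverse (c $ i)) = 1"
  shows "\<phi> \<in> dirichlet_space (\<chi> j. \<alpha> $ j / c $ j)"
proof -
  obtain B where B: "B > 0" "\<And>z. z \<in> polydisc \<Longrightarrow> norm (\<phi> z) \<le> B"
    using bd unfolding bounded_pos by auto
  have "sep_holo B \<phi>"
    unfolding sep_holo_def using B holomorphic_vec_upd[OF \<phi>] by auto
  then obtain a where a: "\<And>z. z \<in> polydisc \<Longrightarrow> ((\<lambda>k. a k * vec_monomial k z) has_sum \<phi> z) UNIV"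
    using sep_holo_power_series[of B \<phi>] B by (metis less_imp_le)
  have "\<forall>j. \<exists>Q. \<forall>F. finite F \<longrightarrow> (\<Sum>k\<in>F. (1 + real (k $ j)) powr (\<alpha> $ j) * (norm (a k))\<^sup>2) \<le> Q"
    using one_plus_coeff_bound[OF \<phi> B(2,1) \<alpha> H a] by (rule allI)
  from choice[OF this] obtain Q where
    Q: "finite F \<Longrightarrow> (\<Sum>k\<in>F. (1 + real (k $ j)) powr (\<alpha> $ j) * (norm (a k))\<^sup>2) \<le> Q j" for j F
    by auto
  have "(\<lambda>k. (\<Prod>i\<in>UNIV. (1 + real (k $ i)) powr (\<alpha> $ i / c $ i)) * (norm (a k))\<^sup>2) summable_on UNIV"
  proof (rule nonneg_bdd_above_summable_on)
    show "bdd_above (sum (\<lambda>k. (\<Prod>i\<in>UNIV. (1 + real (k $ i)) powr (\<alpha> $ i / c $ i)) * (norm (a k))\<^sup>2) ` {F. F \<subseteq> UNIV \<and> finite F})"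
    proof (rule bdd_aboveI2)
      fix F :: "(nat ^ 'n) set" assume "F \<in> {F. F \<subseteq> UNIV \<and> finite F}"
      then have F: "finite F" by simp
      \<comment> \<open>The one-variable weights (1 + k_i)^(\<alpha>_i) are averaged with exponents
        1/c_i, which is where the condition on the sum of the inverses enters.\<close>
      have "(\<Prod>i\<in>UNIV. (1 + real (k $ i)) powr (\<alpha> $ i / c $ i)) \<le> (\<Sum>i\<in>UNIV. (1 + real (k $ i)) powr (\<alpha> $ i))" for k :: "nat ^ 'n"
        using prod_powr_le_sum[of UNIV "\<lambda>i. (1 + real (k $ i)) powr (\<alpha> $ i)" "\<lambda>i. inverse (c $ i)"] c
        by (simp add: powr_powr divide_inverse less_imp_le add_pos_nonneg)
      then have "(\<Sum>k\<in>F. (\<Prod>i\<in>UNIV. (1 + real (k $ i)) powr (\<alpha> $ i / c $ i)) * (norm (a k))\<^sup>2)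
          \<le> (\<Sum>k\<in>F. (\<Sum>i\<in>UNIV. (1 + real (k $ i)) powr (\<alpha> $ i)) * (norm (a k))\<^sup>2)"
        by (intro sum_mono mult_right_mono) auto
      also have "\<dots> = (\<Sum>i\<in>UNIV. \<Sum>k\<in>F. (1 + real (k $ i)) powr (\<alpha> $ i) * (norm (a k))\<^sup>2)"
        unfolding sum_distrib_right by (rule sum.swap)
      also have "\<dots> \<le> (\<Sum>i\<in>UNIV. Q i)"
        by (intro sum_mono Q F)
      finally show "(\<Sum>k\<in>F. (\<Prod>i\<in>UNIV. (1 + real (k $ i)) powr (\<alpha> $ i / c $ i)) * (norm (a k))\<^sup>2) \<le> (\<Sum>i\<in>UNIV. Q i)" .
    qed
  qed (auto intro!: mult_nonneg_nonneg prod_nonneg)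
  then show ?thesis
    unfolding dirichlet_space_def using \<phi> a by auto
qed

theorem theorem1:
  fixes \<phi> :: "complex ^ 'n \<Rightarrow> complex" and \<alpha> :: "real ^ 'n"
  assumes "rational_inner \<phi>"
    and "\<forall>k. 0 < \<alpha> $ k \<and> \<alpha> $ k \<le> 2"
    and "\<forall>k. partial_deriv k \<phi> \<in> hardy_space (\<alpha> $ k)"
  shows "(\<forall>c :: real ^ 'n. (\<forall>j. c $ j > 0) \<and> (\<Sum>i\<in>UNIV. inverse (c $ i)) = 1 \<longrightarrow>
            \<phi> \<in> dirichlet_space (\<chi> j. \<alpha> $ j / c $ j)) \<and>
         \<phi> \<in> dirichlet_space (\<chi> j. \<alpha> $ j / real CARD('n))"
proof -
  have *: "\<phi> \<in> dirichlet_space (\<chi> j. \<alpha> $ j / c $ j)"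
    if "\<forall>j. c $ j > 0" "(\<Sum>i\<in>UNIV. inverse (c $ i)) = 1" for c :: "real ^ 'n"
    using assms that unfolding rational_inner_def
    by (intro dirichlet_space_of_hardy_derivatives) auto
  moreover have "\<phi> \<in> dirichlet_space (\<chi> j. \<alpha> $ j / real CARD('n))"
    \<comment> \<open>With all c_j equal to n, the n inverses add up to 1.\<close>
    using *[of "\<chi> j. real CARD('n)"] by simp
  ultimately show ?thesis by blast
qed

end
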